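(* For all $k\in\mathcal{M}(W)$, the composite map $$(1\times\pi_k)\,q:\ \mathbf{V}\to V\times_{V/\!/W}V\to V\times_{V/\!/W}V_k$$ factors through $\boldsymbol{\pi}_{2k+1}:\mathbf{V}\to\mathbf{V}_{2k+1}$, inducing an isomorphism of $\mathbf{k}$-schemes $$q_k:\ \mathbf{V}_{2k+1}\;\xrightarrow{\ \sim\ }\;V\times_{V/\!/W}V_k .$$ Equivalently, for all $k\in\mathcal{M}(W)$, the algebra map $$\varphi:\ \mathbf{k}[V]\otimes_{\mathbf{k}[V]^W}\mathbf{k}[V]\to\mathbf{k}[V]\otimes\mathbf{k}[W],\qquad f\otimes g\mapsto\sum_{w\in W}f\,w(g)\otimes w,$$ restricts to an isomorphism of $\mathbf{k}$-algebras $$\varphi_k:\ \mathbf{k}[V]\otimes_{\mathbf{k}[V]^W}Q_k(W)\;\xrightarrow{\ \sim\ }\;\mathbf{Q}_{2k+1}(W).$$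
   Context: Let $\mathbf{k}$ be a field of characteristic zero, $W$ a finite Coxeter group and $V$ a finite-dimensional $\mathbf{k}$-vector space carrying a reflection representation of $W$. Let $\mathcal{A}$ be the set of reflection hyperplanes; for each fix a linear form $\alpha\in V^*$ with $H_\alpha=\mathrm{Ker}(\alpha)$ (we write $\alpha\in\mathcal{A}$), and let $s_\alpha\in W$ be the corresponding reflection. $\mathcal{M}(W)$ is the set of $W$-invariant functions $k:\mathcal{A}\to\mathbb{Z}_{\ge0}$, $\alpha\mapsto k_\alpha$; $2k+1$ is the function $\alpha\mapsto 2k_\alpha+1$. $V$ also denotes $\mathrm{Spec}\,\mathbf{k}[V]$, and $V/\!/W=\mathrm{Spec}\,\mathbf{k}[V]^W$. Quasi-invariants: $Q_k(W)=\{p\in\mathbf{k}[V]: s_\alpha(p)\equiv p\bmod\langle\alpha\rangle^{2k_\alpha}\ \forall\alpha\in\mathcal{A}\}$, $V_k=\mathrm{Spec}\,Q_k(W)$, and $\pi_k:V\to V_k$ is the map dual to the inclusion $Q_k(W)\subseteq\mathbf{k}[V]$. $\mathbf{V}=V\times W$ is the disjoint union of copies of $V$ indexed by $W$, with $\mathbf{k}[\mathbf{V}]=\prod_{w\in W}\mathbf{k}[V]\cong\mathbf{k}[V]\otimes\mathbf{k}[W]$, $(p_w)_w\leftrightarrow\sum_wp_w\otimes w$, and componentwise multiplication. Quasi-covariants: for $m\in\mathcal{M}(W)$, $\mathbf{Q}_m(W)=\{(p_w)_{w\in W}\in\prod_{w}\mathbf{k}[V]: p_w\equiv p_{s_\alpha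 w}\bmod\langle\alpha\rangle^{m_\alpha}\ \forall\,\alpha\in\mathcal{A},\ w\in W\}$, $\mathbf{V}_m=\mathrm{Spec}\,\mathbf{Q}_m(W)$, and $\boldsymbol{\pi}_m:\mathbf{V}\to\mathbf{V}_m$ is dual to the inclusion $\mathbf{Q}_m(W)\subseteq\mathbf{k}[\mathbf{V}]$. The map $q:\mathbf{V}\to V\times_{V/\!/W}V$ is $(v,w)\mapsto(v,w^{-1}v)$; its dual is $\varphi$. *)

theory Defs
  imports "HOL-Algebra.Algebra" "HOL-Algebra.Algebraic_Closure_Type"
begin

section \<open>Coxeter systems and reflection representations\<close>

definition word_val :: "('w, 'm) monoid_scheme \<Rightarrow> 'w list \<Rightarrow> 'w" where
  "word_val W ws = foldr (\<lambda>x y. x \<otimes>\<^bsub>W\<^esub> y) ws \<one>\<^bsub>W\<^esub>"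

definition coxeter_relator :: "('w, 'm) monoid_scheme \<Rightarrow> 'w \<Rightarrow> 'w \<Rightarrow> 'w list" where
  "coxeter_relator W s t = concat (replicate (group.ord W (s \<otimes>\<^bsub>W\<^esub> t)) [s, t])"

text \<open>
  The congruence on words over \<open>S\<close> generated by \<open>(s t)\<^sup>m = 1\<close> with \<open>m = ord (s t)\<close>.
  The case \<open>s = t\<close> gives \<open>s s = 1\<close>, so for involutive generators the quotient monoid is the
  group presented by these relators. If \<open>s t\<close> has infinite order, \<open>group.ord\<close> is \<open>0\<close>
  and no relation is imposed.
\<close>
inductive coxeter_equiv :: "('w, 'm) monoid_scheme \<Rightarrow> 'w set \<Rightarrow> 'w list \<Rightarrow> 'w list \<Rightarrow> bool"
  for W S where
  refl: "us \<in> lists S \<Longrightarrow> coxeter_equiv W S us us"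
| sym: "coxeter_equiv W S us vs \<Longrightarrow> coxeter_equiv W S vs us"
| trans: "coxeter_equiv W S us vs \<Longrightarrow> coxeter_equiv W S vs ws \<Longrightarrow> coxeter_equiv W S us ws"
| relator: "us \<in> lists S \<Longrightarrow> vs \<in> lists S \<Longrightarrow> s \<in> S \<Longrightarrow> t \<in> S \<Longrightarrow>
    coxeter_equiv W S (us @ coxeter_relator W s t @ vs) (us @ vs)"

text \<open>\<open>(W, S)\<close> is a Coxeter system: \<open>W\<close> is presented by \<open>\<langle>S | (s t)\<^bsup>m(s,t)\<^esup> = 1\<rangle>\<close>.\<close>
definition coxeter_system :: "('w, 'm) monoid_scheme \<Rightarrow> 'w set \<Rightarrow> bool" where
  "coxeter_system W S \<longleftrightarrow>
     group W \<and> S \<subseteq> carrier W \<and> generate W S = carrier W \<and>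
     (\<forall>s\<in>S. group.ord W s = 2) \<and>
     (\<forall>us\<in>lists S. \<forall>vs\<in>lists S. word_val W us = word_val W vs \<longrightarrow> coxeter_equiv W S us vs)"

abbreviation linear_form :: "('k::field \<Rightarrow> 'v::ab_group_add \<Rightarrow> 'v) \<Rightarrow> ('v \<Rightarrow> 'k) \<Rightarrow> bool" where
  "linear_form sc a \<equiv> Vector_Spaces.linear sc (*) a"

definition fixed_space :: "('v \<Rightarrow> 'v) \<Rightarrow> 'v set" where
  "fixed_space r = {v. r v = v}"

definition is_hyperplane :: "('k::field \<Rightarrow> 'v::ab_group_add \<Rightarrow> 'v) \<Rightarrow> 'v set \<Rightarrow> bool" where
  "is_hyperplane sc H \<longleftrightarrow>
     (\<exists>a. linear_form sc a \<and> a \<noteq> (\<lambda>_. 0) \<and> H = {v. a v = 0})"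

definition is_reflection :: "('k::field \<Rightarrow> 'v::ab_group_add \<Rightarrow> 'v) \<Rightarrow> ('v \<Rightarrow> 'v) \<Rightarrow> bool" where
  "is_reflection sc r \<longleftrightarrow>
     Vector_Spaces.linear sc sc r \<and> r \<circ> r = id \<and> is_hyperplane sc (fixed_space r)"

text \<open>
  A reflection representation of \<open>(W, S)\<close> is a faithful finite-dimensional linear representation
  in which the elements of \<open>S\<close> act as reflections. Irreducibility or absence of
  fixed vectors is not required.
\<close>
definition reflection_representation ::
  "('k::field \<Rightarrow> 'v::ab_group_add \<Rightarrow> 'v) \<Rightarrow> ('w, 'm) monoid_scheme \<Rightarrow> 'w set \<Rightarrow> ('w \<Rightarrow> 'v \<Rightarrow> 'v) \<Rightarrow> bool"
  where
  "reflection_representation sc W S \<rho> \<longleftrightarrow>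
     (\<exists>B. finite_dimensional_vector_space sc B) \<and>
     (\<forall>w\<in>carrier W. Vector_Spaces.linear sc sc (\<rho> w)) \<and>
     \<rho> \<one>\<^bsub>W\<^esub> = id \<and>
     (\<forall>w\<in>carrier W. \<forall>w'\<in>carrier W. \<rho> (w \<otimes>\<^bsub>W\<^esub> w') = \<rho> w \<circ> \<rho> w') \<and>
     inj_on \<rho> (carrier W) \<and>
     (\<forall>s\<in>S. is_reflection sc (\<rho> s))"

definition reflection_hyperplanes ::
  "('k::field \<Rightarrow> 'v::ab_group_add \<Rightarrow> 'v) \<Rightarrow> ('w, 'm) monoid_scheme \<Rightarrow> ('w \<Rightarrow> 'v \<Rightarrow> 'v) \<Rightarrow> 'v set set"
  where
  "reflection_hyperplanes sc W \<rho> = {fixed_space (\<rho> w) | w. w \<in> carrier W \<and> is_reflection sc (\<rho> w)}"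

text \<open>
  The reflection in \<open>W\<close> with hyperplane \<open>H\<close>; unique since \<open>\<rho>\<close> is faithful, \<open>W\<close> finite and
  the characteristic zero.
\<close>
definition reflection_at ::
  "('k::field \<Rightarrow> 'v::ab_group_add \<Rightarrow> 'v) \<Rightarrow> ('w, 'm) monoid_scheme \<Rightarrow> ('w \<Rightarrow> 'v \<Rightarrow> 'v) \<Rightarrow> 'v set \<Rightarrow> 'w"
  where
  "reflection_at sc W \<rho> H =
     (THE w. w \<in> carrier W \<and> is_reflection sc (\<rho> w) \<and> fixed_space (\<rho> w) = H)"

definition multiplicities ::
  "('k::field \<Rightarrow> 'v::ab_group_add \<Rightarrow> 'v) \<Rightarrow> ('w, 'm) monoid_scheme \<Rightarrow> ('w \<Rightarrow> 'v \<Rightarrow> 'v) \<Rightarrow> ('v set \<Rightarrow> nat) set"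
  where
  "multiplicities sc W \<rho> =
     {k. \<forall>w\<in>carrier W. \<forall>H\<in>reflection_hyperplanes sc W \<rho>. k (\<rho> w ` H) = k H}"


section \<open>Commutative algebras over a field\<close>

abbreviation base_field :: "'k::field ring" where
  "base_field \<equiv> ring_of_type_algebra"

definition alg_hom :: "('k, 'a) module \<Rightarrow> ('k, 'b) module \<Rightarrow> ('a \<Rightarrow> 'b) set" where
  "alg_hom A B =
     {h \<in> ring_hom A B. \<forall>c. \<forall>x\<in>carrier A. h (c \<odot>\<^bsub>A\<^esub> x) = c \<odot>\<^bsub>B\<^esub> h x}"

definition alg_iso :: "('k, 'a) module \<Rightarrow> ('k, 'b) module \<Rightarrow> ('a \<Rightarrow> 'b) set" where
  "alg_iso A B = {h \<in> alg_hom A B. bij_betw h (carrier A) (carrier B)}"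

definition prod_alg :: "'i set \<Rightarrow> ('k, 'a) module \<Rightarrow> ('k, 'i \<Rightarrow> 'a) module" where
  "prod_alg I A =
     \<lparr>carrier = (\<Pi>\<^sub>E i\<in>I. carrier A),
      monoid.mult = (\<lambda>p q. \<lambda>i\<in>I. p i \<otimes>\<^bsub>A\<^esub> q i),
      monoid.one = (\<lambda>i\<in>I. \<one>\<^bsub>A\<^esub>),
      ring.zero = (\<lambda>i\<in>I. \<zero>\<^bsub>A\<^esub>),
      ring.add = (\<lambda>p q. \<lambda>i\<in>I. p i \<oplus>\<^bsub>A\<^esub> q i),
      module.smult = (\<lambda>c p. \<lambda>i\<in>I. c \<odot>\<^bsub>A\<^esub> p i)\<rparr>"


subsection \<open>Tensor products\<close>

text \<open>
  The tensor product of two commutative rings \<open>A\<close>, \<open>B\<close> over a common subring \<open>R\<close> is the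
  quotient of the free abelian group on \<open>A \<times> B\<close> by the biadditivity and \<open>R\<close>-balancing
  relations. The free abelian group carries the product determined by
  \<open>(a, b) (a', b') = (a a', b b')\<close>, i.e. it is the integral monoid ring of \<open>A \<times> B\<close>; since
  the set of relations is stable under multiplication by basis elements, the subgroup it
  generates is the ideal it generates.
\<close>
definition int_monoid_ring :: "('m, 'x) monoid_scheme \<Rightarrow> ('m \<Rightarrow>\<^sub>0 int) ring" where
  "int_monoid_ring M =
     \<lparr>carrier = {c. Poly_Mapping.keys c \<subseteq> carrier M},
      monoid.mult = (\<lambda>c d. frag_extend (\<lambda>x. frag_extend (\<lambda>y. frag_of (x \<otimes>\<^bsub>M\<^esub> y)) d) c),
      monoid.one = frag_of \<one>\<^bsub>M\<^esub>,
      ring.zero = 0,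
      ring.add = (+)\<rparr>"

definition tensor_relations ::
  "'a set \<Rightarrow> ('k, 'a) module \<Rightarrow> ('k, 'a) module \<Rightarrow> ('a \<times> 'a \<Rightarrow>\<^sub>0 int) set" where
  "tensor_relations R A B =
     {frag_of (a \<oplus>\<^bsub>A\<^esub> a', b) - frag_of (a, b) - frag_of (a', b) | a a' b.
        a \<in> carrier A \<and> a' \<in> carrier A \<and> b \<in> carrier B} \<union>
     {frag_of (a, b \<oplus>\<^bsub>B\<^esub> b') - frag_of (a, b) - frag_of (a, b') | a b b'.
        a \<in> carrier A \<and> b \<in> carrier B \<and> b' \<in> carrier B} \<union>
     {frag_of (a \<otimes>\<^bsub>A\<^esub> r, b) - frag_of (a, r \<otimes>\<^bsub>B\<^esub> b) | a r b.
        a \<in> carrier A \<and> r \<in> R \<and> b \<in> carrier B}"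

definition tensor_ideal ::
  "'a set \<Rightarrow> ('k, 'a) module \<Rightarrow> ('k, 'a) module \<Rightarrow> ('a \<times> 'a \<Rightarrow>\<^sub>0 int) set" where
  "tensor_ideal R A B = Idl\<^bsub>int_monoid_ring (A \<times>\<times> B)\<^esub> (tensor_relations R A B)"

definition tensor_ring ::
  "'a set \<Rightarrow> ('k, 'a) module \<Rightarrow> ('k, 'a) module \<Rightarrow> ('a \<times> 'a \<Rightarrow>\<^sub>0 int) set ring" where
  "tensor_ring R A B = int_monoid_ring (A \<times>\<times> B) Quot tensor_ideal R A B"

definition pure_tensor ::
  "'a set \<Rightarrow> ('k, 'a) module \<Rightarrow> ('k, 'a) module \<Rightarrow> 'a \<Rightarrow> 'a \<Rightarrow> ('a \<times> 'a \<Rightarrow>\<^sub>0 int) set" where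
  "pure_tensor R A B a b = tensor_ideal R A B +>\<^bsub>int_monoid_ring (A \<times>\<times> B)\<^esub> frag_of (a, b)"

definition tensor_alg ::
  "'a set \<Rightarrow> ('k, 'a) module \<Rightarrow> ('k, 'a) module \<Rightarrow> ('k, ('a \<times> 'a \<Rightarrow>\<^sub>0 int) set) module" where
  "tensor_alg R A B =
     \<lparr>carrier = carrier (tensor_ring R A B),
      monoid.mult = monoid.mult (tensor_ring R A B),
      monoid.one = monoid.one (tensor_ring R A B),
      ring.zero = ring.zero (tensor_ring R A B),
      ring.add = ring.add (tensor_ring R A B),
      module.smult = (\<lambda>c t. pure_tensor R A B (c \<odot>\<^bsub>A\<^esub> \<one>\<^bsub>A\<^esub>) \<one>\<^bsub>B\<^esub> \<otimes>\<^bsub>tensor_ring R A B\<^esub> t)\<rparr>"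


subsection \<open>Affine schemes as functors of points\<close>

text \<open>
  A \<open>k\<close>-scheme is represented by its functor of points on commutative \<open>k\<close>-algebras. HOL
  cannot quantify over types inside a formula, so the test algebras range over all
  algebra structures on subsets of one type \<open>'c\<close>; a statement with \<open>'c\<close> free holds for
  all of them. The morphism part of a functor records only the target-independent
  action of a homomorphism of test algebras.
\<close>
record ('k, 'c, 'p) k_functor =
  pts :: "('k, 'c) module \<Rightarrow> 'p set"
  push :: "('c \<Rightarrow> 'c) \<Rightarrow> 'p \<Rightarrow> 'p"

abbreviation is_k_algebra :: "('k::field, 'c) module \<Rightarrow> bool" where
  "is_k_algebra C \<equiv> algebra base_field C"

definition functor_morphism ::
  "('k::field, 'c, 'p) k_functor \<Rightarrow> ('k, 'c, 'q) k_functor \<Rightarrow> (('k, 'c) module \<Rightarrow> 'p \<Rightarrow> 'q) \<Rightarrow> bool" where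
  "functor_morphism F G \<tau> \<longleftrightarrow>
     (\<forall>C. is_k_algebra C \<longrightarrow> \<tau> C \<in> pts F C \<rightarrow> pts G C) \<and>
     (\<forall>C D h. is_k_algebra C \<and> is_k_algebra D \<and> h \<in> alg_hom C D \<longrightarrow>
        (\<forall>\<xi>\<in>pts F C. \<tau> D (push F h \<xi>) = push G h (\<tau> C \<xi>)))"

definition functor_isomorphism ::
  "('k::field, 'c, 'p) k_functor \<Rightarrow> ('k, 'c, 'q) k_functor \<Rightarrow> (('k, 'c) module \<Rightarrow> 'p \<Rightarrow> 'q) \<Rightarrow> bool" where
  "functor_isomorphism F G \<tau> \<longleftrightarrow>
     functor_morphism F G \<tau> \<and> (\<forall>C. is_k_algebra C \<longrightarrow> bij_betw (\<tau> C) (pts F C) (pts G C))"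

text \<open>Points are extensional functions, so that equal homomorphisms are equal points.\<close>
definition Spec :: "('k, 'a) module \<Rightarrow> ('k, 'c, 'a \<Rightarrow> 'c) k_functor" where
  "Spec A = \<lparr>pts = (\<lambda>C. alg_hom A C \<inter> extensional (carrier A)),
             push = (\<lambda>h \<xi>. compose (carrier A) h \<xi>)\<rparr>"

text \<open>The morphism \<open>Spec B \<rightarrow> Spec A\<close> dual to \<open>h : A \<rightarrow> B\<close>.\<close>
definition Spec_map :: "('k, 'a) module \<Rightarrow> ('a \<Rightarrow> 'b) \<Rightarrow> ('k, 'c) module \<Rightarrow> ('b \<Rightarrow> 'c) \<Rightarrow> ('a \<Rightarrow> 'c)" where
  "Spec_map A h C \<xi> = compose (carrier A) \<xi> h"

definition fibre_product ::
  "('k, 'c, 'p) k_functor \<Rightarrow> (('k, 'c) module \<Rightarrow> 'p \<Rightarrow> 's) \<Rightarrow>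
   ('k, 'c, 'q) k_functor \<Rightarrow> (('k, 'c) module \<Rightarrow> 'q \<Rightarrow> 's) \<Rightarrow> ('k, 'c, 'p \<times> 'q) k_functor" where
  "fibre_product F f G g =
     \<lparr>pts = (\<lambda>C. {(x, y). x \<in> pts F C \<and> y \<in> pts G C \<and> f C x = g C y}),
      push = (\<lambda>h. map_prod (push F h) (push G h))\<rparr>"


section \<open>Quasi-invariants and quasi-covariants\<close>

text \<open>
  \<open>k[V]\<close> is realised as the algebra of polynomial functions on \<open>V\<close>, generated by the constants
  and \<open>V\<^sup>*\<close>. Over an infinite field (in particular in characteristic zero) this is the
  symmetric algebra of \<open>V\<^sup>*\<close>.
\<close>
inductive_set polynomial_functions ::
  "('k::field \<Rightarrow> 'v::ab_group_add \<Rightarrow> 'v) \<Rightarrow> ('v \<Rightarrow> 'k) set"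
  for sc where
  const: "(\<lambda>_. c) \<in> polynomial_functions sc"
| form: "linear_form sc a \<Longrightarrow> a \<in> polynomial_functions sc"
| add: "p \<in> polynomial_functions sc \<Longrightarrow> q \<in> polynomial_functions sc \<Longrightarrow>
    (\<lambda>v. p v + q v) \<in> polynomial_functions sc"
| mult: "p \<in> polynomial_functions sc \<Longrightarrow> q \<in> polynomial_functions sc \<Longrightarrow>
    (\<lambda>v. p v * q v) \<in> polynomial_functions sc"

definition coord_alg :: "('k::field \<Rightarrow> 'v::ab_group_add \<Rightarrow> 'v) \<Rightarrow> ('k, 'v \<Rightarrow> 'k) module" where
  "coord_alg sc =
     \<lparr>carrier = polynomial_functions sc,
      monoid.mult = (\<lambda>p q v. p v * q v),
      monoid.one = (\<lambda>_. 1),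
      ring.zero = (\<lambda>_. 0),
      ring.add = (\<lambda>p q v. p v + q v),
      module.smult = (\<lambda>c p v. c * p v)\<rparr>"

text \<open>The action of \<open>W\<close> on functions: \<open>(w g)(v) = g (w\<^sup>-\<^sup>1 v)\<close>.\<close>
definition act :: "('w, 'm) monoid_scheme \<Rightarrow> ('w \<Rightarrow> 'v \<Rightarrow> 'v) \<Rightarrow> 'w \<Rightarrow> ('v \<Rightarrow> 'k) \<Rightarrow> ('v \<Rightarrow> 'k)" where
  "act W \<rho> w g = (\<lambda>v. g (\<rho> (inv\<^bsub>W\<^esub> w) v))"

text \<open>\<open>p \<equiv> q mod \<langle>a\<rangle>\<^sup>n\<close>, the power being taken in the semiring of ideals of \<open>k[V]\<close>.\<close>
definition cong_mod ::
  "('k::field \<Rightarrow> 'v::ab_group_add \<Rightarrow> 'v) \<Rightarrow> ('v \<Rightarrow> 'k) \<Rightarrow> nat \<Rightarrow> ('v \<Rightarrow> 'k) \<Rightarrow> ('v \<Rightarrow> 'k) \<Rightarrow> bool" where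
  "cong_mod sc a n p q \<longleftrightarrow>
     (\<lambda>v. p v - q v) \<in> (PIdl\<^bsub>coord_alg sc\<^esub> a) [^]\<^bsub>ideals_set (coord_alg sc)\<^esub> n"

definition invariant_functions ::
  "('k::field \<Rightarrow> 'v::ab_group_add \<Rightarrow> 'v) \<Rightarrow> ('w, 'm) monoid_scheme \<Rightarrow> ('w \<Rightarrow> 'v \<Rightarrow> 'v) \<Rightarrow> ('v \<Rightarrow> 'k) set"
  where
  "invariant_functions sc W \<rho> = {p \<in> polynomial_functions sc. \<forall>w\<in>carrier W. act W \<rho> w p = p}"

abbreviation invariant_alg ::
  "('k::field \<Rightarrow> 'v::ab_group_add \<Rightarrow> 'v) \<Rightarrow> ('w, 'm) monoid_scheme \<Rightarrow> ('w \<Rightarrow> 'v \<Rightarrow> 'v) \<Rightarrow>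
   ('k, 'v \<Rightarrow> 'k) module" where
  "invariant_alg sc W \<rho> \<equiv> (coord_alg sc)\<lparr>carrier := invariant_functions sc W \<rho>\<rparr>"

definition quasi_invariants ::
  "('k::field \<Rightarrow> 'v::ab_group_add \<Rightarrow> 'v) \<Rightarrow> ('w, 'm) monoid_scheme \<Rightarrow> ('w \<Rightarrow> 'v \<Rightarrow> 'v) \<Rightarrow>
   ('v set \<Rightarrow> 'v \<Rightarrow> 'k) \<Rightarrow> ('v set \<Rightarrow> nat) \<Rightarrow> ('v \<Rightarrow> 'k) set" where
  "quasi_invariants sc W \<rho> \<alpha> k =
     {p \<in> polynomial_functions sc. \<forall>H\<in>reflection_hyperplanes sc W \<rho>.
        cong_mod sc (\<alpha> H) (2 * k H) (act W \<rho> (reflection_at sc W \<rho> H) p) p}"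

abbreviation quasi_invariant_alg ::
  "('k::field \<Rightarrow> 'v::ab_group_add \<Rightarrow> 'v) \<Rightarrow> ('w, 'm) monoid_scheme \<Rightarrow> ('w \<Rightarrow> 'v \<Rightarrow> 'v) \<Rightarrow>
   ('v set \<Rightarrow> 'v \<Rightarrow> 'k) \<Rightarrow> ('v set \<Rightarrow> nat) \<Rightarrow> ('k, 'v \<Rightarrow> 'k) module" where
  "quasi_invariant_alg sc W \<rho> \<alpha> k \<equiv> (coord_alg sc)\<lparr>carrier := quasi_invariants sc W \<rho> \<alpha> k\<rparr>"

text \<open>
  The coordinate algebra of \<open>V \<times> W\<close>; a family \<open>p\<close> corresponds to \<open>\<Sum>w. p w \<otimes> w\<close> in
  \<open>k[V] \<otimes> k[W]\<close>.
\<close>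
abbreviation coord_alg_W ::
  "('k::field \<Rightarrow> 'v::ab_group_add \<Rightarrow> 'v) \<Rightarrow> ('w, 'm) monoid_scheme \<Rightarrow> ('k, 'w \<Rightarrow> 'v \<Rightarrow> 'k) module" where
  "coord_alg_W sc W \<equiv> prod_alg (carrier W) (coord_alg sc)"

definition quasi_covariants ::
  "('k::field \<Rightarrow> 'v::ab_group_add \<Rightarrow> 'v) \<Rightarrow> ('w, 'm) monoid_scheme \<Rightarrow> ('w \<Rightarrow> 'v \<Rightarrow> 'v) \<Rightarrow>
   ('v set \<Rightarrow> 'v \<Rightarrow> 'k) \<Rightarrow> ('v set \<Rightarrow> nat) \<Rightarrow> ('w \<Rightarrow> 'v \<Rightarrow> 'k) set" where
  "quasi_covariants sc W \<rho> \<alpha> m =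
     {p \<in> carrier (coord_alg_W sc W). \<forall>H\<in>reflection_hyperplanes sc W \<rho>. \<forall>w\<in>carrier W.
        cong_mod sc (\<alpha> H) (m H) (p w) (p (reflection_at sc W \<rho> H \<otimes>\<^bsub>W\<^esub> w))}"

abbreviation quasi_covariant_alg ::
  "('k::field \<Rightarrow> 'v::ab_group_add \<Rightarrow> 'v) \<Rightarrow> ('w, 'm) monoid_scheme \<Rightarrow> ('w \<Rightarrow> 'v \<Rightarrow> 'v) \<Rightarrow>
   ('v set \<Rightarrow> 'v \<Rightarrow> 'k) \<Rightarrow> ('v set \<Rightarrow> nat) \<Rightarrow> ('k, 'w \<Rightarrow> 'v \<Rightarrow> 'k) module" where
  "quasi_covariant_alg sc W \<rho> \<alpha> m \<equiv> (coord_alg_W sc W)\<lparr>carrier := quasi_covariants sc W \<rho> \<alpha> m\<rparr>"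


subsection \<open>The schemes and morphisms\<close>

text \<open>\<open>V \<times>\<^bsub>V//W\<^esub> Spec B\<close> for \<open>k[V]\<^sup>W \<subseteq> B \<subseteq> k[V]\<close>; both maps to \<open>V//W\<close> are dual to inclusions.\<close>
definition fibre_product_over_quotient ::
  "('k::field \<Rightarrow> 'v::ab_group_add \<Rightarrow> 'v) \<Rightarrow> ('w, 'm) monoid_scheme \<Rightarrow> ('w \<Rightarrow> 'v \<Rightarrow> 'v) \<Rightarrow>
   ('k, 'v \<Rightarrow> 'k) module \<Rightarrow> ('k, 'c, (('v \<Rightarrow> 'k) \<Rightarrow> 'c) \<times> (('v \<Rightarrow> 'k) \<Rightarrow> 'c)) k_functor" where
  "fibre_product_over_quotient sc W \<rho> B =
     fibre_product (Spec (coord_alg sc)) (Spec_map (invariant_alg sc W \<rho>) (\<lambda>p. p))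
                   (Spec B) (Spec_map (invariant_alg sc W \<rho>) (\<lambda>p. p))"

text \<open>
  The morphism \<open>q : V \<times> W \<rightarrow> V \<times>\<^bsub>V//W\<^esub> V\<close>, \<open>(v, w) \<mapsto> (v, w\<^sup>-\<^sup>1 v)\<close>; the two components are
  given by pulling back functions along \<open>(v, w) \<mapsto> v\<close> and \<open>(v, w) \<mapsto> w\<^sup>-\<^sup>1 v\<close>.
\<close>
definition q_map ::
  "('k::field \<Rightarrow> 'v::ab_group_add \<Rightarrow> 'v) \<Rightarrow> ('w, 'm) monoid_scheme \<Rightarrow> ('w \<Rightarrow> 'v \<Rightarrow> 'v) \<Rightarrow>
   ('k, 'c) module \<Rightarrow> (('w \<Rightarrow> 'v \<Rightarrow> 'k) \<Rightarrow> 'c) \<Rightarrow> (('v \<Rightarrow> 'k) \<Rightarrow> 'c) \<times> (('v \<Rightarrow> 'k) \<Rightarrow> 'c)" where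
  "q_map sc W \<rho> C \<eta> =
     (Spec_map (coord_alg sc) (\<lambda>f. \<lambda>w\<in>carrier W. \<lambda>v. f v) C \<eta>,
      Spec_map (coord_alg sc) (\<lambda>g. \<lambda>w\<in>carrier W. \<lambda>v. g (\<rho> (inv\<^bsub>W\<^esub> w) v)) C \<eta>)"

definition pi_map ::
  "('k::field \<Rightarrow> 'v::ab_group_add \<Rightarrow> 'v) \<Rightarrow> ('w, 'm) monoid_scheme \<Rightarrow> ('w \<Rightarrow> 'v \<Rightarrow> 'v) \<Rightarrow>
   ('v set \<Rightarrow> 'v \<Rightarrow> 'k) \<Rightarrow> ('v set \<Rightarrow> nat) \<Rightarrow>
   ('k, 'c) module \<Rightarrow> (('v \<Rightarrow> 'k) \<Rightarrow> 'c) \<Rightarrow> (('v \<Rightarrow> 'k) \<Rightarrow> 'c)" where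
  "pi_map sc W \<rho> \<alpha> k = Spec_map (quasi_invariant_alg sc W \<rho> \<alpha> k) (\<lambda>p. p)"

definition bold_pi_map ::
  "('k::field \<Rightarrow> 'v::ab_group_add \<Rightarrow> 'v) \<Rightarrow> ('w, 'm) monoid_scheme \<Rightarrow> ('w \<Rightarrow> 'v \<Rightarrow> 'v) \<Rightarrow>
   ('v set \<Rightarrow> 'v \<Rightarrow> 'k) \<Rightarrow> ('v set \<Rightarrow> nat) \<Rightarrow>
   ('k, 'c) module \<Rightarrow> (('w \<Rightarrow> 'v \<Rightarrow> 'k) \<Rightarrow> 'c) \<Rightarrow> (('w \<Rightarrow> 'v \<Rightarrow> 'k) \<Rightarrow> 'c)" where
  "bold_pi_map sc W \<rho> \<alpha> m = Spec_map (quasi_covariant_alg sc W \<rho> \<alpha> m) (\<lambda>p. p)"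

end

theory Submission
  imports Defs
begin

text \<open>
  The proof avoids the theory of coinvariants. Let \<open>\<Delta>\<^sub>\<alpha> = (1 - s\<^sub>\<alpha>)/\<alpha>\<close>. Because \<open>2k+1\<close> is odd, the
  \<open>k[V] \<rtimes> W\<close>-module \<open>M\<close> of quasi-covariants is stable under all \<open>\<Delta>\<^sub>\<alpha>\<close>, and its invariants are
  the families \<open>(w(g))\<^sub>w\<close> with \<open>g\<close> quasi-invariant. Since \<open>\<Delta>\<^sub>\<alpha>\<close> lowers the degree and
  \<open>p - s\<^sub>\<alpha>(p) = \<alpha> \<Delta>\<^sub>\<alpha>(p)\<close>, induction on the degree shows that \<open>p\<close> agrees modulo \<open>k[V] M\<^sup>W\<close> with
  its average over \<open>W\<close>; so \<open>M = k[V] M\<^sup>W\<close>, which is surjectivity.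

  For injectivity let \<open>\<delta> = \<Prod> \<alpha>\<close>. Surjectivity for \<open>k = 0\<close>, applied to the family with value \<open>\<delta>\<close> at
  \<open>1\<close> and \<open>0\<close> elsewhere, yields \<open>a\<^sub>i, b\<^sub>i\<close> with \<open>\<Sum> a\<^sub>i w(b\<^sub>i) = \<delta>\<close> for \<open>w = 1\<close> and \<open>0\<close> otherwise. They are dual
  bases of \<open>k[V]\<close> over \<open>k[V]\<^sup>W\<close> for the form \<open>f \<mapsto> \<delta>\<inverse> \<Sum>\<^sub>w \<epsilon>(w)\<inverse> w\<inverse>(f)\<close>, where \<open>w\<inverse>(\<delta>) = \<epsilon>(w) \<delta>\<close>, and
  allow a tensor to be reconstructed from its image.
\<close>

section \<open>Polynomial functions\<close>

text \<open>The obstacle is that neither kernel nor image of the algebra map is visible; the usual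
  way in is the freeness of k[V] over k[V]^W, a theorem of its own. Both halves rest instead on
  linear forms: each generates a prime ideal, and forms of different hyperplanes are coprime.
  Oddness: dividing p - s(p) by \<alpha> costs one power of \<alpha> at the hyperplane of s itself.
  If m is odd, the relevant difference before division is \<alpha>^m (h - s(h)), and h - s(h)
  vanishes on the hyperplane, which restores the lost power; an even m would leave h + s(h).
  \<delta> is the least common multiple of the forms, hence the smallest value at 1 that a family
  vanishing elsewhere can have under all congruences modulo \<alpha>. The case k = 0 serves
  injectivity for every k because only the left factor k[V] is expanded: invariants alone cross the
  tensor sign, and Q_k enters as a ring containing them. The scheme statement is the algebra
  statement read on points: a C-point of the fibre product is a pair of homomorphisms agreeing on
  k[V]^W, that is, a homomorphism from the tensor product to C.\<close>

lemma linear_add: "Vector_Spaces.linear s1 s2 f \<Longrightarrow> f (x + y) = f x + f y"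
  and linear_scale: "Vector_Spaces.linear s1 s2 f \<Longrightarrow> f (s1 c x) = s2 c (f x)"
  and linear_zero: "Vector_Spaces.linear s1 s2 f \<Longrightarrow> f 0 = 0"
  and linear_diff: "Vector_Spaces.linear s1 s2 f \<Longrightarrow> f (x - y) = f x - f y"
  unfolding Vector_Spaces.linear_def
  by (blast intro: module_hom.add module_hom.scale module_hom.zero module_hom.diff)+

lemma polynomial_functions_sum:
  assumes "\<And>i. i \<in> I \<Longrightarrow> f i \<in> polynomial_functions sc"
  shows "(\<lambda>v. \<Sum>i\<in>I. f i v) \<in> polynomial_functions sc"
  using assms
  by (induction I rule: infinite_finite_induct)
    (auto intro: polynomial_functions.const polynomial_functions.add)

lemma polynomial_functions_prod:
  assumes "\<And>i. i \<in> I \<Longrightarrow> f i \<in> polynomial_functions sc"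
  shows "(\<lambda>v. \<Prod>i\<in>I. f i v) \<in> polynomial_functions sc"
  using assms
  by (induction I rule: infinite_finite_induct)
    (auto intro: polynomial_functions.const polynomial_functions.mult)

lemma polynomial_functions_power:
  assumes "f \<in> polynomial_functions sc"
  shows "(\<lambda>v. f v ^ n) \<in> polynomial_functions sc"
  using assms by (induction n) (auto intro: polynomial_functions.const polynomial_functions.mult)

lemma polynomial_functions_scale:
  "f \<in> polynomial_functions sc \<Longrightarrow> (\<lambda>v. c * f v) \<in> polynomial_functions sc"
  by (rule polynomial_functions.mult[OF polynomial_functions.const])

lemma polynomial_functions_uminus:
  "f \<in> polynomial_functions sc \<Longrightarrow> (\<lambda>v. - f v) \<in> polynomial_functions sc"
  using polynomial_functions_scale[of f sc "-1"] by simp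

lemma polynomial_functions_diff:
  "f \<in> polynomial_functions sc \<Longrightarrow> g \<in> polynomial_functions sc \<Longrightarrow>
    (\<lambda>v. f v - g v) \<in> polynomial_functions sc"
  using polynomial_functions.add[OF _ polynomial_functions_uminus, of f sc g] by simp

lemma linear_form_comp:
  "linear_form sc a \<Longrightarrow> Vector_Spaces.linear sc sc L \<Longrightarrow> linear_form sc (\<lambda>v. a (L v))"
  using Vector_Spaces.linear_compose[of sc sc L "(*)" a] by (simp add: o_def)

lemma polynomial_functions_comp:
  assumes "p \<in> polynomial_functions sc" "Vector_Spaces.linear sc sc L"
  shows "(\<lambda>v. p (L v)) \<in> polynomial_functions sc"
  using assms(1)
  by induction (auto intro: polynomial_functions.intros linear_form_comp[OF _ assms(2)])

section \<open>Restriction to lines and absence of zero divisors\<close>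

lemma polynomial_function_on_line:
  assumes "p \<in> polynomial_functions sc"
  shows "\<exists>q. \<forall>t. p (v + sc t w) = Polynomial.poly q t"
  using assms
proof induction
  case (const c)
  then show ?case by (intro exI[of _ "[:c:]"]) auto
next
  case (form a)
  then show ?case
    by (intro exI[of _ "[:a v, a w:]"]) (auto simp: linear_add linear_scale)
next
  case (add p q)
  then show ?case by (metis Polynomial.poly_add)
next
  case (mult p q)
  then show ?case by (metis Polynomial.poly_mult)
qed

text \<open>On the line joining a point where p is nonzero (t = 0) to one where q is nonzero (t =
  1), both restrict to nonzero univariate polynomials. Their product cannot vanish at all t, the
  field being infinite.\<close>

lemma polynomial_functions_no_zero_divisors:
  fixes sc :: "'k::field_char_0 \<Rightarrow> 'v::ab_group_add \<Rightarrow> 'v"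
  assumes "vector_space sc" "p \<in> polynomial_functions sc" "q \<in> polynomial_functions sc"
    and "\<And>v. p v * q v = 0"
  shows "(\<forall>v. p v = 0) \<or> (\<forall>v. q v = 0)"
proof (rule ccontr)
  interpret vector_space sc by fact
  assume "\<not> ?thesis"
  then obtain v w where vw: "p v \<noteq> 0" "q w \<noteq> 0" by blast
  obtain P Q where PQ: "\<And>t. p (v + sc t (w - v)) = Polynomial.poly P t"
    "\<And>t. q (v + sc t (w - v)) = Polynomial.poly Q t"
    using polynomial_function_on_line assms by metis
  have "Polynomial.poly (P * Q) t = 0" for t
    using assms(4)[of "v + sc t (w - v)"] PQ by simp
  then have "P * Q = 0"
    using poly_all_0_iff_0 by blast
  moreover have "P \<noteq> 0" using PQ(1)[of 0] vw by auto
  moreover have "Q \<noteq> 0" using PQ(2)[of 1] vw by auto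
  ultimately show False by simp
qed

text \<open>Stands in for the field of fractions: an identity of quotients is proved after
  multiplication by a nonzero function, which is then cancelled.\<close>

lemma polynomial_functions_cancel:
  fixes sc :: "'k::field_char_0 \<Rightarrow> 'v::ab_group_add \<Rightarrow> 'v"
  assumes "vector_space sc" "d \<in> polynomial_functions sc" "p \<in> polynomial_functions sc"
    "q \<in> polynomial_functions sc" "d u \<noteq> 0" "\<And>v. d v * p v = d v * q v"
  shows "p = q"
  using polynomial_functions_no_zero_divisors[OF assms(1,2) polynomial_functions_diff[OF assms(3,4)]]
    assms(5,6) by (auto simp: algebra_simps)

text \<open>The strict bound makes \<open>n = 0\<close> the zero function, so that lowering the degree is uniformly \<open>n - 1\<close>.\<close>
inductive degree_less :: "('k::field \<Rightarrow> 'v::ab_group_add \<Rightarrow> 'v) \<Rightarrow> nat \<Rightarrow> ('v \<Rightarrow> 'k) \<Rightarrow> bool"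
  for sc where
  zero: "degree_less sc n (\<lambda>_. 0)"
| const: "degree_less sc (Suc n) (\<lambda>_. c)"
| form: "linear_form sc a \<Longrightarrow> degree_less sc n p \<Longrightarrow> degree_less sc (Suc n) (\<lambda>v. a v * p v)"
| add: "degree_less sc n p \<Longrightarrow> degree_less sc n q \<Longrightarrow> degree_less sc n (\<lambda>v. p v + q v)"

lemma degree_less_polynomial: "degree_less sc n p \<Longrightarrow> p \<in> polynomial_functions sc"
  by (induction rule: degree_less.induct) (auto intro: polynomial_functions.intros)

lemma degree_less_0: "degree_less sc n p \<Longrightarrow> n = 0 \<Longrightarrow> p = (\<lambda>_. 0)"
  by (induction rule: degree_less.induct) auto

lemma degree_less_mono: "degree_less sc n p \<Longrightarrow> n \<le> m \<Longrightarrow> degree_less sc m p"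
proof (induction arbitrary: m rule: degree_less.induct)
  case (const n c)
  then show ?case by (metis Suc_le_D degree_less.const)
next
  case (form a n p)
  then show ?case by (metis Suc_le_D Suc_le_mono degree_less.form)
qed (auto intro: degree_less.intros)

lemma degree_less_scale: "degree_less sc n p \<Longrightarrow> degree_less sc n (\<lambda>v. c * p v)"
proof (induction rule: degree_less.induct)
  case (form a n p)
  then show ?case using degree_less.form[OF form(1) form.IH] by (simp add: mult.left_commute)
qed (auto intro: degree_less.intros simp: distrib_left)

lemma degree_less_diff:
  "degree_less sc n p \<Longrightarrow> degree_less sc n q \<Longrightarrow> degree_less sc n (\<lambda>v. p v - q v)"
  using degree_less.add[OF _ degree_less_scale, of sc n p q "-1"] by simp

lemma degree_less_comp:
  assumes "degree_less sc n p" "Vector_Spaces.linear sc sc L"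
  shows "degree_less sc n (\<lambda>v. p (L v))"
  using assms(1)
  by induction (auto intro: degree_less.intros degree_less.form[OF linear_form_comp[OF _ assms(2)]])

lemma degree_less_mult:
  "degree_less sc n p \<Longrightarrow> degree_less sc m q \<Longrightarrow> degree_less sc (n + m) (\<lambda>v. p v * q v)"
proof (induction rule: degree_less.induct)
  case (const n c)
  then show ?case using degree_less_mono[OF degree_less_scale, of sc m q "Suc n + m" c] by simp
next
  case (form a n p)
  then show ?case using degree_less.form[OF form(1) form.IH] by (simp add: mult.assoc)
qed (auto intro: degree_less.intros simp: distrib_right)

lemma polynomial_degree_less: "p \<in> polynomial_functions sc \<Longrightarrow> \<exists>n. degree_less sc n p"
proof (induction rule: polynomial_functions.induct)
  case (const c)
  then show ?case using degree_less.const by blast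
next
  case (form a)
  then show ?case using degree_less.form[OF form degree_less.const[of sc 0 1]] by (intro exI) simp
next
  case (add p q)
  then obtain n m where "degree_less sc n p" "degree_less sc m q" by blast
  then have "degree_less sc (max n m) p" "degree_less sc (max n m) q"
    by (auto elim: degree_less_mono)
  then show ?case using degree_less.add by blast
next
  case (mult p q)
  then show ?case using degree_less_mult by blast
qed

text \<open>If \<open>a(u) = 1\<close>, then \<open>v \<mapsto> v - a(v) u\<close> is the projection along \<open>u\<close> onto the hyperplane \<open>a = 0\<close>.\<close>
lemma degree_less_minus_projection:
  assumes "degree_less sc n p" "linear_form sc a"
  shows "\<exists>q. degree_less sc (n - 1) q \<and> (\<forall>v. p v - p (v - sc (a v) u) = a v * q v)"
  using assms(1)
proof induction
  case (zero n)
  then show ?case by (intro exI[of _ "\<lambda>_. 0"]) (auto intro: degree_less.zero)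
next
  case (const n c)
  then show ?case by (intro exI[of _ "\<lambda>_. 0"]) (auto intro: degree_less.zero)
next
  case (form b n p)
  then obtain q where q: "degree_less sc (n - 1) q" "\<And>v. p v - p (v - sc (a v) u) = a v * q v"
    by blast
  interpret vector_space sc using assms(2) by (simp add: Vector_Spaces.linear_def)
  define L where "L v = v - sc (a v) u" for v
  have L: "Vector_Spaces.linear sc sc L"
    by unfold_locales
      (auto simp: L_def linear_add[OF assms(2)] linear_scale[OF assms(2)] algebra_simps)
  have b: "b v - b (L v) = a v * b u" for v
    using form(1) by (simp add: L_def linear_diff linear_scale)
  let ?q = "\<lambda>v. b u * p v + b (L v) * q v"
  have "b v * p v - b (L v) * p (L v) = a v * ?q v" for v
  proof -
    have "b v * p v - b (L v) * p (L v) = (b v - b (L v)) * p v + b (L v) * (p v - p (L v))"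
      by (simp add: algebra_simps)
    then show ?thesis unfolding b q(2)[folded L_def] by (simp add: algebra_simps)
  qed
  \<comment> \<open>The case \<open>n = 0\<close> is separate because the truncated bound
    \<open>n - 1\<close> is then 0, and multiplying by a form would only give the bound 1; but there
    \<open>p\<close> and \<open>q\<close> both vanish.\<close>
  moreover have "degree_less sc n ?q"
  proof (cases "n = 0")
    case True
    then have "p = (\<lambda>_. 0)" "q = (\<lambda>_. 0)" using form degree_less_0 q by auto
    then show ?thesis by (simp add: degree_less.zero)
  next
    case False
    then show ?thesis
      using degree_less.form[OF linear_form_comp[OF form(1) L] q(1)] form(2)
      by (intro degree_less.add degree_less_scale) auto
  qed
  ultimately show ?case by (auto simp: L_def intro: exI[of _ ?q])
next
  case (add n p q)
  then obtain p' q' where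
    p': "degree_less sc (n - 1) p'" "\<And>v. p v - p (v - sc (a v) u) = a v * p' v" and
    q': "degree_less sc (n - 1) q'" "\<And>v. q v - q (v - sc (a v) u) = a v * q' v" by blast
  have "p v + q v - (p (v - sc (a v) u) + q (v - sc (a v) u)) = a v * (p' v + q' v)" for v
    unfolding distrib_left p'(2)[symmetric] q'(2)[symmetric] by simp
  then show ?case using degree_less.add[OF p'(1) q'(1)] by blast
qed

lemma linear_form_normalise:
  fixes sc :: "'k::field \<Rightarrow> 'v::ab_group_add \<Rightarrow> 'v"
  assumes "linear_form sc a" "a u \<noteq> 0"
  shows "\<exists>u. a u = 1"
  using assms linear_scale[OF assms(1), of "1 / a u" u] by (intro exI[of _ "sc (1 / a u) u"]) auto

text \<open>A function vanishing on the hyperplane equals its difference with its composite with the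
  projection, so the quotient found for that difference is a quotient of \<open>p\<close>. The drop
  of the bound drives the later induction on the degree.\<close>

lemma degree_less_divide_form:
  fixes sc :: "'k::field \<Rightarrow> 'v::ab_group_add \<Rightarrow> 'v"
  assumes "degree_less sc n p" "linear_form sc a" "a u \<noteq> 0" "\<And>v. a v = 0 \<Longrightarrow> p v = 0"
  shows "\<exists>q. degree_less sc (n - 1) q \<and> (\<forall>v. p v = a v * q v)"
proof -
  obtain u where u: "a u = 1" using linear_form_normalise[OF assms(2,3)] by auto
  then have "p (v - sc (a v) u) = 0" for v
    by (intro assms(4)) (simp add: linear_diff[OF assms(2)] linear_scale[OF assms(2)])
  then show ?thesis using degree_less_minus_projection[OF assms(1,2), of u] by simp
qed

lemma polynomial_functions_divide_form:
  fixes sc :: "'k::field \<Rightarrow> 'v::ab_group_add \<Rightarrow> 'v"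
  assumes "p \<in> polynomial_functions sc" "linear_form sc a" "a u \<noteq> 0" "\<And>v. a v = 0 \<Longrightarrow> p v = 0"
  shows "\<exists>q\<in>polynomial_functions sc. \<forall>v. p v = a v * q v"
proof -
  obtain n where "degree_less sc n p" using polynomial_degree_less[OF assms(1)] by blast
  from degree_less_divide_form[OF this assms(2,3,4)] show ?thesis
    using degree_less_polynomial by blast
qed

section \<open>Divisibility by powers of linear forms\<close>

text \<open>Pointwise counterpart of membership in a principal ideal;
  \<open>principal_ideal_power\<close> links it to the ideal powers in
  \<open>cong_mod\<close>.\<close>

definition fun_dvd :: "('k::field \<Rightarrow> 'v::ab_group_add \<Rightarrow> 'v) \<Rightarrow> ('v \<Rightarrow> 'k) \<Rightarrow> ('v \<Rightarrow> 'k) \<Rightarrow> bool" where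
  "fun_dvd sc d p \<longleftrightarrow> (\<exists>q\<in>polynomial_functions sc. \<forall>v. p v = d v * q v)"

lemma fun_dvdI:
  "q \<in> polynomial_functions sc \<Longrightarrow> (\<And>v. p v = d v * q v) \<Longrightarrow> fun_dvd sc d p"
  by (auto simp: fun_dvd_def)

lemma fun_dvdE:
  assumes "fun_dvd sc d p"
  obtains q where "q \<in> polynomial_functions sc" "\<And>v. p v = d v * q v"
  using assms by (auto simp: fun_dvd_def)

lemma fun_dvd_add: "fun_dvd sc d p \<Longrightarrow> fun_dvd sc d q \<Longrightarrow> fun_dvd sc d (\<lambda>v. p v + q v)"
  by (elim fun_dvdE, rule fun_dvdI[OF polynomial_functions.add]) (auto simp: distrib_left)

lemma fun_dvd_mult:
  assumes "fun_dvd sc d p" "q \<in> polynomial_functions sc"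
  shows "fun_dvd sc d (\<lambda>v. q v * p v)"
proof -
  from assms(1) obtain r where r: "r \<in> polynomial_functions sc" "\<And>v. p v = d v * r v"
    unfolding fun_dvd_def by blast
  show ?thesis by (rule fun_dvdI[OF polynomial_functions.mult[OF assms(2) r(1)]]) (simp add: r(2))
qed

lemma fun_dvd_uminus: "fun_dvd sc d p \<Longrightarrow> fun_dvd sc d (\<lambda>v. - p v)"
  using fun_dvd_mult[OF _ polynomial_functions.const, of sc d p "-1"] by simp

lemma fun_dvd_diff: "fun_dvd sc d p \<Longrightarrow> fun_dvd sc d q \<Longrightarrow> fun_dvd sc d (\<lambda>v. p v - q v)"
  using fun_dvd_add[OF _ fun_dvd_uminus, of sc d p q] by simp

lemma form_dvd_iff:
  fixes sc :: "'k::field \<Rightarrow> 'v::ab_group_add \<Rightarrow> 'v"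
  assumes "p \<in> polynomial_functions sc" "linear_form sc a" "a u \<noteq> 0"
  shows "fun_dvd sc a p \<longleftrightarrow> (\<forall>v. a v = 0 \<longrightarrow> p v = 0)"
  using polynomial_functions_divide_form[OF assms] unfolding fun_dvd_def by fastforce

text \<open>The ideal of a hyperplane is prime because restriction to it, realised as composition
  with the projection \<open>L\<close>, lands again in a ring without zero divisors.\<close>

lemma form_prime:
  fixes sc :: "'k::field_char_0 \<Rightarrow> 'v::ab_group_add \<Rightarrow> 'v"
  assumes p: "p \<in> polynomial_functions sc" and q: "q \<in> polynomial_functions sc"
    and a: "linear_form sc a" "a u \<noteq> 0"
    and pq: "fun_dvd sc a (\<lambda>v. p v * q v)"
  shows "fun_dvd sc a p \<or> fun_dvd sc a q"
proof -
  interpret vector_space sc using a by (simp add: Vector_Spaces.linear_def)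
  obtain u where u: "a u = 1" using linear_form_normalise[OF a] by auto
  define L where "L v = v - sc (a v) u" for v
  have L: "Vector_Spaces.linear sc sc L"
    by unfold_locales (auto simp: L_def linear_add[OF a(1)] linear_scale[OF a(1)] algebra_simps)
  have aL: "a (L v) = 0" for v
    by (simp add: L_def linear_diff[OF a(1)] linear_scale[OF a(1)] u)
  have Lid: "a v = 0 \<Longrightarrow> L v = v" for v by (simp add: L_def)
  have "p (L v) * q (L v) = 0" for v
    using pq aL[of v] unfolding fun_dvd_def by force
  then have "(\<forall>v. p (L v) = 0) \<or> (\<forall>v. q (L v) = 0)"
    using polynomial_functions_no_zero_divisors[OF vector_space_axioms
        polynomial_functions_comp[OF p L] polynomial_functions_comp[OF q L]] by blast
  then show ?thesis unfolding form_dvd_iff[OF p a] form_dvd_iff[OF q a] using Lid by metis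
qed

text \<open>Induction on the exponent: once \<open>b ^ n\<close> is cancelled, one factor
  \<open>b\<close> divides the product of \<open>a\<close> and the remaining quotient, and primality
  moves it to the quotient.\<close>

lemma form_power_coprime:
  fixes sc :: "'k::field_char_0 \<Rightarrow> 'v::ab_group_add \<Rightarrow> 'v"
  assumes q: "q \<in> polynomial_functions sc" and a: "a \<in> polynomial_functions sc"
    and b: "linear_form sc b" "b u \<noteq> 0" and ab: "\<not> fun_dvd sc b a"
    and "fun_dvd sc (\<lambda>v. b v ^ n) (\<lambda>v. a v * q v)"
  shows "fun_dvd sc (\<lambda>v. b v ^ n) q"
  using assms(6)
proof (induction n)
  case 0
  then show ?case using q by (auto simp: fun_dvd_def)
next
  case (Suc n)
  have vs: "vector_space sc" using b by (simp add: Vector_Spaces.linear_def)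
  have bp: "b \<in> polynomial_functions sc" by (rule polynomial_functions.form) (fact b)
  obtain h where h: "h \<in> polynomial_functions sc" "\<And>v. a v * q v = b v ^ Suc n * h v"
    using Suc.prems by (auto simp: fun_dvd_def)
  have "fun_dvd sc (\<lambda>v. b v ^ n) (\<lambda>v. a v * q v)"
    unfolding fun_dvd_def using h polynomial_functions.mult[OF bp h(1)]
    by (intro bexI[of _ "\<lambda>v. b v * h v"]) (auto simp: mult_ac)
  then obtain r where r: "r \<in> polynomial_functions sc" "\<And>v. q v = b v ^ n * r v"
    using Suc.IH by (auto simp: fun_dvd_def)
  have "(\<lambda>v. a v * r v) = (\<lambda>v. b v * h v)"
    by (rule polynomial_functions_cancel[OF vs polynomial_functions_power[OF bp, of n]])
      (use b h r polynomial_functions.mult a bp in \<open>auto simp: mult_ac\<close>)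
  then have "fun_dvd sc b (\<lambda>v. a v * r v)" using h(1) by (auto simp: fun_dvd_def)
  then obtain t where "t \<in> polynomial_functions sc" "\<And>v. r v = b v * t v"
    using form_prime[OF a r(1) b] ab by (auto simp: fun_dvd_def)
  then show ?case using r by (auto simp: fun_dvd_def mult_ac)
qed

section \<open>Tensor products of commutative rings\<close>

lemma frag_cmul_diff_right: "frag_cmul k (a - b) = frag_cmul k a - frag_cmul k b"
  by (rule poly_mapping_eqI) (simp add: lookup_minus right_diff_distrib)

lemma frag_extend_fun_diff:
  "frag_extend (\<lambda>x. f x - g x) c = frag_extend f c - frag_extend g c"
  by (simp add: frag_extend_def frag_cmul_diff_right sum_subtractf)

text \<open>Variant of \<open>frag_induction\<close> whose difference step also provides the support
  conditions of both arguments, as needed when a homomorphism is additive on supported elements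
  only.\<close>

lemma frag_induct_keys [consumes 1, case_names zero one diff]:
  assumes "Poly_Mapping.keys c \<subseteq> S"
    and "P 0" and "\<And>x. x \<in> S \<Longrightarrow> P (frag_of x)"
    and "\<And>a b. Poly_Mapping.keys a \<subseteq> S \<Longrightarrow> Poly_Mapping.keys b \<subseteq> S \<Longrightarrow> P a \<Longrightarrow> P b \<Longrightarrow> P (a - b)"
  shows "P c"
proof -
  have "Poly_Mapping.keys c \<subseteq> S \<and> P c"
    using assms(1)
  proof (induction c rule: frag_induction)
    case (diff a b)
    then show ?case using assms(4)[of a b] keys_diff[of a b] by blast
  qed (use assms in auto)
  then show ?thesis ..
qed

section \<open>Integral monoid rings\<close>

text \<open>The product of \<open>int_monoid_ring\<close> under its own name, so that biadditivity
  becomes a set of simplification rules without support conditions.\<close>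

definition frag_mult :: "('m, 'x) monoid_scheme \<Rightarrow> ('m \<Rightarrow>\<^sub>0 int) \<Rightarrow> ('m \<Rightarrow>\<^sub>0 int) \<Rightarrow> ('m \<Rightarrow>\<^sub>0 int)" where
  "frag_mult M c d = frag_extend (\<lambda>x. frag_extend (\<lambda>y. frag_of (x \<otimes>\<^bsub>M\<^esub> y)) d) c"

lemma frag_mult_simps [simp]:
  "frag_mult M 0 d = 0" "frag_mult M c 0 = 0"
  "frag_mult M (c - c') d = frag_mult M c d - frag_mult M c' d"
  "frag_mult M c (d - d') = frag_mult M c d - frag_mult M c d'"
  "frag_mult M (frag_of x) (frag_of y) = frag_of (x \<otimes>\<^bsub>M\<^esub> y)"
  unfolding frag_mult_def
  by (simp_all add: frag_extend_diff frag_extend_fun_diff frag_extend_eq_0)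

lemma frag_mult_add_left: "frag_mult M (c + c') d = frag_mult M c d + frag_mult M c' d"
  using frag_mult_simps(3)[of M "c + c'" c' d] by simp

lemma int_monoid_ring_simps:
  "carrier (int_monoid_ring M) = {c. Poly_Mapping.keys c \<subseteq> carrier M}"
  "c \<otimes>\<^bsub>int_monoid_ring M\<^esub> d = frag_mult M c d"
  "\<one>\<^bsub>int_monoid_ring M\<^esub> = frag_of \<one>\<^bsub>M\<^esub>" "\<zero>\<^bsub>int_monoid_ring M\<^esub> = 0"
  "c \<oplus>\<^bsub>int_monoid_ring M\<^esub> d = c + d"
  by (simp_all add: int_monoid_ring_def frag_mult_def)

text \<open>Both sides of each law of the product are additive in every argument, so
  \<open>frag_induction\<close> reduces the law to basis elements, where it is a law of the
  monoid.\<close>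

lemma int_monoid_ring_cring:
  assumes "comm_monoid M"
  shows "cring (int_monoid_ring M)"
proof -
  interpret comm_monoid M by fact
  have comm: "frag_mult M c d = frag_mult M d c"
    if c: "Poly_Mapping.keys c \<subseteq> carrier M" and d: "Poly_Mapping.keys d \<subseteq> carrier M" for c d
    using c
  proof (induction c rule: frag_induction)
    case (one x)
    show ?case using d
      by (induction d rule: frag_induct_keys) (use one in \<open>auto simp: m_comm\<close>)
  qed auto
  have assoc: "frag_mult M (frag_mult M c d) e = frag_mult M c (frag_mult M d e)"
    if c: "Poly_Mapping.keys c \<subseteq> carrier M" and d: "Poly_Mapping.keys d \<subseteq> carrier M"
      and e: "Poly_Mapping.keys e \<subseteq> carrier M" for c d e
    using c
  proof (induction c rule: frag_induction)
    case (one x)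
    show ?case using d
    proof (induction d rule: frag_induction)
      case (one y)
      show ?case using e
        by (induction e rule: frag_induct_keys) (use \<open>x \<in> _\<close> one in \<open>auto simp: m_assoc\<close>)
    qed auto
  qed auto
  have unit: "frag_mult M (frag_of \<one>\<^bsub>M\<^esub>) c = c" if "Poly_Mapping.keys c \<subseteq> carrier M" for c
    using that by (induction c rule: frag_induction) auto
  have closed: "Poly_Mapping.keys (frag_mult M c d) \<subseteq> carrier M"
    if "Poly_Mapping.keys c \<subseteq> carrier M" "Poly_Mapping.keys d \<subseteq> carrier M" for c d
  proof
    fix z assume "z \<in> Poly_Mapping.keys (frag_mult M c d)"
    then obtain x where x: "x \<in> Poly_Mapping.keys c"
      "z \<in> Poly_Mapping.keys (frag_extend (\<lambda>y. frag_of (x \<otimes>\<^bsub>M\<^esub> y)) d)"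
      unfolding frag_mult_def using keys_frag_extend by fastforce
    then obtain y where "y \<in> Poly_Mapping.keys d" "z = x \<otimes>\<^bsub>M\<^esub> y"
      using keys_frag_extend by fastforce
    then show "z \<in> carrier M" using that x by auto
  qed
  show ?thesis
  proof (rule cringI)
    show "abelian_group (int_monoid_ring M)"
    proof (rule abelian_groupI)
      fix c assume "c \<in> carrier (int_monoid_ring M)"
      then show "\<exists>d\<in>carrier (int_monoid_ring M). d \<oplus>\<^bsub>int_monoid_ring M\<^esub> c = \<zero>\<^bsub>int_monoid_ring M\<^esub>"
        by (intro bexI[of _ "- c"]) (auto simp: int_monoid_ring_simps)
    qed (use Poly_Mapping.keys_add in \<open>fastforce simp: int_monoid_ring_simps add_ac\<close>)+
    show "comm_monoid (int_monoid_ring M)"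
      by (rule comm_monoidI)
        (use comm assoc unit closed in \<open>auto simp: int_monoid_ring_simps\<close>)
  qed (auto simp: int_monoid_ring_simps frag_mult_add_left)
qed

lemma int_monoid_ring_minus:
  assumes "comm_monoid M" "Poly_Mapping.keys c \<subseteq> carrier M" "Poly_Mapping.keys d \<subseteq> carrier M"
  shows "c \<ominus>\<^bsub>int_monoid_ring M\<^esub> d = c - d"
proof -
  interpret cring "int_monoid_ring M" by (rule int_monoid_ring_cring) fact
  have "\<ominus>\<^bsub>int_monoid_ring M\<^esub> d = - d"
    by (rule minus_equality) (use assms in \<open>auto simp: int_monoid_ring_simps\<close>)
  then show ?thesis by (simp add: a_minus_def int_monoid_ring_simps)
qed

text \<open>The free abelian group provides the additive extension. Multiplicativity is additive in
  each argument, hence it is proved with a basis element on the left first and then in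
  general.\<close>

lemma int_monoid_ring_universal:
  assumes M: "comm_monoid M" and T: "cring T" and f: "f \<in> carrier M \<rightarrow> carrier T"
    and f1: "f \<one>\<^bsub>M\<^esub> = \<one>\<^bsub>T\<^esub>"
    and fm: "\<And>x y. x \<in> carrier M \<Longrightarrow> y \<in> carrier M \<Longrightarrow> f (x \<otimes>\<^bsub>M\<^esub> y) = f x \<otimes>\<^bsub>T\<^esub> f y"
  shows "\<exists>h\<in>ring_hom (int_monoid_ring M) T. \<forall>x\<in>carrier M. h (frag_of x) = f x"
proof -
  interpret M: comm_monoid M by fact
  interpret T: cring T by fact
  have sub: "f ` carrier M \<subseteq> carrier (add_monoid T)" using f by auto
  obtain h where h: "h \<in> hom (free_Abelian_group (carrier M)) (add_monoid T)"
    "\<And>x. x \<in> carrier M \<Longrightarrow> h (frag_of x) = f x"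
    using comm_group.free_Abelian_group_universal[OF T.a_comm_group sub] by blast
  have hc: "h c \<in> carrier T" if "Poly_Mapping.keys c \<subseteq> carrier M" for c
    using hom_in_carrier[OF h(1), of c] that by auto
  have hadd: "h (c + d) = h c \<oplus>\<^bsub>T\<^esub> h d"
    if "Poly_Mapping.keys c \<subseteq> carrier M" "Poly_Mapping.keys d \<subseteq> carrier M" for c d
    using hom_mult[OF h(1), of c d] that by auto
  have hzero: "h 0 = \<zero>\<^bsub>T\<^esub>" using hadd[of 0 0] hc[of 0] by simp
  have hdiff: "h (c - d) = h c \<ominus>\<^bsub>T\<^esub> h d"
    if cd: "Poly_Mapping.keys c \<subseteq> carrier M" "Poly_Mapping.keys d \<subseteq> carrier M" for c d
  proof -
    have k: "Poly_Mapping.keys (c - d) \<subseteq> carrier M" using cd keys_diff[of c d] by blast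
    have "h c = h (c - d) \<oplus>\<^bsub>T\<^esub> h d" using hadd[OF k cd(2)] by simp
    then show ?thesis
      using hc[OF cd(1)] hc[OF cd(2)] hc[OF k] by (simp add: a_minus_def T.a_assoc T.r_neg)
  qed
  interpret Z: cring "int_monoid_ring M" by (rule int_monoid_ring_cring) fact
  have mclosed: "Poly_Mapping.keys (frag_mult M c d) \<subseteq> carrier M"
    if "Poly_Mapping.keys c \<subseteq> carrier M" "Poly_Mapping.keys d \<subseteq> carrier M" for c d
    using Z.m_closed[of c d] that by (simp add: int_monoid_ring_simps)
  have mult1: "h (frag_mult M (frag_of x) d) = h (frag_of x) \<otimes>\<^bsub>T\<^esub> h d"
    if x: "x \<in> carrier M" and d: "Poly_Mapping.keys d \<subseteq> carrier M" for x d
    using d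
  proof (induction d rule: frag_induct_keys)
    case (diff a b)
    then show ?case
      using x by (simp add: hdiff mclosed hc T.r_distr T.r_minus a_minus_def)
  qed (use x hzero h fm f in \<open>auto simp: Pi_iff\<close>)
  have mult: "h (frag_mult M c d) = h c \<otimes>\<^bsub>T\<^esub> h d"
    if c: "Poly_Mapping.keys c \<subseteq> carrier M" and d: "Poly_Mapping.keys d \<subseteq> carrier M" for c d
    using c
  proof (induction c rule: frag_induct_keys)
    case (diff a b)
    then show ?case
      using d by (simp add: hdiff mclosed hc T.l_distr T.l_minus a_minus_def)
  qed (use d hzero mult1 hc in auto)
  have "h \<in> ring_hom (int_monoid_ring M) T"
    by (rule ring_hom_memI) (use hc hadd mult h f1 in \<open>auto simp: int_monoid_ring_simps\<close>)
  then show ?thesis using h(2) by blast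
qed

subsection \<open>Pure tensors\<close>

text \<open>Both factors share the element type, so that one set \<open>R\<close> can lie in both
  carriers and the two inclusions need no names.\<close>

locale tensor_product =
  fixes R :: "'a set" and A B :: "('k, 'a) module"
  assumes cring_left: "cring A" and cring_right: "cring B"
    and subset_left: "R \<subseteq> carrier A" and subset_right: "R \<subseteq> carrier B"
begin

sublocale A: cring A by (rule cring_left)
sublocale B: cring B by (rule cring_right)

abbreviation "Z \<equiv> int_monoid_ring (A \<times>\<times> B)"
abbreviation "T \<equiv> tensor_ring R A B"
abbreviation "pt \<equiv> pure_tensor R A B"

lemma comm_monoid_DirProd: "comm_monoid (A \<times>\<times> B)"
  by (rule comm_monoidI) (auto simp: A.m_assoc B.m_assoc intro: A.m_comm B.m_comm)

sublocale Z: cring Z by (rule int_monoid_ring_cring[OF comm_monoid_DirProd])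

lemma frag_in_Z: "Poly_Mapping.keys c \<subseteq> carrier A \<times> carrier B \<Longrightarrow> c \<in> carrier Z"
  by (simp add: int_monoid_ring_simps)

lemma frag_of_in_Z: "a \<in> carrier A \<Longrightarrow> b \<in> carrier B \<Longrightarrow> frag_of (a, b) \<in> carrier Z"
  by (simp add: int_monoid_ring_simps)

lemma diff_in_Z: "c \<in> carrier Z \<Longrightarrow> d \<in> carrier Z \<Longrightarrow> c - d \<in> carrier Z"
  using keys_diff[of c d] by (auto simp: int_monoid_ring_simps)

lemma minus_Z: "c \<in> carrier Z \<Longrightarrow> d \<in> carrier Z \<Longrightarrow> c \<ominus>\<^bsub>Z\<^esub> d = c - d"
  by (rule int_monoid_ring_minus[OF comm_monoid_DirProd]) (auto simp: int_monoid_ring_simps)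

lemma relations_subset: "tensor_relations R A B \<subseteq> carrier Z"
proof -
  have "\<And>r. r \<in> R \<Longrightarrow> r \<in> carrier A \<and> r \<in> carrier B" using subset_left subset_right by blast
  then show ?thesis
    unfolding tensor_relations_def
    by (auto intro!: diff_in_Z frag_of_in_Z)
qed

sublocale I: ideal "tensor_ideal R A B" Z
  unfolding tensor_ideal_def by (rule Z.genideal_ideal[OF relations_subset])

lemma tensor_ring_cring: "cring T"
  unfolding tensor_ring_def by (rule I.quotient_is_cring[OF Z.is_cring])

sublocale T: cring T by (rule tensor_ring_cring)

sublocale proj: ring_hom_ring Z T "(+>\<^bsub>Z\<^esub>) (tensor_ideal R A B)"
  unfolding tensor_ring_def by (rule I.rcos_ring_hom_ring)

lemma proj_diff:
  "c \<in> carrier Z \<Longrightarrow> d \<in> carrier Z \<Longrightarrow>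
    tensor_ideal R A B +>\<^bsub>Z\<^esub> (c - d) =
    (tensor_ideal R A B +>\<^bsub>Z\<^esub> c) \<ominus>\<^bsub>T\<^esub> (tensor_ideal R A B +>\<^bsub>Z\<^esub> d)"
  by (simp add: minus_Z[symmetric] a_minus_def)

lemma proj_relation:
  "c \<in> tensor_relations R A B \<Longrightarrow> tensor_ideal R A B +>\<^bsub>Z\<^esub> c = \<zero>\<^bsub>T\<^esub>"
  using Z.genideal_self[OF relations_subset] I.a_rcos_const
  by (auto simp: tensor_ideal_def tensor_ring_def FactRing_def)

lemma pt_closed: "a \<in> carrier A \<Longrightarrow> b \<in> carrier B \<Longrightarrow> pt a b \<in> carrier T"
  unfolding pure_tensor_def by (intro proj.hom_closed frag_of_in_Z)

lemma pt_one: "pt \<one>\<^bsub>A\<^esub> \<one>\<^bsub>B\<^esub> = \<one>\<^bsub>T\<^esub>"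
  using proj.hom_one by (simp add: pure_tensor_def int_monoid_ring_simps)

lemma pt_mult:
  assumes "a \<in> carrier A" "a' \<in> carrier A" "b \<in> carrier B" "b' \<in> carrier B"
  shows "pt a b \<otimes>\<^bsub>T\<^esub> pt a' b' = pt (a \<otimes>\<^bsub>A\<^esub> a') (b \<otimes>\<^bsub>B\<^esub> b')"
  using proj.hom_mult[OF frag_of_in_Z frag_of_in_Z, of a b a' b'] assms
  by (simp add: pure_tensor_def int_monoid_ring_simps)

lemma pt_add_left:
  assumes "a \<in> carrier A" "a' \<in> carrier A" "b \<in> carrier B"
  shows "pt (a \<oplus>\<^bsub>A\<^esub> a') b = pt a b \<oplus>\<^bsub>T\<^esub> pt a' b"
proof -
  let ?r = "frag_of (a \<oplus>\<^bsub>A\<^esub> a', b) - frag_of (a, b) - frag_of (a', b)"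
  have "?r \<in> tensor_relations R A B" using assms unfolding tensor_relations_def by blast
  from proj_relation[OF this] have "(pt (a \<oplus>\<^bsub>A\<^esub> a') b \<ominus>\<^bsub>T\<^esub> pt a b) \<ominus>\<^bsub>T\<^esub> pt a' b = \<zero>\<^bsub>T\<^esub>"
    using assms by (simp add: proj_diff diff_in_Z frag_of_in_Z pure_tensor_def)
  moreover have "pt (a \<oplus>\<^bsub>A\<^esub> a') b \<in> carrier T" "pt a b \<in> carrier T" "pt a' b \<in> carrier T"
    using assms by (auto intro: pt_closed)
  ultimately show ?thesis
    by (metis T.add.m_comm T.add.inv_solve_right' T.minus_closed T.r_right_minus_eq a_minus_def)
qed

lemma pt_add_right:
  assumes "a \<in> carrier A" "b \<in> carrier B" "b' \<in> carrier B"
  shows "pt a (b \<oplus>\<^bsub>B\<^esub> b') = pt a b \<oplus>\<^bsub>T\<^esub> pt a b'"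
proof -
  let ?r = "frag_of (a, b \<oplus>\<^bsub>B\<^esub> b') - frag_of (a, b) - frag_of (a, b')"
  have "?r \<in> tensor_relations R A B" using assms unfolding tensor_relations_def by blast
  from proj_relation[OF this] have "(pt a (b \<oplus>\<^bsub>B\<^esub> b') \<ominus>\<^bsub>T\<^esub> pt a b) \<ominus>\<^bsub>T\<^esub> pt a b' = \<zero>\<^bsub>T\<^esub>"
    using assms by (simp add: proj_diff diff_in_Z frag_of_in_Z pure_tensor_def)
  moreover have "pt a (b \<oplus>\<^bsub>B\<^esub> b') \<in> carrier T" "pt a b \<in> carrier T" "pt a b' \<in> carrier T"
    using assms by (auto intro: pt_closed)
  ultimately show ?thesis
    by (metis T.add.m_comm T.add.inv_solve_right' T.minus_closed T.r_right_minus_eq a_minus_def)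
qed

lemma pt_balanced:
  assumes "a \<in> carrier A" "r \<in> R" "b \<in> carrier B"
  shows "pt (a \<otimes>\<^bsub>A\<^esub> r) b = pt a (r \<otimes>\<^bsub>B\<^esub> b)"
proof -
  have r: "r \<in> carrier A" "r \<in> carrier B" using assms subset_left subset_right by auto
  have "frag_of (a \<otimes>\<^bsub>A\<^esub> r, b) - frag_of (a, r \<otimes>\<^bsub>B\<^esub> b) \<in> tensor_relations R A B"
    using assms unfolding tensor_relations_def by blast
  from proj_relation[OF this] have "pt (a \<otimes>\<^bsub>A\<^esub> r) b \<ominus>\<^bsub>T\<^esub> pt a (r \<otimes>\<^bsub>B\<^esub> b) = \<zero>\<^bsub>T\<^esub>"
    using assms r by (simp add: proj_diff frag_of_in_Z pure_tensor_def)
  then show ?thesis using T.r_right_minus_eq pt_closed assms r by simp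
qed

lemma pt_zero_right: "a \<in> carrier A \<Longrightarrow> pt a \<zero>\<^bsub>B\<^esub> = \<zero>\<^bsub>T\<^esub>"
  using pt_add_right[of a "\<zero>\<^bsub>B\<^esub>" "\<zero>\<^bsub>B\<^esub>"] pt_closed[of a "\<zero>\<^bsub>B\<^esub>"] T.add.l_cancel_one' by auto

lemma pt_zero_left: "b \<in> carrier B \<Longrightarrow> pt \<zero>\<^bsub>A\<^esub> b = \<zero>\<^bsub>T\<^esub>"
  using pt_add_left[of "\<zero>\<^bsub>A\<^esub>" "\<zero>\<^bsub>A\<^esub>" b] pt_closed[of "\<zero>\<^bsub>A\<^esub>" b] T.add.l_cancel_one' by auto

lemma pt_minus_left: "a \<in> carrier A \<Longrightarrow> b \<in> carrier B \<Longrightarrow> pt (\<ominus>\<^bsub>A\<^esub> a) b = \<ominus>\<^bsub>T\<^esub> pt a b"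
  using pt_add_left[of "\<ominus>\<^bsub>A\<^esub> a" a b] pt_zero_left[of b]
  by (intro T.minus_equality[symmetric]) (auto simp: A.l_neg pt_closed)

lemma tensor_ring_carrier: "z \<in> carrier T \<Longrightarrow> \<exists>c\<in>carrier Z. z = tensor_ideal R A B +>\<^bsub>Z\<^esub> c"
  unfolding tensor_ring_def FactRing_def A_RCOSETS_def' by auto

text \<open>A tensor comes from a difference of elements of the free group, yet no rule for negation
  is required, since -(a (x) b) = (-a) (x) b. The inner induction therefore carries \<open>P\<close>
  for a class together with its negative.\<close>

lemma tensor_induct [consumes 1, case_names pure add]:
  assumes "z \<in> carrier T"
    and pure: "\<And>a b. a \<in> carrier A \<Longrightarrow> b \<in> carrier B \<Longrightarrow> P (pt a b)"
    and add: "\<And>x y. x \<in> carrier T \<Longrightarrow> y \<in> carrier T \<Longrightarrow> P x \<Longrightarrow> P y \<Longrightarrow> P (x \<oplus>\<^bsub>T\<^esub> y)"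
  shows "P z"
proof -
  let ?I = "tensor_ideal R A B"
  obtain c where c: "c \<in> carrier Z" "z = ?I +>\<^bsub>Z\<^esub> c"
    using tensor_ring_carrier[OF assms(1)] by blast
  have "Poly_Mapping.keys c \<subseteq> carrier A \<times> carrier B"
    using c(1) by (simp add: int_monoid_ring_simps)
  then have "P (?I +>\<^bsub>Z\<^esub> c) \<and> P (\<ominus>\<^bsub>T\<^esub> (?I +>\<^bsub>Z\<^esub> c))"
  proof (induction c rule: frag_induct_keys)
    case zero
    have "P \<zero>\<^bsub>T\<^esub>" using pure[of "\<zero>\<^bsub>A\<^esub>" "\<zero>\<^bsub>B\<^esub>"] pt_zero_left by simp
    then show ?case using proj.hom_zero by (simp add: int_monoid_ring_simps)
  next
    case (one x)
    then obtain a b where "x = (a, b)" "a \<in> carrier A" "b \<in> carrier B" by blast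
    then show ?case
      using pure[of a b] pure[of "\<ominus>\<^bsub>A\<^esub> a" b] pt_minus_left by (simp add: pure_tensor_def)
  next
    case (diff a b)
    then have ab: "a \<in> carrier Z" "b \<in> carrier Z" by (auto intro: frag_in_Z)
    let ?a = "?I +>\<^bsub>Z\<^esub> a" and ?b = "?I +>\<^bsub>Z\<^esub> b"
    have ab': "?a \<in> carrier T" "?b \<in> carrier T" using ab by auto
    then have "\<ominus>\<^bsub>T\<^esub> (?a \<ominus>\<^bsub>T\<^esub> ?b) = ?b \<oplus>\<^bsub>T\<^esub> \<ominus>\<^bsub>T\<^esub> ?a"
      by (simp add: a_minus_def T.minus_add T.a_comm)
    then show ?case
      using diff ab ab' by (simp add: proj_diff) (simp add: a_minus_def add)
  qed
  then show ?thesis using c by simp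
qed

lemma tensor_lift:
  assumes U: "cring U" and f: "f \<in> ring_hom A U" and g: "g \<in> ring_hom B U"
    and fg: "\<And>r. r \<in> R \<Longrightarrow> f r = g r"
  shows "\<exists>h\<in>ring_hom T U. \<forall>a\<in>carrier A. \<forall>b\<in>carrier B. h (pt a b) = f a \<otimes>\<^bsub>U\<^esub> g b"
proof -
  interpret U: cring U by fact
  interpret f: ring_hom_ring A U f by (rule ring_hom_ringI2) (fact A.ring_axioms U.ring_axioms f)+
  interpret g: ring_hom_ring B U g by (rule ring_hom_ringI2) (fact B.ring_axioms U.ring_axioms g)+
  have "\<exists>e\<in>ring_hom Z U. \<forall>x\<in>carrier (A \<times>\<times> B). e (frag_of x) = f (fst x) \<otimes>\<^bsub>U\<^esub> g (snd x)"
    by (rule int_monoid_ring_universal[OF comm_monoid_DirProd U]) (auto simp: U.m_ac)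
  then obtain e where e: "e \<in> ring_hom Z U"
    "\<And>a b. a \<in> carrier A \<Longrightarrow> b \<in> carrier B \<Longrightarrow> e (frag_of (a, b)) = f a \<otimes>\<^bsub>U\<^esub> g b"
    by auto
  interpret e: ring_hom_ring Z U e by (rule ring_hom_ringI2) (fact Z.ring_axioms U.ring_axioms e(1))+
  have e_diff: "e (c - d) = e c \<ominus>\<^bsub>U\<^esub> e d" if "c \<in> carrier Z" "d \<in> carrier Z" for c d
    using that by (simp add: minus_Z[symmetric] a_minus_def)
  have "tensor_ideal R A B \<subseteq> a_kernel Z U e"
    unfolding tensor_ideal_def
  proof (rule Z.genideal_minimal[OF e.kernel_is_ideal])
    have r: "r \<in> carrier A" "r \<in> carrier B" if "r \<in> R" for r
      using that subset_left subset_right by auto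
    have cancel: "(x \<oplus>\<^bsub>U\<^esub> y) \<ominus>\<^bsub>U\<^esub> x \<ominus>\<^bsub>U\<^esub> y = \<zero>\<^bsub>U\<^esub>"
      if "x \<in> carrier U" "y \<in> carrier U" for x y
    proof -
      have "(x \<oplus>\<^bsub>U\<^esub> y) \<ominus>\<^bsub>U\<^esub> x = y" using that by (metis U.a_comm U.add.inv_solve_right a_minus_def U.add.m_closed)
      then show ?thesis using that by simp
    qed
    have "e c = \<zero>\<^bsub>U\<^esub>" if "c \<in> tensor_relations R A B" for c
      using that unfolding tensor_relations_def
      by (auto simp: e e_diff diff_in_Z frag_of_in_Z U.l_distr U.r_distr cancel r fg U.m_assoc)
    then show "tensor_relations R A B \<subseteq> a_kernel Z U e"
      using relations_subset unfolding a_kernel_def' by blast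
  qed
  then have ker: "e i = \<zero>\<^bsub>U\<^esub>" if "i \<in> tensor_ideal R A B" for i
    using that unfolding a_kernel_def' by blast
  \<comment> \<open>Since \<open>e\<close> kills the ideal, it is constant on each coset, and
    \<open>the_elem\<close> of the image defines the induced map without choosing
    representatives.\<close>
  have img: "the_elem (e ` (tensor_ideal R A B +>\<^bsub>Z\<^esub> c)) = e c" if c: "c \<in> carrier Z" for c
  proof -
    have "e ` (tensor_ideal R A B +>\<^bsub>Z\<^esub> c) = {e c}"
    proof
      show "{e c} \<subseteq> e ` (tensor_ideal R A B +>\<^bsub>Z\<^esub> c)" using I.a_rcos_self[OF c] by blast
      show "e ` (tensor_ideal R A B +>\<^bsub>Z\<^esub> c) \<subseteq> {e c}"
        using c ker I.Icarr by (auto simp: a_r_coset_def')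
    qed
    then show ?thesis by simp
  qed
  define ev where "ev z = the_elem (e ` z)" for z
  have ev: "ev (tensor_ideal R A B +>\<^bsub>Z\<^esub> c) = e c" if "c \<in> carrier Z" for c
    unfolding ev_def by (rule img[OF that])
  note rep = tensor_ring_carrier
  have "ev \<in> ring_hom T U"
  proof (rule ring_hom_memI)
    fix x y assume "x \<in> carrier T" "y \<in> carrier T"
    then obtain c d where cd: "c \<in> carrier Z" "d \<in> carrier Z"
      "x = tensor_ideal R A B +>\<^bsub>Z\<^esub> c" "y = tensor_ideal R A B +>\<^bsub>Z\<^esub> d"
      using rep by metis
    show "ev (x \<otimes>\<^bsub>T\<^esub> y) = ev x \<otimes>\<^bsub>U\<^esub> ev y" "ev (x \<oplus>\<^bsub>T\<^esub> y) = ev x \<oplus>\<^bsub>U\<^esub> ev y"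
      unfolding cd(3,4) proj.hom_mult[OF cd(1,2), symmetric] proj.hom_add[OF cd(1,2), symmetric]
      using cd(1,2) by (simp_all add: ev del: proj.hom_mult proj.hom_add)
  next
    fix x assume "x \<in> carrier T"
    then show "ev x \<in> carrier U" using rep[of x] ev by auto
  next
    show "ev \<one>\<^bsub>T\<^esub> = \<one>\<^bsub>U\<^esub>" using ev[OF Z.one_closed] proj.hom_one by simp
  qed
  moreover have "ev (pt a b) = f a \<otimes>\<^bsub>U\<^esub> g b" if "a \<in> carrier A" "b \<in> carrier B" for a b
    using ev[OF frag_of_in_Z[OF that]] e(2)[OF that] by (simp add: pure_tensor_def)
  ultimately show ?thesis by blast
qed

end

section \<open>Congruences modulo powers of a linear form\<close>

lemma coord_alg_simps [simp]:
  "carrier (coord_alg sc) = polynomial_functions sc"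
  "p \<otimes>\<^bsub>coord_alg sc\<^esub> q = (\<lambda>v. p v * q v)"
  "p \<oplus>\<^bsub>coord_alg sc\<^esub> q = (\<lambda>v. p v + q v)"
  "\<one>\<^bsub>coord_alg sc\<^esub> = (\<lambda>_. 1)" "\<zero>\<^bsub>coord_alg sc\<^esub> = (\<lambda>_. 0)"
  "c \<odot>\<^bsub>coord_alg sc\<^esub> p = (\<lambda>v. c * p v)"
  by (simp_all add: coord_alg_def)

text \<open>Serves k[V] as well as the quasi-invariants; negatives come from multiplication by the
  constant -1.\<close>

lemma coord_subalg_cring:
  assumes "B \<subseteq> polynomial_functions sc" "\<And>c. (\<lambda>_. c) \<in> B"
    and "\<And>p q. p \<in> B \<Longrightarrow> q \<in> B \<Longrightarrow> (\<lambda>v. p v + q v) \<in> B"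
    and "\<And>p q. p \<in> B \<Longrightarrow> q \<in> B \<Longrightarrow> (\<lambda>v. p v * q v) \<in> B"
  shows "cring ((coord_alg sc)\<lparr>carrier := B\<rparr>)"
proof (rule cringI)
  show "abelian_group ((coord_alg sc)\<lparr>carrier := B\<rparr>)"
  proof (rule abelian_groupI)
    fix p assume "p \<in> carrier ((coord_alg sc)\<lparr>carrier := B\<rparr>)"
    then have "(\<lambda>v. (-1) * p v) \<in> B" using assms(2)[of "-1"] assms(4) by fastforce
    then show "\<exists>q\<in>carrier ((coord_alg sc)\<lparr>carrier := B\<rparr>).
        q \<oplus>\<^bsub>(coord_alg sc)\<lparr>carrier := B\<rparr>\<^esub> p = \<zero>\<^bsub>(coord_alg sc)\<lparr>carrier := B\<rparr>\<^esub>"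
      by (intro bexI[of _ "\<lambda>v. (-1) * p v"]) (auto simp: coord_alg_def)
  qed (use assms in \<open>auto simp: coord_alg_def algebra_simps\<close>)
  show "comm_monoid ((coord_alg sc)\<lparr>carrier := B\<rparr>)"
    by (rule comm_monoidI) (use assms in \<open>auto simp: coord_alg_def algebra_simps\<close>)
qed (auto simp: coord_alg_def algebra_simps)

lemma coord_alg_cring: "cring (coord_alg sc)"
proof -
  have "cring ((coord_alg sc)\<lparr>carrier := polynomial_functions sc\<rparr>)"
    by (rule coord_subalg_cring) (auto intro: polynomial_functions.const polynomial_functions.add
        polynomial_functions.mult)
  then show ?thesis by (simp add: coord_alg_def)
qed

text \<open>Turns the congruences into divisibility. Sums of products of a multiple of a^n with a
  multiple of a are multiples of a^(n+1), and each such multiple is already a single product; the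
  power 0 is the unit ideal.\<close>

lemma principal_ideal_power:
  assumes "a \<in> polynomial_functions sc"
  shows "(PIdl\<^bsub>coord_alg sc\<^esub> a) [^]\<^bsub>ideals_set (coord_alg sc)\<^esub> (n::nat) =
    {p. fun_dvd sc (\<lambda>v. a v ^ n) p}"
proof (induction n)
  case 0
  have "p \<in> polynomial_functions sc \<longleftrightarrow> fun_dvd sc (\<lambda>v. a v ^ 0) p" for p
    unfolding fun_dvd_def by (auto simp: fun_eq_iff[symmetric])
  then show ?case by (auto simp: nat_pow_def ideals_set_def)
next
  case (Suc n)
  have I: "PIdl\<^bsub>coord_alg sc\<^esub> a = {p. fun_dvd sc a p}"
    unfolding cgenideal_def fun_dvd_def
    by (simp add: fun_eq_iff mult.commute) blast
  have "(PIdl\<^bsub>coord_alg sc\<^esub> a) [^]\<^bsub>ideals_set (coord_alg sc)\<^esub> (Suc n) =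
      ideal_prod (coord_alg sc) {p. fun_dvd sc (\<lambda>v. a v ^ n) p} {p. fun_dvd sc a p}"
    using Suc by (simp add: nat_pow_def ideals_set_def I)
  also have "\<dots> = {p. fun_dvd sc (\<lambda>v. a v ^ Suc n) p}"
  proof (intro equalityI subsetI)
    fix p assume "p \<in> ideal_prod (coord_alg sc) {p. fun_dvd sc (\<lambda>v. a v ^ n) p} {p. fun_dvd sc a p}"
    then show "p \<in> {p. fun_dvd sc (\<lambda>v. a v ^ Suc n) p}"
    proof (induction rule: ideal_prod.induct)
      case (prod i j)
      then obtain q r where q: "q \<in> polynomial_functions sc" "\<And>v. i v = a v ^ n * q v"
        and r: "r \<in> polynomial_functions sc" "\<And>v. j v = a v * r v"
        by (auto simp: fun_dvd_def)
      have "fun_dvd sc (\<lambda>v. a v ^ Suc n) (\<lambda>v. i v * j v)"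
        by (rule fun_dvdI[OF polynomial_functions.mult[OF q(1) r(1)]]) (simp add: q(2) r(2))
      then show ?case by simp
    next
      case (sum i j)
      then show ?case using fun_dvd_add by simp
    qed
  next
    fix p assume "p \<in> {p. fun_dvd sc (\<lambda>v. a v ^ Suc n) p}"
    then obtain q where q: "q \<in> polynomial_functions sc" "\<And>v. p v = a v ^ Suc n * q v"
      by (auto simp: fun_dvd_def)
    have "fun_dvd sc (\<lambda>v. a v ^ n) (\<lambda>v. a v ^ n * q v)" using q(1) by (auto simp: fun_dvd_def)
    moreover have "fun_dvd sc a a"
      by (rule fun_dvdI[OF polynomial_functions.const[of 1]]) simp
    ultimately have "(\<lambda>v. a v ^ n * q v) \<otimes>\<^bsub>coord_alg sc\<^esub> a
        \<in> ideal_prod (coord_alg sc) {p. fun_dvd sc (\<lambda>v. a v ^ n) p} {p. fun_dvd sc a p}"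
      by (intro ideal_prod.prod) auto
    moreover have "(\<lambda>v. a v ^ n * q v) \<otimes>\<^bsub>coord_alg sc\<^esub> a = p" using q(2) by auto
    ultimately show "p \<in> ideal_prod (coord_alg sc) {p. fun_dvd sc (\<lambda>v. a v ^ n) p} {p. fun_dvd sc a p}"
      by simp
  qed
  finally show ?case .
qed

lemma cong_mod_iff:
  "linear_form sc a \<Longrightarrow> cong_mod sc a n p q \<longleftrightarrow> fun_dvd sc (\<lambda>v. a v ^ n) (\<lambda>v. p v - q v)"
  unfolding cong_mod_def using principal_ideal_power[OF polynomial_functions.form, of sc a n] by simp

text \<open>If a(u) = 1, then v - a(v) u lies in the kernel of \<open>a\<close>, hence in that of
  \<open>b\<close>; so b(v) = a(v) b(u), and the constant is b(u).\<close>

lemma forms_proportional: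
  assumes a: "linear_form sc a" "a u \<noteq> 0" and b: "linear_form sc b"
    and ab: "\<And>v. a v = 0 \<Longrightarrow> b v = 0"
  shows "\<exists>c. \<forall>v. b v = c * a v"
proof -
  obtain u where u: "a u = 1" using linear_form_normalise[OF a] by auto
  have "b (v - sc (a v) u) = 0" for v
    by (rule ab) (simp add: linear_diff[OF a(1)] linear_scale[OF a(1)] u)
  then have "b v = a v * b u" for v
    unfolding linear_diff[OF b] linear_scale[OF b] by (metis eq_iff_diff_eq_0)
  then show ?thesis by (metis mult.commute)
qed

section \<open>Finite reflection groups\<close>

locale reflection_group =
  fixes sc :: "'k::field_char_0 \<Rightarrow> 'v::ab_group_add \<Rightarrow> 'v"
    and W :: "'w monoid" and S :: "'w set" and \<rho> :: "'w \<Rightarrow> 'v \<Rightarrow> 'v"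
    and \<alpha> :: "'v set \<Rightarrow> 'v \<Rightarrow> 'k"
  assumes coxeter: "coxeter_system W S" and fin: "finite (carrier W)"
    and refl_rep: "reflection_representation sc W S \<rho>"
    and forms: "\<forall>H\<in>reflection_hyperplanes sc W \<rho>. linear_form sc (\<alpha> H) \<and> H = {v. \<alpha> H v = 0}"
begin

sublocale group W using coxeter by (simp add: coxeter_system_def)

sublocale vector_space sc
  using refl_rep by (auto simp: reflection_representation_def finite_dimensional_vector_space_def)

abbreviation "P \<equiv> polynomial_functions sc"
abbreviation "Hyp \<equiv> reflection_hyperplanes sc W \<rho>"
abbreviation "s_refl H \<equiv> reflection_at sc W \<rho> H"
abbreviation "Inv \<equiv> invariant_functions sc W \<rho>"

lemma S_subset: "S \<subseteq> carrier W" and S_generate: "generate W S = carrier W"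
  using coxeter by (auto simp: coxeter_system_def)

lemma rho_linear: "w \<in> carrier W \<Longrightarrow> Vector_Spaces.linear sc sc (\<rho> w)"
  and rho_one: "\<rho> \<one>\<^bsub>W\<^esub> v = v"
  and rho_mult: "w \<in> carrier W \<Longrightarrow> x \<in> carrier W \<Longrightarrow> \<rho> (w \<otimes>\<^bsub>W\<^esub> x) v = \<rho> w (\<rho> x v)"
  and rho_inj: "inj_on \<rho> (carrier W)"
  and rho_refl: "s \<in> S \<Longrightarrow> is_reflection sc (\<rho> s)"
  using refl_rep by (auto simp: reflection_representation_def)

lemma rho_inv: "w \<in> carrier W \<Longrightarrow> \<rho> (inv\<^bsub>W\<^esub> w) (\<rho> w v) = v" "w \<in> carrier W \<Longrightarrow> \<rho> w (\<rho> (inv\<^bsub>W\<^esub> w) v) = v"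
  by (simp_all flip: rho_mult add: rho_one)

lemma P_comp: "p \<in> P \<Longrightarrow> w \<in> carrier W \<Longrightarrow> (\<lambda>v. p (\<rho> w v)) \<in> P"
  by (rule polynomial_functions_comp[OF _ rho_linear])

lemma finite_Hyp: "finite Hyp"
  using fin by (simp add: reflection_hyperplanes_def)

lemma alpha_linear: "H \<in> Hyp \<Longrightarrow> linear_form sc (\<alpha> H)"
  and alpha_ker: "H \<in> Hyp \<Longrightarrow> v \<in> H \<longleftrightarrow> \<alpha> H v = 0"
  using forms by auto

lemma alpha_P: "H \<in> Hyp \<Longrightarrow> \<alpha> H \<in> P"
  by (rule polynomial_functions.form) (rule alpha_linear)

lemma alpha_nonzero: "H \<in> Hyp \<Longrightarrow> \<exists>u. \<alpha> H u \<noteq> 0"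
proof -
  assume H: "H \<in> Hyp"
  then have "is_hyperplane sc H" by (auto simp: reflection_hyperplanes_def is_reflection_def)
  then obtain v where "v \<notin> H" unfolding is_hyperplane_def by fastforce
  then show ?thesis using alpha_ker[OF H] by blast
qed

section \<open>Reflections, their hyperplanes and the defining forms\<close>

text \<open>\<open>u\<close> is the coroot. For u0 with value 1 under the form, u0 - r(u0) is
  negated by r, and comparing this with the formula for r forces the value 2.\<close>

lemma reflection_formula:
  assumes H: "H \<in> Hyp" and r: "is_reflection sc r" "fixed_space r = H"
  shows "\<exists>u. \<alpha> H u = 2 \<and> (\<forall>v. r v = v - sc (\<alpha> H v) u)"
proof -
  note a = alpha_linear[OF H]
  have r_lin: "Vector_Spaces.linear sc sc r" and rr: "\<And>v. r (r v) = v"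
    using r(1) by (auto simp: is_reflection_def fun_eq_iff)
  have fixed: "\<alpha> H v = 0 \<longleftrightarrow> r v = v" for v
    using alpha_ker[OF H] r(2) by (auto simp: fixed_space_def)
  obtain u0 where u0: "\<alpha> H u0 = 1"
    using alpha_nonzero[OF H] linear_form_normalise[OF a] by blast
  define u where "u = u0 - r u0"
  have rv: "r v = v - sc (\<alpha> H v) u" for v
  proof -
    have "\<alpha> H (v - sc (\<alpha> H v) u0) = 0" by (simp add: linear_diff[OF a] linear_scale[OF a] u0)
    then have "r (v - sc (\<alpha> H v) u0) = v - sc (\<alpha> H v) u0" by (simp add: fixed)
    then show ?thesis
      by (simp add: linear_diff[OF r_lin] linear_scale[OF r_lin] u_def algebra_simps)
  qed
  have "u \<noteq> 0" using fixed[of u0] u0 by (auto simp: u_def)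
  have "r u = - u" by (simp add: u_def linear_diff[OF r_lin] rr)
  then have "sc (\<alpha> H u) u = u + u" using rv[of u] by (simp add: algebra_simps)
  then have "sc (\<alpha> H u - 2) u = 0"
    using scale_left_distrib[of 1 1 u] by (simp add: scale_left_diff_distrib)
  then have "\<alpha> H u = 2" using \<open>u \<noteq> 0\<close> by simp
  then show ?thesis using rv by blast
qed

text \<open>
  Two reflections with the same hyperplane differ by a transvection, which has infinite order
  in characteristic zero unless it is trivial.
\<close>
lemma reflection_unique:
  assumes H: "H \<in> Hyp" and w: "w \<in> carrier W" "is_reflection sc (\<rho> w)" "fixed_space (\<rho> w) = H"
    and w': "w' \<in> carrier W" "is_reflection sc (\<rho> w')" "fixed_space (\<rho> w') = H"
  shows "w = w'"
proof -
  note a = alpha_linear[OF H]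
  obtain u where u: "\<alpha> H u = 2" "\<And>v. \<rho> w v = v - sc (\<alpha> H v) u"
    using reflection_formula[OF H w(2,3)] by blast
  obtain u' where u': "\<alpha> H u' = 2" "\<And>v. \<rho> w' v = v - sc (\<alpha> H v) u'"
    using reflection_formula[OF H w'(2,3)] by blast
  define x where "x = u - u'"
  have ax: "\<alpha> H x = 0" by (simp add: x_def linear_diff[OF a] u u')
  let ?t = "w \<otimes>\<^bsub>W\<^esub> w'"
  have t: "\<rho> ?t v = v + sc (\<alpha> H v) x" for v
  proof -
    have "\<rho> ?t v = v - sc (\<alpha> H v) u' - sc (\<alpha> H v - \<alpha> H v * 2) u"
      unfolding rho_mult[OF w(1) w'(1)] u(2) u'(2)
      by (simp add: linear_diff[OF a] linear_scale[OF a] u')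
    then show ?thesis
      by (simp add: x_def algebra_simps scale_left_diff_distrib flip: scale_left_distrib)
  qed
  have pow: "\<rho> (?t [^]\<^bsub>W\<^esub> n) v = v + sc (of_nat n * \<alpha> H v) x" for n :: nat and v
  proof (induction n arbitrary: v)
    case (Suc n)
    have "\<rho> (?t [^]\<^bsub>W\<^esub> Suc n) v = \<rho> (?t [^]\<^bsub>W\<^esub> n) (\<rho> ?t v)"
      using w w' by (simp add: rho_mult)
    then show ?case
      unfolding Suc t by (simp add: linear_add[OF a] linear_scale[OF a] ax algebra_simps)
  qed (simp add: rho_one)
  have "?t [^]\<^bsub>W\<^esub> Coset.order W = \<one>\<^bsub>W\<^esub>" using w w' by (simp add: pow_order_eq_1)
  then have "sc (of_nat (Coset.order W) * \<alpha> H u) x = 0"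
    using pow[of "Coset.order W" u] by (simp add: rho_one)
  moreover have "Coset.order W > 0" using fin order_gt_0_iff_finite by blast
  ultimately have "x = 0" using u by simp
  then have "\<rho> w = \<rho> w'" using u u' by (auto simp: x_def fun_eq_iff)
  then show ?thesis using rho_inj w w' by (auto dest: inj_onD)
qed

lemma refl_eqI:
  assumes "w \<in> carrier W" "is_reflection sc (\<rho> w)" "fixed_space (\<rho> w) = H"
  shows "s_refl H = w"
proof -
  have "H \<in> Hyp" using assms by (auto simp: reflection_hyperplanes_def)
  then show ?thesis
    unfolding reflection_at_def using assms reflection_unique by (intro the_equality) auto
qed

lemma refl_props:
  assumes "H \<in> Hyp"
  shows "s_refl H \<in> carrier W" "is_reflection sc (\<rho> (s_refl H))" "fixed_space (\<rho> (s_refl H)) = H"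
  using assms refl_eqI by (auto simp: reflection_hyperplanes_def)

lemma alpha_refl: "H \<in> Hyp \<Longrightarrow> \<alpha> H (\<rho> (s_refl H) v) = - \<alpha> H v"
  using reflection_formula[OF _ refl_props(2,3), of H]
  by (auto simp: linear_diff[OF alpha_linear] linear_scale[OF alpha_linear])

lemma refl_fixes: "H \<in> Hyp \<Longrightarrow> \<alpha> H v = 0 \<Longrightarrow> \<rho> (s_refl H) v = v"
  using refl_props(3) alpha_ker by (auto simp: fixed_space_def)

lemma refl_refl:
  assumes "H \<in> Hyp"
  shows "s_refl H \<otimes>\<^bsub>W\<^esub> s_refl H = \<one>\<^bsub>W\<^esub>"
proof -
  have "\<rho> (s_refl H \<otimes>\<^bsub>W\<^esub> s_refl H) = \<rho> \<one>\<^bsub>W\<^esub>"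
    using refl_props[OF assms] by (auto simp: rho_mult rho_one is_reflection_def fun_eq_iff)
  then show ?thesis using rho_inj refl_props(1)[OF assms] by (auto dest: inj_onD)
qed

lemma refl_inv: "H \<in> Hyp \<Longrightarrow> inv\<^bsub>W\<^esub> (s_refl H) = s_refl H"
  by (intro inv_equality refl_refl refl_props(1))

lemma rho_refl_refl: "H \<in> Hyp \<Longrightarrow> \<rho> (s_refl H) (\<rho> (s_refl H) v) = v"
  using rho_inv(1)[OF refl_props(1)] refl_inv by metis

lemma refl_conjugate:
  assumes H: "H \<in> Hyp" and w: "w \<in> carrier W"
  shows "\<rho> w ` H \<in> Hyp" "s_refl (\<rho> w ` H) = w \<otimes>\<^bsub>W\<^esub> s_refl H \<otimes>\<^bsub>W\<^esub> inv\<^bsub>W\<^esub> w"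
proof -
  let ?r = "w \<otimes>\<^bsub>W\<^esub> s_refl H \<otimes>\<^bsub>W\<^esub> inv\<^bsub>W\<^esub> w"
  note c = refl_props(1)[OF H]
  have r: "?r \<in> carrier W" using w c by simp
  have \<rho>: "\<rho> ?r v = \<rho> w (\<rho> (s_refl H) (\<rho> (inv\<^bsub>W\<^esub> w) v))" for v
    using w c by (simp add: rho_mult)
  have fixed_iff: "\<rho> ?r v = v \<longleftrightarrow> \<rho> (inv\<^bsub>W\<^esub> w) v \<in> H" for v
  proof -
    have "\<rho> ?r v = v \<longleftrightarrow> \<rho> (s_refl H) (\<rho> (inv\<^bsub>W\<^esub> w) v) = \<rho> (inv\<^bsub>W\<^esub> w) v"
      unfolding \<rho> by (metis rho_inv w)
    then show ?thesis using refl_props(3)[OF H] by (auto simp: fixed_space_def)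
  qed
  have image: "fixed_space (\<rho> ?r) = \<rho> w ` H"
    unfolding fixed_space_def fixed_iff using rho_inv[OF w] by (auto simp: image_iff) metis
  have "is_hyperplane sc (fixed_space (\<rho> ?r))"
    unfolding is_hyperplane_def
  proof (intro exI conjI)
    show "linear_form sc (\<lambda>v. \<alpha> H (\<rho> (inv\<^bsub>W\<^esub> w) v))"
      by (rule linear_form_comp[OF alpha_linear[OF H] rho_linear]) (simp add: w)
    show "(\<lambda>v. \<alpha> H (\<rho> (inv\<^bsub>W\<^esub> w) v)) \<noteq> (\<lambda>_. 0)"
      using alpha_nonzero[OF H] rho_inv[OF w] by (metis (no_types, lifting))
    show "fixed_space (\<rho> ?r) = {v. \<alpha> H (\<rho> (inv\<^bsub>W\<^esub> w) v) = 0}"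
      unfolding fixed_space_def fixed_iff using alpha_ker[OF H] by simp
  qed
  moreover have "\<rho> ?r \<circ> \<rho> ?r = id"
    using \<rho> rho_inv[OF w] rho_refl_refl[OF H] by (auto simp: fun_eq_iff)
  ultimately have "is_reflection sc (\<rho> ?r)"
    using rho_linear[OF r] by (simp add: is_reflection_def)
  then show "\<rho> w ` H \<in> Hyp" "s_refl (\<rho> w ` H) = ?r"
    using r image refl_eqI[OF r _ image] unfolding reflection_hyperplanes_def by blast+
qed

text \<open>The forms are chosen independently for each hyperplane, so the group permutes them only
  up to nonzero scalars; divisibility does not see these.\<close>

lemma alpha_conjugate:
  assumes H: "H \<in> Hyp" and w: "w \<in> carrier W"
  shows "\<exists>c. c \<noteq> 0 \<and> (\<forall>v. \<alpha> (\<rho> w ` H) (\<rho> w v) = c * \<alpha> H v)"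
proof -
  note H' = refl_conjugate(1)[OF H w]
  obtain u where u: "\<alpha> H u \<noteq> 0" using alpha_nonzero[OF H] by blast
  have "\<exists>c. \<forall>v. \<alpha> (\<rho> w ` H) (\<rho> w v) = c * \<alpha> H v"
  proof (rule forms_proportional[OF alpha_linear[OF H] u])
    show "linear_form sc (\<lambda>v. \<alpha> (\<rho> w ` H) (\<rho> w v))"
      by (rule linear_form_comp[OF alpha_linear[OF H'] rho_linear[OF w]])
    show "\<alpha> (\<rho> w ` H) (\<rho> w v) = 0" if "\<alpha> H v = 0" for v
      using that alpha_ker[OF H] alpha_ker[OF H'] by blast
  qed
  then obtain c where c: "\<And>v. \<alpha> (\<rho> w ` H) (\<rho> w v) = c * \<alpha> H v" by blast
  moreover have "c \<noteq> 0"
    using alpha_nonzero[OF H'] c rho_inv(2)[OF w] by (metis mult_zero_left)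
  ultimately show ?thesis by blast
qed

lemma alpha_not_dvd:
  assumes "H \<in> Hyp" "H' \<in> Hyp" "H \<noteq> H'"
  shows "\<not> fun_dvd sc (\<alpha> H) (\<alpha> H')"
proof
  assume "fun_dvd sc (\<alpha> H) (\<alpha> H')"
  then have le: "\<And>v. \<alpha> H v = 0 \<Longrightarrow> \<alpha> H' v = 0" by (auto simp: fun_dvd_def)
  obtain u where u: "\<alpha> H u \<noteq> 0" using alpha_nonzero assms by blast
  obtain c where c: "\<And>v. \<alpha> H' v = c * \<alpha> H v"
    using forms_proportional[OF alpha_linear[OF assms(1)] u alpha_linear[OF assms(2)]] le by blast
  then have "c \<noteq> 0" using alpha_nonzero[OF assms(2)] by auto
  then have "v \<in> H \<longleftrightarrow> v \<in> H'" for v using c alpha_ker assms by simp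
  then show False using assms(3) by blast
qed

lemma cong_iff:
  "H \<in> Hyp \<Longrightarrow> cong_mod sc (\<alpha> H) n p q \<longleftrightarrow> fun_dvd sc (\<lambda>v. \<alpha> H v ^ n) (\<lambda>v. p v - q v)"
  by (rule cong_mod_iff[OF alpha_linear])

text \<open>The generators in \<open>S\<close> are themselves of the form \<open>s_refl H\<close>,
  with \<open>H\<close> their fixed space, and being involutions they need no separate case for
  inverses.\<close>

lemma group_induct [consumes 1, case_names one refl mult]:
  assumes "w \<in> carrier W" "Q \<one>\<^bsub>W\<^esub>" "\<And>H. H \<in> Hyp \<Longrightarrow> Q (s_refl H)"
    and mult: "\<And>x y. x \<in> carrier W \<Longrightarrow> y \<in> carrier W \<Longrightarrow> Q x \<Longrightarrow> Q y \<Longrightarrow> Q (x \<otimes>\<^bsub>W\<^esub> y)"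
  shows "Q w"
proof -
  have s: "Q s \<and> inv\<^bsub>W\<^esub> s = s" if "s \<in> S" for s
  proof -
    let ?H = "fixed_space (\<rho> s)"
    have "s \<in> carrier W" using that S_subset by blast
    then have "?H \<in> Hyp" "s_refl ?H = s"
      using rho_refl[OF that] refl_eqI by (auto simp: reflection_hyperplanes_def)
    then show ?thesis using assms(3) refl_inv by metis
  qed
  have "w \<in> generate W S" using assms(1) S_generate by simp
  then have "w \<in> carrier W \<and> Q w"
    by induction (use s S_subset assms in auto)
  then show ?thesis ..
qed

text \<open>
  Quasi-covariants without the extensionality condition on families, and the action
  \<open>x (\<Sum> p\<^sub>w \<otimes> w) = \<Sum> x(p\<^sub>w) \<otimes> x w\<close> of the group on families.
\<close>
definition quasi_covariant :: "('v set \<Rightarrow> nat) \<Rightarrow> ('w \<Rightarrow> 'v \<Rightarrow> 'k) \<Rightarrow> bool" where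
  "quasi_covariant m p \<longleftrightarrow> (\<forall>w\<in>carrier W. p w \<in> P) \<and>
     (\<forall>H\<in>Hyp. \<forall>w\<in>carrier W. fun_dvd sc (\<lambda>v. \<alpha> H v ^ m H) (\<lambda>v. p w v - p (s_refl H \<otimes>\<^bsub>W\<^esub> w) v))"

definition family_act :: "'w \<Rightarrow> ('w \<Rightarrow> 'v \<Rightarrow> 'k) \<Rightarrow> 'w \<Rightarrow> 'v \<Rightarrow> 'k" where
  "family_act x p = (\<lambda>w v. p (inv\<^bsub>W\<^esub> x \<otimes>\<^bsub>W\<^esub> w) (\<rho> (inv\<^bsub>W\<^esub> x) v))"

lemma quasi_covariants_iff:
  "p \<in> quasi_covariants sc W \<rho> \<alpha> m \<longleftrightarrow> p \<in> extensional (carrier W) \<and> quasi_covariant m p"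
  unfolding quasi_covariants_def quasi_covariant_def prod_alg_def
  by (auto simp: cong_iff PiE_iff)

section \<open>The algebra of quasi-covariants and the group action on it\<close>

lemma quasi_covariant_cong:
  "quasi_covariant m p \<Longrightarrow> (\<And>w. w \<in> carrier W \<Longrightarrow> q w = p w) \<Longrightarrow> quasi_covariant m q"
  unfolding quasi_covariant_def by (simp add: refl_props)

lemma quasi_covariant_add:
  assumes "quasi_covariant m p" "quasi_covariant m q"
  shows "quasi_covariant m (\<lambda>w v. p w v + q w v)"
  unfolding quasi_covariant_def
proof (intro conjI ballI)
  show "(\<lambda>v. p w v + q w v) \<in> P" if "w \<in> carrier W" for w
    using assms that by (intro polynomial_functions.add) (auto simp: quasi_covariant_def)
  fix H w assume "H \<in> Hyp" "w \<in> carrier W"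
  then show "fun_dvd sc (\<lambda>v. \<alpha> H v ^ m H)
      (\<lambda>v. p w v + q w v - (p (s_refl H \<otimes>\<^bsub>W\<^esub> w) v + q (s_refl H \<otimes>\<^bsub>W\<^esub> w) v))"
    using assms fun_dvd_add[of sc "\<lambda>v. \<alpha> H v ^ m H" "\<lambda>v. p w v - p (s_refl H \<otimes>\<^bsub>W\<^esub> w) v"
        "\<lambda>v. q w v - q (s_refl H \<otimes>\<^bsub>W\<^esub> w) v"]
    by (simp add: quasi_covariant_def algebra_simps)
qed

lemma quasi_covariant_mult:
  assumes "quasi_covariant m p" "quasi_covariant m q"
  shows "quasi_covariant m (\<lambda>w v. p w v * q w v)"
  unfolding quasi_covariant_def
proof (intro conjI ballI)
  show "(\<lambda>v. p w v * q w v) \<in> P" if "w \<in> carrier W" for w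
    using assms that by (intro polynomial_functions.mult) (auto simp: quasi_covariant_def)
  fix H w assume H: "H \<in> Hyp" and w: "w \<in> carrier W"
  let ?s = "s_refl H \<otimes>\<^bsub>W\<^esub> w"
  have "?s \<in> carrier W" using H w refl_props by simp
  then have P: "p w \<in> P" "q ?s \<in> P" using assms w by (auto simp: quasi_covariant_def)
  have "fun_dvd sc (\<lambda>v. \<alpha> H v ^ m H) (\<lambda>v. q ?s v * (p w v - p ?s v) + p w v * (q w v - q ?s v))"
    using assms H w P by (intro fun_dvd_add fun_dvd_mult) (auto simp: quasi_covariant_def)
  then show "fun_dvd sc (\<lambda>v. \<alpha> H v ^ m H) (\<lambda>v. p w v * q w v - p ?s v * q ?s v)"
    by (simp add: algebra_simps)
qed

lemma quasi_covariant_constant: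
  "f \<in> P \<Longrightarrow> quasi_covariant m (\<lambda>w. f)"
  unfolding quasi_covariant_def
  by (auto simp: fun_dvd_def intro: bexI[OF _ polynomial_functions.const[of 0]])

lemma quasi_covariant_diff:
  assumes "quasi_covariant m p" "quasi_covariant m q"
  shows "quasi_covariant m (\<lambda>w v. p w v - q w v)"
  using quasi_covariant_add[OF assms(1)
      quasi_covariant_mult[OF quasi_covariant_constant[OF polynomial_functions.const[of "-1"]] assms(2)]]
  by simp

lemma quasi_covariant_sum:
  assumes "\<And>i. i \<in> I \<Longrightarrow> quasi_covariant m (p i)"
  shows "quasi_covariant m (\<lambda>w v. \<Sum>i\<in>I. p i w v)"
  using assms
proof (induction I rule: infinite_finite_induct)
  case (insert i F)
  then show ?case using quasi_covariant_add[of m "p i"] by simp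
qed (use quasi_covariant_constant[OF polynomial_functions.const[of 0]] in simp_all)

text \<open>Invariance of \<open>k\<close> matches the exponents, and the scalar between the two
  forms is absorbed into the quotient as 1 / c^(k H).\<close>

lemma fun_dvd_conjugate:
  assumes k: "k \<in> multiplicities sc W \<rho>" and H: "H \<in> Hyp" and w: "w \<in> carrier W"
    and dvd: "fun_dvd sc (\<lambda>v. \<alpha> H v ^ k H) p"
  shows "fun_dvd sc (\<lambda>v. \<alpha> (\<rho> w ` H) v ^ k (\<rho> w ` H)) (\<lambda>v. p (\<rho> (inv\<^bsub>W\<^esub> w) v))"
proof -
  obtain c where c: "c \<noteq> 0" "\<And>v. \<alpha> (\<rho> w ` H) (\<rho> w v) = c * \<alpha> H v"
    using alpha_conjugate[OF H w] by blast
  obtain q where q: "q \<in> P" "\<And>v. p v = \<alpha> H v ^ k H * q v" using dvd by (auto simp: fun_dvd_def)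
  have kH: "k (\<rho> w ` H) = k H" using k H w by (simp add: multiplicities_def)
  have "\<alpha> H (\<rho> (inv\<^bsub>W\<^esub> w) v) = \<alpha> (\<rho> w ` H) v / c" for v
    using c(2)[of "\<rho> (inv\<^bsub>W\<^esub> w) v"] c(1) rho_inv(2)[OF w] by simp
  then have "p (\<rho> (inv\<^bsub>W\<^esub> w) v)
      = \<alpha> (\<rho> w ` H) v ^ k (\<rho> w ` H) * ((1 / c ^ k H) * q (\<rho> (inv\<^bsub>W\<^esub> w) v))" for v
    by (simp add: q kH power_divide)
  then show ?thesis
    by (rule fun_dvdI[OF polynomial_functions_scale[OF P_comp[OF q(1) inv_closed[OF w]]]])
qed

text \<open>With H' = x^-1 H one has s_H' x^-1 w = x^-1 s_H w. Hence the condition on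
  \<open>family_act x p\<close> at H and w is the x-translate of the condition on \<open>p\<close>
  at H' and x^-1 w.\<close>

lemma quasi_covariant_act:
  assumes m: "m \<in> multiplicities sc W \<rho>" and p: "quasi_covariant m p" and x: "x \<in> carrier W"
  shows "quasi_covariant m (family_act x p)"
  unfolding quasi_covariant_def
proof (intro conjI ballI)
  show "family_act x p w \<in> P" if "w \<in> carrier W" for w
    unfolding family_act_def using p that x by (intro P_comp) (auto simp: quasi_covariant_def)
  fix H w assume H: "H \<in> Hyp" and w: "w \<in> carrier W"
  let ?H = "\<rho> (inv\<^bsub>W\<^esub> x) ` H" and ?w = "inv\<^bsub>W\<^esub> x \<otimes>\<^bsub>W\<^esub> w"
  have x': "inv\<^bsub>W\<^esub> x \<in> carrier W" using x by simp
  note H' = refl_conjugate[OF H x']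
  have "\<rho> x ` ?H = H" using rho_inv[OF x] by (auto simp: image_image)
  moreover have "s_refl ?H \<otimes>\<^bsub>W\<^esub> ?w = inv\<^bsub>W\<^esub> x \<otimes>\<^bsub>W\<^esub> (s_refl H \<otimes>\<^bsub>W\<^esub> w)"
  proof -
    have "s_refl ?H \<otimes>\<^bsub>W\<^esub> ?w = inv\<^bsub>W\<^esub> x \<otimes>\<^bsub>W\<^esub> (s_refl H \<otimes>\<^bsub>W\<^esub> (x \<otimes>\<^bsub>W\<^esub> (inv\<^bsub>W\<^esub> x \<otimes>\<^bsub>W\<^esub> w)))"
      unfolding H'(2) using x w refl_props(1)[OF H] by (simp add: m_assoc)
    then show ?thesis using x w by (simp flip: m_assoc)
  qed
  moreover have "fun_dvd sc (\<lambda>v. \<alpha> (\<rho> x ` ?H) v ^ m (\<rho> x ` ?H))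
      (\<lambda>v. p ?w (\<rho> (inv\<^bsub>W\<^esub> x) v) - p (s_refl ?H \<otimes>\<^bsub>W\<^esub> ?w) (\<rho> (inv\<^bsub>W\<^esub> x) v))"
    by (rule fun_dvd_conjugate[OF m H'(1) x]) (use p H'(1) x w in \<open>simp add: quasi_covariant_def\<close>)
  ultimately show "fun_dvd sc (\<lambda>v. \<alpha> H v ^ m H)
      (\<lambda>v. family_act x p w v - family_act x p (s_refl H \<otimes>\<^bsub>W\<^esub> w) v)"
    by (simp add: family_act_def)
qed

text \<open>
  The divided difference operators preserve the quasi-covariants. At the hyperplane of the
  reflection itself this is where the exponent \<open>m H\<close> has to be odd.
\<close>
lemma divided_difference:
  assumes m: "m \<in> multiplicities sc W \<rho>" and p: "quasi_covariant m p" and H: "H \<in> Hyp"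
    and odd: "m H = 2 * j + 1"
    and deg: "\<And>w. w \<in> carrier W \<Longrightarrow> degree_less sc n (p w)"
  shows "\<exists>q. quasi_covariant m q \<and> (\<forall>w\<in>carrier W. degree_less sc (n - 1) (q w)) \<and>
    (\<forall>w\<in>carrier W. \<forall>v. p w v - family_act (s_refl H) p w v = \<alpha> H v * q w v)"
proof -
  let ?s = "s_refl H" and ?d = "\<lambda>w v. p w v - family_act (s_refl H) p w v"
  note s = refl_props(1)[OF H]
  note a = alpha_linear[OF H]
  obtain u where u: "\<alpha> H u \<noteq> 0" using alpha_nonzero[OF H] by blast
  have act: "family_act ?s p w v = p (?s \<otimes>\<^bsub>W\<^esub> w) (\<rho> ?s v)" for w v
    by (simp add: family_act_def refl_inv[OF H])
  have ss: "?s \<otimes>\<^bsub>W\<^esub> (?s \<otimes>\<^bsub>W\<^esub> w) = w" if "w \<in> carrier W" for w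
    using that s refl_refl[OF H] by (simp flip: m_assoc)
  have "\<exists>q. degree_less sc (n - 1) q \<and> (\<forall>v. ?d w v = \<alpha> H v * q v)" if w: "w \<in> carrier W" for w
  proof (rule degree_less_divide_form[OF _ a u])
    show "degree_less sc n (?d w)"
      unfolding act using s w by (intro degree_less_diff deg degree_less_comp[OF deg rho_linear]) auto
    fix v assume v: "\<alpha> H v = 0"
    have "fun_dvd sc (\<lambda>v. \<alpha> H v ^ m H) (\<lambda>v. p w v - p (?s \<otimes>\<^bsub>W\<^esub> w) v)"
      using p H w by (simp add: quasi_covariant_def)
    then obtain h where "\<And>v. p w v - p (?s \<otimes>\<^bsub>W\<^esub> w) v = \<alpha> H v ^ m H * h v"
      unfolding fun_dvd_def by blast
    \<comment> \<open>On the hyperplane the reflection fixes \<open>v\<close>, and the odd number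
      \<open>m H\<close> is at least 1, so the two members agree there.\<close>
    then show "?d w v = 0" unfolding act using v refl_fixes[OF H v] odd by simp
  qed
  then obtain q where q: "\<And>w. w \<in> carrier W \<Longrightarrow> degree_less sc (n - 1) (q w)"
    "\<And>w v. w \<in> carrier W \<Longrightarrow> ?d w v = \<alpha> H v * q w v" by metis
  have qP: "q w \<in> P" if "w \<in> carrier W" for w using q(1)[OF that] by (rule degree_less_polynomial)
  have d: "quasi_covariant m ?d"
    by (rule quasi_covariant_diff[OF p quasi_covariant_act[OF m p s]])
  have "quasi_covariant m q"
    unfolding quasi_covariant_def
  proof (intro conjI ballI qP)
    fix H' w assume H': "H' \<in> Hyp" and w: "w \<in> carrier W"
    let ?w = "s_refl H' \<otimes>\<^bsub>W\<^esub> w"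
    have w': "?w \<in> carrier W" using w refl_props(1)[OF H'] by simp
    have qq: "(\<lambda>v. q w v - q ?w v) \<in> P" using w w' by (intro polynomial_functions_diff qP)
    show "fun_dvd sc (\<lambda>v. \<alpha> H' v ^ m H') (\<lambda>v. q w v - q ?w v)"
    proof (cases "H' = H")
      case True
      have ww: "?s \<otimes>\<^bsub>W\<^esub> w \<in> carrier W" using s w by simp
      have "fun_dvd sc (\<lambda>v. \<alpha> H v ^ m H) (\<lambda>v. p w v - p (?s \<otimes>\<^bsub>W\<^esub> w) v)"
        using p H w by (simp add: quasi_covariant_def)
      then obtain h where h: "h \<in> P" "\<And>v. p w v - p (?s \<otimes>\<^bsub>W\<^esub> w) v = \<alpha> H v ^ m H * h v"
        unfolding fun_dvd_def by blast
      have "(\<lambda>v. h v - h (\<rho> ?s v)) \<in> P"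
        using h(1) s by (intro polynomial_functions_diff P_comp)
      \<comment> \<open>This factor of the form compensates for the one lost when passing from the
        differences of \<open>p\<close> to \<open>q\<close>.\<close>
      then have "\<exists>g\<in>P. \<forall>v. h v - h (\<rho> ?s v) = \<alpha> H v * g v"
        by (rule polynomial_functions_divide_form[OF _ a u]) (simp add: refl_fixes[OF H])
      then obtain g where g: "g \<in> P" "\<And>v. h v - h (\<rho> ?s v) = \<alpha> H v * g v" by blast
      have "\<alpha> H v * (q w v - q (?s \<otimes>\<^bsub>W\<^esub> w) v) = \<alpha> H v * (\<alpha> H v ^ m H * g v)" for v
      proof -
        have "\<alpha> H v * (q w v - q (?s \<otimes>\<^bsub>W\<^esub> w) v)
            = (p w v - p (?s \<otimes>\<^bsub>W\<^esub> w) v) + (p w (\<rho> ?s v) - p (?s \<otimes>\<^bsub>W\<^esub> w) (\<rho> ?s v))"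
          unfolding right_diff_distrib q(2)[OF w, symmetric] q(2)[OF ww, symmetric] act ss[OF w]
          by simp
        also have "\<dots> = \<alpha> H v ^ m H * h v + (- \<alpha> H v) ^ m H * h (\<rho> ?s v)"
          unfolding h(2) alpha_refl[OF H] by simp
        \<comment> \<open>Oddness makes the second summand change sign, so that the difference of
          \<open>h\<close> and its reflection appears instead of the sum.\<close>
        also have "\<dots> = \<alpha> H v ^ m H * (h v - h (\<rho> ?s v))"
          unfolding odd by (simp add: algebra_simps)
        finally show ?thesis unfolding g(2) by (simp add: algebra_simps)
      qed
      then have "(\<lambda>v. q w v - q (?s \<otimes>\<^bsub>W\<^esub> w) v) = (\<lambda>v. \<alpha> H v ^ m H * g v)"
        using polynomial_functions_cancel[OF vector_space_axioms alpha_P[OF H] _ _ u] qq True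
          polynomial_functions.mult[OF polynomial_functions_power[OF alpha_P[OF H]] g(1)] by blast
      then show ?thesis using True g(1) by (auto simp: fun_dvd_def fun_eq_iff)
    next
      case False
      obtain u' where u': "\<alpha> H' u' \<noteq> 0" using alpha_nonzero[OF H'] by blast
      have "fun_dvd sc (\<lambda>v. \<alpha> H' v ^ m H') (\<lambda>v. ?d w v - ?d ?w v)"
        using d H' w by (simp add: quasi_covariant_def)
      \<comment> \<open>The difference for \<open>q\<close> times \<alpha>_H is divisible by the
        power of \<alpha>_H'; as the two forms are coprime, \<alpha>_H may be dropped.\<close>
      then have "fun_dvd sc (\<lambda>v. \<alpha> H' v ^ m H') (\<lambda>v. \<alpha> H v * (q w v - q ?w v))"
        by (simp add: q(2)[OF w] q(2)[OF w'] right_diff_distrib)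
      then show ?thesis
        by (rule form_power_coprime[OF qq alpha_P[OF H] alpha_linear[OF H'] u'
              alpha_not_dvd[OF H' H False]])
    qed
  qed
  then show ?thesis using q by blast
qed

section \<open>Quasi-invariants and their families of translates\<close>

lemma quasi_invariant_iff:
  "g \<in> quasi_invariants sc W \<rho> \<alpha> k \<longleftrightarrow>
    g \<in> P \<and> (\<forall>H\<in>Hyp. fun_dvd sc (\<lambda>v. \<alpha> H v ^ (2 * k H)) (\<lambda>v. g (\<rho> (s_refl H) v) - g v))"
  by (auto simp: quasi_invariants_def cong_iff act_def refl_inv)

lemma quasi_invariant_P: "g \<in> quasi_invariants sc W \<rho> \<alpha> k \<Longrightarrow> g \<in> P"
  by (simp add: quasi_invariant_iff)

text \<open>\<open>s\<^sub>\<alpha>(g) - g\<close> is odd under \<open>s\<^sub>\<alpha>\<close>, so divisibility by \<open>\<alpha>\<^bsup>2k\<^esup>\<close> improves to \<open>\<alpha>\<^bsup>2k+1\<^esup>\<close>.\<close>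
lemma quasi_invariant_odd:
  assumes g: "g \<in> quasi_invariants sc W \<rho> \<alpha> k" and H: "H \<in> Hyp"
  shows "fun_dvd sc (\<lambda>v. \<alpha> H v ^ (2 * k H + 1)) (\<lambda>v. g v - g (\<rho> (s_refl H) v))"
proof -
  note a = alpha_linear[OF H]
  note s = refl_props(1)[OF H]
  obtain u where u: "\<alpha> H u \<noteq> 0" using alpha_nonzero[OF H] by blast
  obtain h where h: "h \<in> P" "\<And>v. g (\<rho> (s_refl H) v) - g v = \<alpha> H v ^ (2 * k H) * h v"
    using g H by (auto simp: quasi_invariant_iff fun_dvd_def)
  have "\<alpha> H v ^ (2 * k H) * h (\<rho> (s_refl H) v) = \<alpha> H v ^ (2 * k H) * (- h v)" for v
  proof -
    have "\<alpha> H v ^ (2 * k H) * h (\<rho> (s_refl H) v) = g v - g (\<rho> (s_refl H) v)"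
      using h(2)[of "\<rho> (s_refl H) v"] by (simp add: alpha_refl[OF H] rho_refl_refl[OF H])
    then show ?thesis using h(2)[of v] by (metis minus_diff_eq mult_minus_right)
  qed
  then have "(\<lambda>v. h (\<rho> (s_refl H) v)) = (\<lambda>v. - h v)"
    by (intro polynomial_functions_cancel[OF vector_space_axioms
          polynomial_functions_power[OF alpha_P[OF H], of "2 * k H"] P_comp[OF h(1) s]
          polynomial_functions_uminus[OF h(1)], of u]) (use u in auto)
  then have "h v = 0" if "\<alpha> H v = 0" for v
    using fun_cong[of "\<lambda>v. h (\<rho> (s_refl H) v)" "\<lambda>v. - h v" v] refl_fixes[OF H that] by simp
  then have "\<exists>r\<in>P. \<forall>v. h v = \<alpha> H v * r v"
    by (rule polynomial_functions_divide_form[OF h(1) a u])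
  then obtain r where r: "r \<in> P" "\<And>v. h v = \<alpha> H v * r v" by blast
  have "g v - g (\<rho> (s_refl H) v) = \<alpha> H v ^ (2 * k H + 1) * - r v" for v
    using h(2)[of v] by (simp add: r(2) algebra_simps)
  then show ?thesis by (rule fun_dvdI[OF polynomial_functions_uminus[OF r(1)]])
qed

text \<open>Put H' = w^-1 H. Then s_H w = w s_H', so the members at w and s_H w are w(g) and
  w(s_H'(g)), and the condition at H is the w-translate of \<open>quasi_invariant_odd\<close> at
  H'.\<close>

lemma quasi_invariant_translates:
  assumes k: "k \<in> multiplicities sc W \<rho>" and g: "g \<in> quasi_invariants sc W \<rho> \<alpha> k"
  shows "quasi_covariant (\<lambda>H. 2 * k H + 1) (\<lambda>w v. g (\<rho> (inv\<^bsub>W\<^esub> w) v))"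
  unfolding quasi_covariant_def
proof (intro conjI ballI)
  show "(\<lambda>v. g (\<rho> (inv\<^bsub>W\<^esub> w) v)) \<in> P" if "w \<in> carrier W" for w
    using that g by (intro P_comp) (auto simp: quasi_invariant_iff)
  fix H w assume H: "H \<in> Hyp" and w: "w \<in> carrier W"
  let ?H = "\<rho> (inv\<^bsub>W\<^esub> w) ` H"
  have w': "inv\<^bsub>W\<^esub> w \<in> carrier W" using w by simp
  note s = refl_props(1)[OF H]
  note H' = refl_conjugate[OF H w']
  have m: "(\<lambda>H. 2 * k H + 1) \<in> multiplicities sc W \<rho>" using k by (simp add: multiplicities_def)
  have "\<rho> w ` ?H = H" using rho_inv[OF w] by (auto simp: image_image)
  moreover have "\<rho> (s_refl ?H) (\<rho> (inv\<^bsub>W\<^esub> w) v) = \<rho> (inv\<^bsub>W\<^esub> (s_refl H \<otimes>\<^bsub>W\<^esub> w)) v" for v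
    unfolding H'(2) using w s refl_inv[OF H] rho_inv[OF w] by (simp add: rho_mult inv_mult_group)
  moreover note fun_dvd_conjugate[OF m H'(1) w quasi_invariant_odd[OF g H'(1)]]
  ultimately show "fun_dvd sc (\<lambda>v. \<alpha> H v ^ (2 * k H + 1))
      (\<lambda>v. g (\<rho> (inv\<^bsub>W\<^esub> w) v) - g (\<rho> (inv\<^bsub>W\<^esub> (s_refl H \<otimes>\<^bsub>W\<^esub> w)) v))"
    by simp
qed

section \<open>Generation of the quasi-covariants by invariant families\<close>

text \<open>This is the submodule k[V] M^W, an invariant family being the translates of its member
  at 1. Equalities are asked on the group only, so that families need not be extensional.\<close>

inductive spanned :: "('v set \<Rightarrow> nat) \<Rightarrow> ('w \<Rightarrow> 'v \<Rightarrow> 'k) \<Rightarrow> bool" for k where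
  gen: "f \<in> P \<Longrightarrow> g \<in> quasi_invariants sc W \<rho> \<alpha> k \<Longrightarrow>
    (\<And>w v. w \<in> carrier W \<Longrightarrow> p w v = f v * g (\<rho> (inv\<^bsub>W\<^esub> w) v)) \<Longrightarrow> spanned k p"
| add: "spanned k p \<Longrightarrow> spanned k q \<Longrightarrow>
    (\<And>w v. w \<in> carrier W \<Longrightarrow> r w v = p w v + q w v) \<Longrightarrow> spanned k r"

lemma quasi_invariant_zero: "(\<lambda>_. 0) \<in> quasi_invariants sc W \<rho> \<alpha> k"
  by (auto simp: quasi_invariant_iff fun_dvd_def polynomial_functions.const
      intro: bexI[OF _ polynomial_functions.const[of 0]])

lemma spanned_zero: "(\<And>w v. w \<in> carrier W \<Longrightarrow> p w v = 0) \<Longrightarrow> spanned k p"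
  by (rule spanned.gen[OF polynomial_functions.const[of 0] quasi_invariant_zero]) auto

lemma spanned_cong: "spanned k p \<Longrightarrow> (\<And>w v. w \<in> carrier W \<Longrightarrow> q w v = p w v) \<Longrightarrow> spanned k q"
  by (rule spanned.add[OF _ spanned_zero[of "\<lambda>_ _. 0"]]) auto

lemma spanned_mult:
  assumes "spanned k p" and f: "f \<in> P"
  shows "spanned k (\<lambda>w v. f v * p w v)"
  using assms(1)
proof induction
  case (gen f' g p)
  show ?case
    by (rule spanned.gen[OF polynomial_functions.mult[OF f gen(1)] gen(2)]) (simp add: gen(3))
next
  case (add p q r)
  show ?case by (rule spanned.add[OF add.IH]) (simp add: add(3) distrib_left)
qed

text \<open>The translates of \<open>g\<close> form an invariant family, so \<open>x\<close> moves
  only the coefficient \<open>f\<close>.\<close>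

lemma spanned_act:
  assumes "spanned k p" and x: "x \<in> carrier W"
  shows "spanned k (family_act x p)"
  using assms(1)
proof induction
  case (gen f g p)
  show ?case
  proof (rule spanned.gen[OF P_comp[OF gen(1)] gen(2)])
    fix w v assume w: "w \<in> carrier W"
    have "\<rho> (inv\<^bsub>W\<^esub> (inv\<^bsub>W\<^esub> x \<otimes>\<^bsub>W\<^esub> w)) (\<rho> (inv\<^bsub>W\<^esub> x) v) = \<rho> (inv\<^bsub>W\<^esub> w) v"
      using x w by (simp add: inv_mult_group rho_mult rho_inv)
    then show "family_act x p w v = f (\<rho> (inv\<^bsub>W\<^esub> x) v) * g (\<rho> (inv\<^bsub>W\<^esub> w) v)"
      using x w by (simp add: family_act_def gen(3))
  qed (simp add: x)
next
  case (add p q r)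
  show ?case by (rule spanned.add[OF add.IH]) (simp add: family_act_def add(3) x)
qed

lemma spanned_sum:
  assumes "\<And>i. i \<in> I \<Longrightarrow> spanned k (p i)"
  shows "spanned k (\<lambda>w v. \<Sum>i\<in>I. p i w v)"
  using assms
proof (induction I rule: infinite_finite_induct)
  case (insert i F)
  show ?case by (rule spanned.add[of k "p i" "\<lambda>w v. \<Sum>i\<in>F. p i w v"]) (use insert in auto)
qed (auto intro: spanned_zero)

lemma family_act_mult:
  assumes "x \<in> carrier W" "y \<in> carrier W" "w \<in> carrier W"
  shows "family_act (x \<otimes>\<^bsub>W\<^esub> y) p w v = family_act x (family_act y p) w v"
  using assms by (simp add: family_act_def inv_mult_group rho_mult m_assoc)

text \<open>Products telescope: p - (x y)(p) = (p - x(p)) + x(p - y(p)), so reflections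
  suffice.\<close>

lemma spanned_minus_act:
  assumes "\<And>H. H \<in> Hyp \<Longrightarrow> spanned k (\<lambda>w v. p w v - family_act (s_refl H) p w v)"
    and "x \<in> carrier W"
  shows "spanned k (\<lambda>w v. p w v - family_act x p w v)"
  using assms(2)
proof (induction rule: group_induct)
  case one
  show ?case by (rule spanned_zero) (simp add: family_act_def rho_one)
next
  case (mult x y)
  show ?case
  proof (rule spanned.add[OF mult(3) spanned_act[OF mult(4) mult(1)]])
    fix w v assume "w \<in> carrier W"
    then show "p w v - family_act (x \<otimes>\<^bsub>W\<^esub> y) p w v = p w v - family_act x p w v
        + family_act x (\<lambda>w v. p w v - family_act y p w v) w v"
      using mult(1,2) family_act_mult by (simp add: family_act_def)
  qed
qed (rule assms(1))

text \<open>The sum \<open>N\<close> is invariant, hence consists of the translates of its member at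
  1. In the congruence for \<open>N\<close> at w = 1, the member at s_H is s_H applied to the one at
  1; this gives quasi-invariance, even with one power of the form to spare.\<close>

lemma spanned_average:
  assumes k: "k \<in> multiplicities sc W \<rho>" and p: "quasi_covariant (\<lambda>H. 2 * k H + 1) p"
  shows "spanned k (\<lambda>w v. \<Sum>x\<in>carrier W. family_act x p w v)"
proof -
  define N where "N = (\<lambda>w v. \<Sum>x\<in>carrier W. family_act x p w v)"
  have m: "(\<lambda>H. 2 * k H + 1) \<in> multiplicities sc W \<rho>" using k by (simp add: multiplicities_def)
  have N_inv: "N w v = N \<one>\<^bsub>W\<^esub> (\<rho> (inv\<^bsub>W\<^esub> w) v)" if w: "w \<in> carrier W" for w v
  proof -
    have bij: "bij_betw (\<lambda>x. w \<otimes>\<^bsub>W\<^esub> x) (carrier W) (carrier W)"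
      by (rule bij_betw_byWitness[of _ "\<lambda>x. inv\<^bsub>W\<^esub> w \<otimes>\<^bsub>W\<^esub> x"])
        (use w in \<open>auto simp flip: m_assoc\<close>)
    have "N w v = (\<Sum>x\<in>carrier W. family_act (w \<otimes>\<^bsub>W\<^esub> x) p w v)"
      unfolding N_def by (rule sum.reindex_bij_betw[OF bij, symmetric])
    also have "\<dots> = N \<one>\<^bsub>W\<^esub> (\<rho> (inv\<^bsub>W\<^esub> w) v)"
      unfolding N_def by (rule sum.cong) (use w in \<open>auto simp: family_act_def inv_mult_group rho_mult m_assoc\<close>)
    finally show ?thesis .
  qed
  have N: "quasi_covariant (\<lambda>H. 2 * k H + 1) N"
    unfolding N_def by (intro quasi_covariant_sum quasi_covariant_act[OF m p])
  have "N \<one>\<^bsub>W\<^esub> \<in> quasi_invariants sc W \<rho> \<alpha> k"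
    unfolding quasi_invariant_iff
  proof (intro conjI ballI)
    show "N \<one>\<^bsub>W\<^esub> \<in> P" using N by (simp add: quasi_covariant_def)
    fix H assume H: "H \<in> Hyp"
    have "fun_dvd sc (\<lambda>v. \<alpha> H v ^ (2 * k H + 1)) (\<lambda>v. N \<one>\<^bsub>W\<^esub> v - N (s_refl H) v)"
    proof -
      have "fun_dvd sc (\<lambda>v. \<alpha> H v ^ (2 * k H + 1))
          (\<lambda>v. N \<one>\<^bsub>W\<^esub> v - N (s_refl H \<otimes>\<^bsub>W\<^esub> \<one>\<^bsub>W\<^esub>) v)"
        using N H one_closed unfolding quasi_covariant_def by blast
      then show ?thesis using refl_props(1)[OF H] by simp
    qed
    then obtain h where h: "h \<in> P" "\<And>v. N \<one>\<^bsub>W\<^esub> v - N (s_refl H) v = \<alpha> H v ^ (2 * k H + 1) * h v"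
      unfolding fun_dvd_def by blast
    have "N \<one>\<^bsub>W\<^esub> (\<rho> (s_refl H) v) - N \<one>\<^bsub>W\<^esub> v = \<alpha> H v ^ (2 * k H) * - (\<alpha> H v * h v)" for v
      using h(2)[of v] N_inv[OF refl_props(1)[OF H], of v] unfolding refl_inv[OF H]
      by (simp add: algebra_simps)
    then show "fun_dvd sc (\<lambda>v. \<alpha> H v ^ (2 * k H)) (\<lambda>v. N \<one>\<^bsub>W\<^esub> (\<rho> (s_refl H) v) - N \<one>\<^bsub>W\<^esub> v)"
      by (rule fun_dvdI[OF polynomial_functions_uminus[OF polynomial_functions.mult[OF alpha_P[OF H] h(1)]]])
  qed
  then have "spanned k N"
    by (rule spanned.gen[OF polynomial_functions.const[of 1]]) (simp add: N_inv[symmetric])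
  then show ?thesis by (simp add: N_def)
qed

lemma quasi_covariant_degree:
  assumes "quasi_covariant m p"
  shows "\<exists>n. \<forall>w\<in>carrier W. degree_less sc n (p w)"
proof -
  have "\<forall>w\<in>carrier W. \<exists>n. degree_less sc n (p w)"
    using assms polynomial_degree_less unfolding quasi_covariant_def by blast
  then obtain d where d: "\<And>w. w \<in> carrier W \<Longrightarrow> degree_less sc (d w) (p w)" by metis
  have "degree_less sc (Max (d ` carrier W)) (p w)" if "w \<in> carrier W" for w
    by (rule degree_less_mono[OF d[OF that]]) (use fin that in auto)
  then show ?thesis by blast
qed

text \<open>
  Induction on the degree: \<open>p - s\<^sub>\<alpha>(p) = \<alpha> \<Delta>\<^sub>\<alpha>(p)\<close> is spanned since \<open>\<Delta>\<^sub>\<alpha>(p)\<close> has smaller degree.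
  Hence \<open>p\<close> is congruent to its average over the group, which is itself spanned.
\<close>
theorem quasi_covariant_spanned:
  assumes k: "k \<in> multiplicities sc W \<rho>" and p: "quasi_covariant (\<lambda>H. 2 * k H + 1) p"
  shows "spanned k p"
proof -
  have m: "(\<lambda>H. 2 * k H + 1) \<in> multiplicities sc W \<rho>" using k by (simp add: multiplicities_def)
  obtain n where "\<And>w. w \<in> carrier W \<Longrightarrow> degree_less sc n (p w)"
    using quasi_covariant_degree[OF p] by blast
  then show ?thesis using p
  proof (induction n arbitrary: p)
    case 0
    then show ?case using degree_less_0 by (intro spanned_zero) fastforce
  next
    case (Suc n)
    have step: "spanned k (\<lambda>w v. p w v - family_act (s_refl H) p w v)" if H: "H \<in> Hyp" for H
    proof -
      obtain q where q: "quasi_covariant (\<lambda>H. 2 * k H + 1) q"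
        "\<And>w. w \<in> carrier W \<Longrightarrow> degree_less sc n (q w)"
        "\<And>w v. w \<in> carrier W \<Longrightarrow> p w v - family_act (s_refl H) p w v = \<alpha> H v * q w v"
        using divided_difference[OF m Suc.prems(2) H HOL.refl Suc.prems(1)] by auto
      show ?thesis by (rule spanned_cong[OF spanned_mult[OF Suc.IH[OF q(2,1)] alpha_P[OF H]] q(3)])
    qed
    have diff: "spanned k (\<lambda>w v. \<Sum>x\<in>carrier W. p w v - family_act x p w v)"
      by (rule spanned_sum, rule spanned_minus_act[OF step])
    have avg: "spanned k (\<lambda>w v. \<Sum>x\<in>carrier W. family_act x p w v)"
      by (rule spanned_average[OF k Suc.prems(2)])
    \<comment> \<open>Summing p = (p - x(p)) + x(p) over the group yields |W| p, and |W| is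
      invertible in characteristic zero.\<close>
    let ?c = "of_nat (card (carrier W)) :: 'k"
    have "?c \<noteq> 0" using fin by auto
    have "spanned k (\<lambda>w v. ?c * p w v)"
      by (rule spanned.add[OF diff avg]) (simp add: sum_subtractf)
    from spanned_mult[OF this polynomial_functions.const[of "1 / ?c"]] show ?case
      by (rule spanned_cong) (use \<open>?c \<noteq> 0\<close> in simp)
  qed
qed

text \<open>Makes the inductive span explicit; the elements of the dual bases are read off from such
  a sum.\<close>

lemma spanned_finite_sum:
  assumes "spanned k p"
  shows "\<exists>n::nat. \<exists>f g. (\<forall>i<n. f i \<in> P \<and> g i \<in> quasi_invariants sc W \<rho> \<alpha> k) \<and>
    (\<forall>w\<in>carrier W. \<forall>v. p w v = (\<Sum>i<n. f i v * g i (\<rho> (inv\<^bsub>W\<^esub> w) v)))"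
  using assms
proof induction
  case (gen f g p)
  then show ?case by (intro exI[of _ "1::nat"] exI[of _ "\<lambda>_. f"] exI[of _ "\<lambda>_. g"]) auto
next
  case (add p q r)
  from add.IH(1) obtain n f g where
    1: "\<And>i. i < (n::nat) \<Longrightarrow> f i \<in> P \<and> g i \<in> quasi_invariants sc W \<rho> \<alpha> k"
    "\<And>w v. w \<in> carrier W \<Longrightarrow> p w v = (\<Sum>i<n. f i v * g i (\<rho> (inv\<^bsub>W\<^esub> w) v))" by blast
  from add.IH(2) obtain n' f' g' where
    2: "\<And>i. i < (n'::nat) \<Longrightarrow> f' i \<in> P \<and> g' i \<in> quasi_invariants sc W \<rho> \<alpha> k"
    "\<And>w v. w \<in> carrier W \<Longrightarrow> q w v = (\<Sum>i<n'. f' i v * g' i (\<rho> (inv\<^bsub>W\<^esub> w) v))" by blast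
  let ?f = "\<lambda>i. if i < n then f i else f' (i - n)" and ?g = "\<lambda>i. if i < n then g i else g' (i - n)"
  have split: "(\<Sum>i<n + n'. F i) = (\<Sum>i<n. F i) + (\<Sum>i<n'. F (n + i))" for F :: "nat \<Rightarrow> 'k"
    by (induction n') (simp_all add: add.assoc)
  show ?case
    by (intro exI[of _ "n + n'"] exI[of _ ?f] exI[of _ ?g]) (auto simp: split 1 2 add(3))
qed

section \<open>The product of the forms, its character, and skew averages\<close>

definition \<delta> :: "'v \<Rightarrow> 'k" where
  "\<delta> v = (\<Prod>H\<in>Hyp. \<alpha> H v)"

lemma prod_alpha_P: "F \<subseteq> Hyp \<Longrightarrow> (\<lambda>v. \<Prod>H\<in>F. \<alpha> H v) \<in> P"
  by (intro polynomial_functions_prod alpha_P) auto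

lemma delta_P: "\<delta> \<in> P"
  using prod_alpha_P[of Hyp] by (simp add: \<delta>_def[abs_def])

lemma alpha_not_dvd_prod:
  assumes "finite F" "F \<subseteq> Hyp" "H \<in> Hyp" "H \<notin> F"
  shows "\<not> fun_dvd sc (\<alpha> H) (\<lambda>v. \<Prod>H\<in>F. \<alpha> H v)"
  using assms
proof (induction F rule: finite_induct)
  case empty
  \<comment> \<open>The empty product is 1, whereas every multiple of a linear form vanishes at the
    origin.\<close>
  obtain u where "\<alpha> H u \<noteq> 0" using alpha_nonzero[OF \<open>H \<in> Hyp\<close>] by blast
  moreover have "\<alpha> H 0 = 0" by (rule linear_zero[OF alpha_linear[OF \<open>H \<in> Hyp\<close>]])
  ultimately show ?case unfolding fun_dvd_def by (metis mult_zero_left prod.empty zero_neq_one)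
next
  case (insert H' F)
  obtain u where u: "\<alpha> H u \<noteq> 0" using alpha_nonzero[OF \<open>H \<in> Hyp\<close>] by blast
  have H': "H' \<in> Hyp" "F \<subseteq> Hyp" using insert.prems by auto
  show ?case
  proof
    assume "fun_dvd sc (\<alpha> H) (\<lambda>v. \<Prod>H\<in>insert H' F. \<alpha> H v)"
    then have "fun_dvd sc (\<alpha> H) (\<lambda>v. \<alpha> H' v * (\<Prod>H\<in>F. \<alpha> H v))" using insert by simp
    then have "fun_dvd sc (\<alpha> H) (\<alpha> H') \<or> fun_dvd sc (\<alpha> H) (\<lambda>v. \<Prod>H\<in>F. \<alpha> H v)"
      by (rule form_prime[OF alpha_P[OF H'(1)] prod_alpha_P[OF H'(2)]
            alpha_linear[OF \<open>H \<in> Hyp\<close>] u])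
    then show False using alpha_not_dvd[OF \<open>H \<in> Hyp\<close> H'(1)] insert by auto
  qed
qed

text \<open>The forms are pairwise coprime primes: each further one divides the product of the
  earlier ones times the current quotient, but not that product, so it splits off from the
  quotient.\<close>

lemma prod_alpha_dvd:
  assumes "finite F" "F \<subseteq> Hyp" "p \<in> P" "\<And>H v. H \<in> F \<Longrightarrow> \<alpha> H v = 0 \<Longrightarrow> p v = 0"
  shows "\<exists>q\<in>P. \<forall>v. p v = (\<Prod>H\<in>F. \<alpha> H v) * q v"
  using assms
proof (induction F rule: finite_induct)
  case empty
  then show ?case by auto
next
  case (insert H F)
  have H: "H \<in> Hyp" "F \<subseteq> Hyp" using insert.prems by auto
  obtain u where u: "\<alpha> H u \<noteq> 0" using alpha_nonzero[OF H(1)] by blast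
  have "\<exists>q\<in>P. \<forall>v. p v = (\<Prod>H\<in>F. \<alpha> H v) * q v"
    by (rule insert.IH[OF H(2) insert.prems(2)]) (use insert.prems(3) in blast)
  then obtain q where q: "q \<in> P" "\<And>v. p v = (\<Prod>H\<in>F. \<alpha> H v) * q v" by blast
  have "fun_dvd sc (\<alpha> H) p"
    using form_dvd_iff[OF insert.prems(2) alpha_linear[OF H(1)] u] insert.prems(3) by blast
  then have "fun_dvd sc (\<alpha> H) (\<lambda>v. (\<Prod>H\<in>F. \<alpha> H v) * q v)"
    using q(2) by (simp add: fun_dvd_def)
  then have "fun_dvd sc (\<alpha> H) (\<lambda>v. \<Prod>H\<in>F. \<alpha> H v) \<or> fun_dvd sc (\<alpha> H) q"
    by (rule form_prime[OF prod_alpha_P[OF H(2)] q(1) alpha_linear[OF H(1)] u])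
  then have "fun_dvd sc (\<alpha> H) q"
    using alpha_not_dvd_prod[OF insert.hyps(1) H(2,1) insert.hyps(2)] by blast
  then obtain r where "r \<in> P" "\<And>v. q v = \<alpha> H v * r v" unfolding fun_dvd_def by blast
  then show ?case using q(2) insert.hyps by (auto simp: mult_ac)
qed

lemma delta_nonzero: "\<exists>u. \<delta> u \<noteq> 0"
proof -
  have "\<exists>u. (\<Prod>H\<in>F. \<alpha> H u) \<noteq> 0" if "finite F" "F \<subseteq> Hyp" for F
    using that
  proof (induction F rule: finite_induct)
    case (insert H F)
    then have H: "H \<in> Hyp" "F \<subseteq> Hyp" by auto
    then have "\<not> (\<forall>v. \<alpha> H v = 0)" "\<not> (\<forall>v. (\<Prod>H\<in>F. \<alpha> H v) = 0)"
      using alpha_nonzero insert.IH by blast+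
    then show ?case
      using polynomial_functions_no_zero_divisors[OF vector_space_axioms alpha_P[OF H(1)]
          prod_alpha_P[OF H(2)]] insert.hyps by auto
  qed auto
  then show ?thesis using finite_Hyp by (simp add: \<delta>_def)
qed

lemma delta_cancel: "p \<in> P \<Longrightarrow> q \<in> P \<Longrightarrow> (\<And>v. \<delta> v * p v = \<delta> v * q v) \<Longrightarrow> p = q"
  using delta_nonzero polynomial_functions_cancel[OF vector_space_axioms delta_P] by blast

text \<open>The group permutes the hyperplanes, and with them the factors of \<delta> up to
  scalars.\<close>

lemma delta_semi_invariant:
  assumes w: "w \<in> carrier W"
  shows "\<exists>c. \<forall>v. \<delta> (\<rho> w v) = c * \<delta> v"
proof -
  have bij: "bij_betw (\<lambda>H. \<rho> w ` H) Hyp Hyp"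
  proof (rule bij_betw_byWitness[of _ "\<lambda>H. \<rho> (inv\<^bsub>W\<^esub> w) ` H"])
    show "(\<lambda>H. \<rho> w ` H) ` Hyp \<subseteq> Hyp" using refl_conjugate(1)[OF _ w] by blast
    show "(\<lambda>H. \<rho> (inv\<^bsub>W\<^esub> w) ` H) ` Hyp \<subseteq> Hyp"
      using refl_conjugate(1)[OF _ inv_closed[OF w]] by blast
  qed (use rho_inv[OF w] in \<open>auto simp: image_image\<close>)
  obtain c where c: "\<And>H v. H \<in> Hyp \<Longrightarrow> \<alpha> (\<rho> w ` H) (\<rho> w v) = c H * \<alpha> H v"
    using alpha_conjugate[OF _ w] by metis
  have "\<delta> (\<rho> w v) = (\<Prod>H\<in>Hyp. c H) * \<delta> v" for v
  proof -
    have "\<delta> (\<rho> w v) = (\<Prod>H\<in>Hyp. \<alpha> (\<rho> w ` H) (\<rho> w v))"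
      unfolding \<delta>_def by (rule prod.reindex_bij_betw[OF bij, symmetric])
    then show ?thesis by (simp add: c \<delta>_def prod.distrib)
  qed
  then show ?thesis by blast
qed

text \<open>The sign character, defined through its effect on \<delta>. Beyond that effect, the
  proof relies on multiplicativity, nonzero values, and values different from 1 at
  reflections.\<close>

definition \<epsilon> :: "'w \<Rightarrow> 'k" where
  "\<epsilon> w = (SOME c. \<forall>v. \<delta> (\<rho> w v) = c * \<delta> v)"

lemma delta_rho: "w \<in> carrier W \<Longrightarrow> \<delta> (\<rho> w v) = \<epsilon> w * \<delta> v"
  using someI_ex[OF delta_semi_invariant] unfolding \<epsilon>_def by blast

lemma epsilon_eqI: "w \<in> carrier W \<Longrightarrow> (\<And>v. \<delta> (\<rho> w v) = c * \<delta> v) \<Longrightarrow> \<epsilon> w = c"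
  using delta_nonzero delta_rho by (metis mult_right_cancel)

lemma epsilon_one: "\<epsilon> \<one>\<^bsub>W\<^esub> = 1"
  by (rule epsilon_eqI) (auto simp: rho_one)

lemma epsilon_mult: "w \<in> carrier W \<Longrightarrow> x \<in> carrier W \<Longrightarrow> \<epsilon> (w \<otimes>\<^bsub>W\<^esub> x) = \<epsilon> w * \<epsilon> x"
  by (rule epsilon_eqI) (auto simp: rho_mult delta_rho)

lemma epsilon_nonzero: "w \<in> carrier W \<Longrightarrow> \<epsilon> w \<noteq> 0"
  using epsilon_mult[of w "inv\<^bsub>W\<^esub> w"] epsilon_one by auto

text \<open>The factor \<alpha>_H changes sign under its reflection. If \<delta> were fixed, the
  product of the other forms would change sign too, hence vanish on H and be divisible by
  \<alpha>_H, against coprimality.\<close>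

lemma epsilon_refl:
  assumes H: "H \<in> Hyp"
  shows "\<epsilon> (s_refl H) \<noteq> 1"
proof
  assume 1: "\<epsilon> (s_refl H) = 1"
  note s = refl_props(1)[OF H]
  obtain u where u: "\<alpha> H u \<noteq> 0" using alpha_nonzero[OF H] by blast
  define d where "d v = (\<Prod>H\<in>Hyp - {H}. \<alpha> H v)" for v
  have dP: "d \<in> P" unfolding d_def[abs_def] by (rule prod_alpha_P) auto
  have \<delta>_eq: "\<delta> v = \<alpha> H v * d v" for v
    unfolding \<delta>_def d_def by (rule prod.remove[OF finite_Hyp H])
  have "\<alpha> H v * d (\<rho> (s_refl H) v) = \<alpha> H v * (- d v)" for v
    using delta_rho[OF s, of v] unfolding \<delta>_eq 1 alpha_refl[OF H]
    by (simp add: eq_neg_iff_add_eq_0 neg_eq_iff_add_eq_0)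
  then have "(\<lambda>v. d (\<rho> (s_refl H) v)) = (\<lambda>v. - d v)"
    by (rule polynomial_functions_cancel[OF vector_space_axioms alpha_P[OF H] P_comp[OF dP s]
          polynomial_functions_uminus[OF dP] u])
  then have "d (\<rho> (s_refl H) v) = - d v" for v by (rule fun_cong)
  then have "d v = 0" if "\<alpha> H v = 0" for v
  proof -
    have "d v + d v = 0"
      using \<open>d (\<rho> (s_refl H) v) = - d v\<close> unfolding refl_fixes[OF H that] by simp
    then show ?thesis by (simp flip: mult_2)
  qed
  then have "fun_dvd sc (\<alpha> H) d" using form_dvd_iff[OF dP alpha_linear[OF H] u] by blast
  then show False using alpha_not_dvd_prod[OF _ _ H, of "Hyp - {H}"] finite_Hyp
    by (simp add: d_def[abs_def])
qed

text \<open>The sum is \<open>\<epsilon>\<close>-semi-invariant and \<open>\<epsilon>(s\<^sub>\<alpha>) \<noteq> 1\<close>, so it vanishes on every hyperplane.\<close>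
lemma skew_average:
  assumes f: "f \<in> P"
  shows "\<exists>r\<in>Inv. \<forall>v. \<delta> v * r v = (\<Sum>w\<in>carrier W. 1 / \<epsilon> w * f (\<rho> w v))"
proof -
  define N where "N v = (\<Sum>w\<in>carrier W. 1 / \<epsilon> w * f (\<rho> w v))" for v
  have NP: "N \<in> P"
    unfolding N_def[abs_def]
    by (intro polynomial_functions_sum polynomial_functions_scale P_comp f)
  have N_rho: "N (\<rho> x v) = \<epsilon> x * N v" if x: "x \<in> carrier W" for x v
  proof -
    have bij: "bij_betw (\<lambda>w. w \<otimes>\<^bsub>W\<^esub> x) (carrier W) (carrier W)"
      by (rule bij_betw_byWitness[of _ "\<lambda>w. w \<otimes>\<^bsub>W\<^esub> inv\<^bsub>W\<^esub> x"]) (use x in \<open>auto simp: m_assoc\<close>)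
    have "N v = (\<Sum>w\<in>carrier W. 1 / \<epsilon> (w \<otimes>\<^bsub>W\<^esub> x) * f (\<rho> (w \<otimes>\<^bsub>W\<^esub> x) v))"
      unfolding N_def by (rule sum.reindex_bij_betw[OF bij, symmetric])
    also have "\<epsilon> x * \<dots> = N (\<rho> x v)"
      unfolding N_def sum_distrib_left
      by (rule sum.cong) (use x epsilon_nonzero in \<open>auto simp: epsilon_mult rho_mult\<close>)
    finally show ?thesis by simp
  qed
  have "N v = 0" if H: "H \<in> Hyp" and v: "\<alpha> H v = 0" for H v
    using N_rho[OF refl_props(1)[OF H], of v] refl_fixes[OF H v] epsilon_refl[OF H] by auto
  then have "\<exists>q\<in>P. \<forall>v. N v = (\<Prod>H\<in>Hyp. \<alpha> H v) * q v"
    by (intro prod_alpha_dvd finite_Hyp NP) auto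
  then obtain r where r: "r \<in> P" "\<And>v. N v = \<delta> v * r v" unfolding \<delta>_def by blast
  \<comment> \<open>\<open>N\<close> and \<delta> transform by the same character, so their quotient
    is invariant.\<close>
  have "(\<lambda>v. r (\<rho> x v)) = r" if x: "x \<in> carrier W" for x
  proof (rule delta_cancel[OF P_comp[OF r(1) x] r(1)])
    fix v
    have "\<epsilon> x * (\<delta> v * r (\<rho> x v)) = \<epsilon> x * (\<delta> v * r v)"
      using N_rho[OF x, of v] unfolding r(2) delta_rho[OF x] by (simp add: mult_ac)
    then show "\<delta> v * r (\<rho> x v) = \<delta> v * r v" using epsilon_nonzero[OF x] by simp
  qed
  then have "r \<in> Inv" using r(1) by (simp add: invariant_functions_def act_def)
  then show ?thesis using r(2) unfolding N_def by metis
qed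

lemma zero_multiplicities: "(\<lambda>_. 0) \<in> multiplicities sc W \<rho>"
  by (simp add: multiplicities_def)

section \<open>Dual bases\<close>

lemma diagonal_element:
  shows "\<exists>n::nat. \<exists>a b. (\<forall>i<n. a i \<in> P \<and> b i \<in> P) \<and>
    (\<forall>w\<in>carrier W. \<forall>v. (\<Sum>i<n. a i v * b i (\<rho> w v)) = (if w = \<one>\<^bsub>W\<^esub> then \<delta> v else 0))"
proof -
  let ?p = "\<lambda>w v. if w = \<one>\<^bsub>W\<^esub> then \<delta> v else 0"
  have "quasi_covariant (\<lambda>H. 2 * 0 + 1) ?p"
    unfolding quasi_covariant_def
  proof (intro conjI ballI)
    show "?p w \<in> P" for w
      using delta_P polynomial_functions.const[of 0] by (cases "w = \<one>\<^bsub>W\<^esub>") simp_all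
    fix H w assume H: "H \<in> Hyp" and w: "w \<in> carrier W"
    have "\<delta> v = \<alpha> H v * (\<Prod>H\<in>Hyp - {H}. \<alpha> H v)" for v
      unfolding \<delta>_def by (rule prod.remove[OF finite_Hyp H])
    then have "fun_dvd sc (\<alpha> H) \<delta>"
      by (intro fun_dvdI[OF prod_alpha_P[of "Hyp - {H}"]]) auto
    moreover have "fun_dvd sc (\<alpha> H) (\<lambda>_. 0)"
      by (rule fun_dvdI[OF polynomial_functions.const[of 0]]) simp
    ultimately have "fun_dvd sc (\<alpha> H) (?p x)" for x by (cases "x = \<one>\<^bsub>W\<^esub>") simp_all
    then show "fun_dvd sc (\<lambda>v. \<alpha> H v ^ (2 * 0 + 1)) (\<lambda>v. ?p w v - ?p (s_refl H \<otimes>\<^bsub>W\<^esub> w) v)"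
      unfolding mult_0_right add_0 power_one_right by (intro fun_dvd_diff)
  qed
  from spanned_finite_sum[OF quasi_covariant_spanned[OF zero_multiplicities this]]
  obtain n :: nat and a b where
    ab: "\<And>i. i < n \<Longrightarrow> a i \<in> P \<and> b i \<in> quasi_invariants sc W \<rho> \<alpha> (\<lambda>_. 0)"
    "\<And>w v. w \<in> carrier W \<Longrightarrow> ?p w v = (\<Sum>i<n. a i v * b i (\<rho> (inv\<^bsub>W\<^esub> w) v))" by blast
  \<comment> \<open>Replacing w by its inverse is harmless, because the family only distinguishes
    the identity from the rest.\<close>
  have "(\<Sum>i<n. a i v * b i (\<rho> w v)) = ?p w v" if w: "w \<in> carrier W" for w v
    using ab(2)[of "inv\<^bsub>W\<^esub> w" v] w by (simp add: inv_eq_1_iff)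
  then show ?thesis using ab(1) quasi_invariant_P by blast
qed

text \<open>\<open>r i\<close> is the value of the form at \<open>b i\<close> times
  \<open>f\<close>, pinned down by its product with \<delta> instead of by a division. In \<delta>
  times the sum of the a_i r_i, summation over i first kills all terms except w = 1, which
  contributes \<delta> f.\<close>

lemma dual_bases:
  "\<exists>n::nat. \<exists>a b. (\<forall>i<n. a i \<in> P \<and> b i \<in> P) \<and>
    (\<forall>f\<in>P. \<forall>r. (\<forall>i<n. r i \<in> P \<and> (\<forall>v. \<delta> v * r i v =
      (\<Sum>w\<in>carrier W. 1 / \<epsilon> w * (b i (\<rho> w v) * f (\<rho> w v))))) \<longrightarrow>
      f = (\<lambda>v. \<Sum>i<n. a i v * r i v))"
proof -
  obtain n :: nat and a b where ab: "\<And>i. i < n \<Longrightarrow> a i \<in> P" "\<And>i. i < n \<Longrightarrow> b i \<in> P"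
    "\<And>w v. w \<in> carrier W \<Longrightarrow> (\<Sum>i<n. a i v * b i (\<rho> w v)) = (if w = \<one>\<^bsub>W\<^esub> then \<delta> v else 0)"
    using diagonal_element by blast
  have main: "f = (\<lambda>v. \<Sum>i<n. a i v * r i v)"
    if f: "f \<in> P" and r: "\<And>i. i < n \<Longrightarrow> r i \<in> P" "\<And>i v. i < n \<Longrightarrow> \<delta> v * r i v =
      (\<Sum>w\<in>carrier W. 1 / \<epsilon> w * (b i (\<rho> w v) * f (\<rho> w v)))" for f r
    proof (rule delta_cancel[OF f])
      show "(\<lambda>v. \<Sum>i<n. a i v * r i v) \<in> P"
        by (intro polynomial_functions_sum polynomial_functions.mult ab r) auto
      fix v
      have "\<delta> v * (\<Sum>i<n. a i v * r i v) = (\<Sum>i<n. a i v * (\<delta> v * r i v))"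
        by (simp add: sum_distrib_left mult_ac)
      also have "\<dots> = (\<Sum>i<n. a i v * (\<Sum>w\<in>carrier W. 1 / \<epsilon> w * (b i (\<rho> w v) * f (\<rho> w v))))"
        by (rule sum.cong) (auto simp: r)
      also have "\<dots> = (\<Sum>w\<in>carrier W. \<Sum>i<n. a i v * (1 / \<epsilon> w * (b i (\<rho> w v) * f (\<rho> w v))))"
        unfolding sum_distrib_left by (rule sum.swap)
      also have "\<dots> = (\<Sum>w\<in>carrier W. 1 / \<epsilon> w * f (\<rho> w v) * (\<Sum>i<n. a i v * b i (\<rho> w v)))"
        by (simp add: sum_distrib_left mult_ac)
      also have "\<dots> = (\<Sum>w\<in>carrier W. if w = \<one>\<^bsub>W\<^esub> then \<delta> v * f v else 0)"
        by (rule sum.cong) (auto simp: ab(3) rho_one epsilon_one)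
      also have "\<dots> = \<delta> v * f v" using fin by simp
      finally show "\<delta> v * f v = \<delta> v * (\<Sum>i<n. a i v * r i v)" ..
    qed
  show ?thesis
    by (intro exI[of _ n] exI[of _ a] exI[of _ b] conjI ballI allI impI) (auto intro!: ab main)
qed

end

section \<open>Algebra homomorphisms\<close>

lemma alg_homI:
  assumes "\<And>x. x \<in> carrier A \<Longrightarrow> h x \<in> carrier B"
    and "\<And>x y. x \<in> carrier A \<Longrightarrow> y \<in> carrier A \<Longrightarrow> h (x \<otimes>\<^bsub>A\<^esub> y) = h x \<otimes>\<^bsub>B\<^esub> h y"
    and "\<And>x y. x \<in> carrier A \<Longrightarrow> y \<in> carrier A \<Longrightarrow> h (x \<oplus>\<^bsub>A\<^esub> y) = h x \<oplus>\<^bsub>B\<^esub> h y"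
    and "h \<one>\<^bsub>A\<^esub> = \<one>\<^bsub>B\<^esub>"
    and "\<And>c x. x \<in> carrier A \<Longrightarrow> h (c \<odot>\<^bsub>A\<^esub> x) = c \<odot>\<^bsub>B\<^esub> h x"
  shows "h \<in> alg_hom A B"
  using assms by (auto simp: alg_hom_def intro: ring_hom_memI)

lemma alg_homD:
  assumes "h \<in> alg_hom A B"
  shows "x \<in> carrier A \<Longrightarrow> h x \<in> carrier B"
    and "x \<in> carrier A \<Longrightarrow> y \<in> carrier A \<Longrightarrow> h (x \<otimes>\<^bsub>A\<^esub> y) = h x \<otimes>\<^bsub>B\<^esub> h y"
    and "x \<in> carrier A \<Longrightarrow> y \<in> carrier A \<Longrightarrow> h (x \<oplus>\<^bsub>A\<^esub> y) = h x \<oplus>\<^bsub>B\<^esub> h y"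
    and "h \<one>\<^bsub>A\<^esub> = \<one>\<^bsub>B\<^esub>"
    and "x \<in> carrier A \<Longrightarrow> h (c \<odot>\<^bsub>A\<^esub> x) = c \<odot>\<^bsub>B\<^esub> h x"
  using assms by (auto simp: alg_hom_def ring_hom_mult ring_hom_add ring_hom_one ring_hom_closed)

lemma alg_hom_comp: "g \<in> alg_hom B C \<Longrightarrow> f \<in> alg_hom A B \<Longrightarrow> g \<circ> f \<in> alg_hom A C"
  by (rule alg_homI) (simp_all add: alg_homD)

lemma k_algebraD:
  fixes C :: "('k::field, 'c) module"
  assumes "is_k_algebra C"
  shows "cring C" "x \<in> carrier C \<Longrightarrow> c \<odot>\<^bsub>C\<^esub> x \<in> carrier C"
    "x \<in> carrier C \<Longrightarrow> (c \<odot>\<^bsub>C\<^esub> \<one>\<^bsub>C\<^esub>) \<otimes>\<^bsub>C\<^esub> x = c \<odot>\<^bsub>C\<^esub> x"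
proof -
  interpret algebra base_field C by fact
  have c: "c \<in> carrier base_field" for c :: 'k by (simp add: ring_of_type_algebra_def)
  show "cring C" ..
  show "x \<in> carrier C \<Longrightarrow> c \<odot>\<^bsub>C\<^esub> x \<in> carrier C" using smult_closed c by blast
  show "x \<in> carrier C \<Longrightarrow> (c \<odot>\<^bsub>C\<^esub> \<one>\<^bsub>C\<^esub>) \<otimes>\<^bsub>C\<^esub> x = c \<odot>\<^bsub>C\<^esub> x"
    using smult_assoc2[OF c one_closed, of x] by simp
qed

text \<open>Moves ring axioms between records with equal ring operations, here from
  \<open>tensor_ring\<close> to \<open>tensor_alg\<close>.\<close>

lemma cring_cong:
  assumes "cring A" and "carrier B = carrier A"
    and "\<And>x y. x \<otimes>\<^bsub>B\<^esub> y = x \<otimes>\<^bsub>A\<^esub> y" "\<And>x y. x \<oplus>\<^bsub>B\<^esub> y = x \<oplus>\<^bsub>A\<^esub> y"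
    and "\<one>\<^bsub>B\<^esub> = \<one>\<^bsub>A\<^esub>" "\<zero>\<^bsub>B\<^esub> = \<zero>\<^bsub>A\<^esub>"
  shows "cring B"
proof -
  interpret A: cring A by fact
  show ?thesis
  proof (rule cringI)
    show "abelian_group B"
    proof (rule abelian_groupI)
      fix x assume "x \<in> carrier B"
      then show "\<exists>y\<in>carrier B. y \<oplus>\<^bsub>B\<^esub> x = \<zero>\<^bsub>B\<^esub>"
        by (intro bexI[of _ "\<ominus>\<^bsub>A\<^esub> x"]) (simp_all add: assms A.l_neg)
    qed (auto simp: assms A.a_assoc intro: A.a_comm)
    show "comm_monoid B" by (rule comm_monoidI) (auto simp: assms A.m_assoc intro: A.m_comm)
  qed (auto simp: assms A.l_distr)
qed

lemma prod_alg_simps [simp]: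
  "carrier (prod_alg I A) = (\<Pi>\<^sub>E i\<in>I. carrier A)"
  "p \<otimes>\<^bsub>prod_alg I A\<^esub> q = (\<lambda>i\<in>I. p i \<otimes>\<^bsub>A\<^esub> q i)"
  "p \<oplus>\<^bsub>prod_alg I A\<^esub> q = (\<lambda>i\<in>I. p i \<oplus>\<^bsub>A\<^esub> q i)"
  "\<one>\<^bsub>prod_alg I A\<^esub> = (\<lambda>i\<in>I. \<one>\<^bsub>A\<^esub>)" "\<zero>\<^bsub>prod_alg I A\<^esub> = (\<lambda>i\<in>I. \<zero>\<^bsub>A\<^esub>)"
  "c \<odot>\<^bsub>prod_alg I A\<^esub> p = (\<lambda>i\<in>I. c \<odot>\<^bsub>A\<^esub> p i)"
  by (simp_all add: prod_alg_def)

lemma prod_alg_cring: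
  assumes "cring A"
  shows "cring (prod_alg I A)"
proof -
  interpret A: cring A by fact
  show ?thesis
  proof (rule cringI)
    show "abelian_group (prod_alg I A)"
    proof (rule abelian_groupI)
      fix p assume "p \<in> carrier (prod_alg I A)"
      then show "\<exists>q\<in>carrier (prod_alg I A). q \<oplus>\<^bsub>prod_alg I A\<^esub> p = \<zero>\<^bsub>prod_alg I A\<^esub>"
        by (intro bexI[of _ "\<lambda>i\<in>I. \<ominus>\<^bsub>A\<^esub> p i"]) (auto simp: PiE_iff A.l_neg intro!: restrict_ext)
    next
      fix p assume "p \<in> carrier (prod_alg I A)"
      then show "\<zero>\<^bsub>prod_alg I A\<^esub> \<oplus>\<^bsub>prod_alg I A\<^esub> p = p"
        by (auto simp: PiE_iff extensional_def restrict_def fun_eq_iff)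
    qed (auto simp: PiE_iff A.a_assoc intro!: restrict_ext A.a_comm)
    show "comm_monoid (prod_alg I A)"
    proof (rule comm_monoidI)
      fix p assume "p \<in> carrier (prod_alg I A)"
      then show "\<one>\<^bsub>prod_alg I A\<^esub> \<otimes>\<^bsub>prod_alg I A\<^esub> p = p"
        by (auto simp: PiE_iff extensional_def restrict_def fun_eq_iff)
    qed (auto simp: PiE_iff A.m_assoc intro!: restrict_ext A.m_comm)
  qed (auto simp: PiE_iff A.l_distr intro!: restrict_ext)
qed

lemma tensor_alg_simps:
  "carrier (tensor_alg R A B) = carrier (tensor_ring R A B)"
  "x \<otimes>\<^bsub>tensor_alg R A B\<^esub> y = x \<otimes>\<^bsub>tensor_ring R A B\<^esub> y"
  "x \<oplus>\<^bsub>tensor_alg R A B\<^esub> y = x \<oplus>\<^bsub>tensor_ring R A B\<^esub> y"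
  "\<one>\<^bsub>tensor_alg R A B\<^esub> = \<one>\<^bsub>tensor_ring R A B\<^esub>"
  "\<zero>\<^bsub>tensor_alg R A B\<^esub> = \<zero>\<^bsub>tensor_ring R A B\<^esub>"
  "c \<odot>\<^bsub>tensor_alg R A B\<^esub> x =
    pure_tensor R A B (c \<odot>\<^bsub>A\<^esub> \<one>\<^bsub>A\<^esub>) \<one>\<^bsub>B\<^esub> \<otimes>\<^bsub>tensor_ring R A B\<^esub> x"
  by (simp_all add: tensor_alg_def)

context tensor_product
begin

lemma tensor_alg_cring: "cring (tensor_alg R A B)"
  by (rule cring_cong[OF tensor_ring_cring]) (simp_all add: tensor_alg_simps)

text \<open>Scalars act on the tensor algebra through the left factor, as multiplication by (c 1)
  (x) 1. Linearity of the lift therefore comes from \<open>f\<close>, while \<open>g\<close> enters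
  as a ring homomorphism.\<close>

lemma tensor_alg_lift:
  assumes U: "cring U" "\<And>c x. x \<in> carrier U \<Longrightarrow> (c \<odot>\<^bsub>U\<^esub> \<one>\<^bsub>U\<^esub>) \<otimes>\<^bsub>U\<^esub> x = c \<odot>\<^bsub>U\<^esub> x"
    and A: "\<And>c. c \<odot>\<^bsub>A\<^esub> \<one>\<^bsub>A\<^esub> \<in> carrier A"
    and f: "f \<in> alg_hom A U" and g: "g \<in> ring_hom B U"
    and fg: "\<And>r. r \<in> R \<Longrightarrow> f r = g r"
  shows "\<exists>h\<in>alg_hom (tensor_alg R A B) U.
    \<forall>a\<in>carrier A. \<forall>b\<in>carrier B. h (pt a b) = f a \<otimes>\<^bsub>U\<^esub> g b"
proof -
  interpret U: cring U by fact
  have f': "f \<in> ring_hom A U" using f by (simp add: alg_hom_def)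
  from tensor_lift[OF U(1) f' g fg] obtain h where h: "h \<in> ring_hom T U"
    "\<And>a b. a \<in> carrier A \<Longrightarrow> b \<in> carrier B \<Longrightarrow> h (pt a b) = f a \<otimes>\<^bsub>U\<^esub> g b" by blast
  have "h \<in> alg_hom (tensor_alg R A B) U"
  proof (rule alg_homI)
    fix c x assume x: "x \<in> carrier (tensor_alg R A B)"
    have "f \<one>\<^bsub>A\<^esub> = \<one>\<^bsub>U\<^esub>" "f (c \<odot>\<^bsub>A\<^esub> \<one>\<^bsub>A\<^esub>) = c \<odot>\<^bsub>U\<^esub> \<one>\<^bsub>U\<^esub>"
      using alg_homD(4)[OF f] alg_homD(5)[OF f A.one_closed] by auto
    moreover have "f (c \<odot>\<^bsub>A\<^esub> \<one>\<^bsub>A\<^esub>) \<in> carrier U" by (rule alg_homD(1)[OF f A])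
    moreover have "h x \<in> carrier U" using x ring_hom_closed[OF h(1)] by (simp add: tensor_alg_simps)
    ultimately show "h (c \<odot>\<^bsub>tensor_alg R A B\<^esub> x) = c \<odot>\<^bsub>U\<^esub> h x"
      using x ring_hom_mult[OF h(1) pt_closed[OF A B.one_closed], of x]
      by (simp add: h(2) A ring_hom_one[OF g] U(2) tensor_alg_simps)
  qed (use h(1) in \<open>simp_all add: ring_hom_closed ring_hom_mult ring_hom_add ring_hom_one tensor_alg_simps\<close>)
  then show ?thesis using h(2) by blast
qed

lemma pt_scale:
  assumes A: "\<And>c a. a \<in> carrier A \<Longrightarrow> c \<odot>\<^bsub>A\<^esub> a = (c \<odot>\<^bsub>A\<^esub> \<one>\<^bsub>A\<^esub>) \<otimes>\<^bsub>A\<^esub> a"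
    "\<And>c. c \<odot>\<^bsub>A\<^esub> \<one>\<^bsub>A\<^esub> \<in> carrier A"
    and a: "a \<in> carrier A" and b: "b \<in> carrier B"
  shows "pt (c \<odot>\<^bsub>A\<^esub> a) b = c \<odot>\<^bsub>tensor_alg R A B\<^esub> pt a b"
  using pt_mult[OF A(2) a B.one_closed b] A(1)[OF a] b by (simp add: tensor_alg_simps)

end

section \<open>Quasi-covariants as a tensor product\<close>

locale quasi_invariant_data = reflection_group sc W S \<rho> \<alpha>
  for sc :: "'k::field_char_0 \<Rightarrow> 'v::ab_group_add \<Rightarrow> 'v"
    and W :: "'w monoid" and S \<rho> \<alpha> +
  fixes k :: "'v set \<Rightarrow> nat"
  assumes k: "k \<in> multiplicities sc W \<rho>"
begin

abbreviation "K \<equiv> coord_alg sc"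
abbreviation "Q \<equiv> quasi_invariants sc W \<rho> \<alpha> k"
abbreviation "KQ \<equiv> quasi_invariant_alg sc W \<rho> \<alpha> k"
abbreviation "ptK \<equiv> pure_tensor Inv K K"
abbreviation "ptQ \<equiv> pure_tensor Inv K KQ"
abbreviation "F \<equiv> coord_alg_W sc W"
abbreviation "M \<equiv> quasi_covariants sc W \<rho> \<alpha> (\<lambda>H. 2 * k H + 1)"
abbreviation "KM \<equiv> quasi_covariant_alg sc W \<rho> \<alpha> (\<lambda>H. 2 * k H + 1)"

section \<open>The algebras involved and the comorphisms between them\<close>

text \<open>\<open>const_family\<close> and \<open>translates\<close> are the comorphisms of the two
  components v and w^-1 v of the map q; the value of \<phi> at f (x) g is the product of their
  values.\<close>

definition const_family :: "('v \<Rightarrow> 'k) \<Rightarrow> 'w \<Rightarrow> 'v \<Rightarrow> 'k" where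
  "const_family f = (\<lambda>w\<in>carrier W. \<lambda>v. f v)"

definition translates :: "('v \<Rightarrow> 'k) \<Rightarrow> 'w \<Rightarrow> 'v \<Rightarrow> 'k" where
  "translates g = (\<lambda>w\<in>carrier W. \<lambda>v. g (\<rho> (inv\<^bsub>W\<^esub> w) v))"

lemma Inv_subset_P: "Inv \<subseteq> P"
  by (auto simp: invariant_functions_def)

lemma Inv_rho: "f \<in> Inv \<Longrightarrow> w \<in> carrier W \<Longrightarrow> f (\<rho> w v) = f v"
  using inv_inv[of w] by (auto simp: invariant_functions_def act_def dest!: bspec[of _ _ "inv\<^bsub>W\<^esub> w"] fun_cong)

lemma Q_subset_P: "Q \<subseteq> P"
  using quasi_invariant_P by blast

lemma Inv_subset_Q: "Inv \<subseteq> Q"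
  using Inv_subset_P
  by (auto simp: quasi_invariant_iff Inv_rho refl_props fun_dvd_def
      intro: bexI[OF _ polynomial_functions.const[of 0]])

lemma const_Q: "(\<lambda>_. c) \<in> Q"
  using Inv_subset_Q by (auto simp: invariant_functions_def act_def polynomial_functions.const)

lemma add_Q: "f \<in> Q \<Longrightarrow> g \<in> Q \<Longrightarrow> (\<lambda>v. f v + g v) \<in> Q"
  unfolding quasi_invariant_iff
proof (intro conjI ballI)
  fix H assume fg: "f \<in> P \<and> (\<forall>H\<in>Hyp. fun_dvd sc (\<lambda>v. \<alpha> H v ^ (2 * k H)) (\<lambda>v. f (\<rho> (s_refl H) v) - f v))"
    "g \<in> P \<and> (\<forall>H\<in>Hyp. fun_dvd sc (\<lambda>v. \<alpha> H v ^ (2 * k H)) (\<lambda>v. g (\<rho> (s_refl H) v) - g v))"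
    and H: "H \<in> Hyp"
  then have "fun_dvd sc (\<lambda>v. \<alpha> H v ^ (2 * k H))
      (\<lambda>v. (f (\<rho> (s_refl H) v) - f v) + (g (\<rho> (s_refl H) v) - g v))"
    by (intro fun_dvd_add) auto
  then show "fun_dvd sc (\<lambda>v. \<alpha> H v ^ (2 * k H))
      (\<lambda>v. f (\<rho> (s_refl H) v) + g (\<rho> (s_refl H) v) - (f v + g v))"
    by (simp add: algebra_simps)
qed (auto intro: polynomial_functions.add)

lemma mult_Q: "f \<in> Q \<Longrightarrow> g \<in> Q \<Longrightarrow> (\<lambda>v. f v * g v) \<in> Q"
  unfolding quasi_invariant_iff
proof (intro conjI ballI)
  fix H assume fg: "f \<in> P \<and> (\<forall>H\<in>Hyp. fun_dvd sc (\<lambda>v. \<alpha> H v ^ (2 * k H)) (\<lambda>v. f (\<rho> (s_refl H) v) - f v))"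
    "g \<in> P \<and> (\<forall>H\<in>Hyp. fun_dvd sc (\<lambda>v. \<alpha> H v ^ (2 * k H)) (\<lambda>v. g (\<rho> (s_refl H) v) - g v))"
    and H: "H \<in> Hyp"
  then have "fun_dvd sc (\<lambda>v. \<alpha> H v ^ (2 * k H))
      (\<lambda>v. g (\<rho> (s_refl H) v) * (f (\<rho> (s_refl H) v) - f v) + f v * (g (\<rho> (s_refl H) v) - g v))"
    by (intro fun_dvd_add fun_dvd_mult P_comp) (auto simp: refl_props)
  then show "fun_dvd sc (\<lambda>v. \<alpha> H v ^ (2 * k H))
      (\<lambda>v. f (\<rho> (s_refl H) v) * g (\<rho> (s_refl H) v) - f v * g v)"
    by (simp add: algebra_simps)
qed (auto intro: polynomial_functions.mult)

lemma KQ_cring: "cring KQ"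
  by (rule coord_subalg_cring[OF Q_subset_P const_Q add_Q mult_Q])

lemma KQ_simps:
  "carrier KQ = Q" "\<one>\<^bsub>KQ\<^esub> = (\<lambda>_. 1)" "f \<otimes>\<^bsub>KQ\<^esub> g = (\<lambda>v. f v * g v)"
  "f \<oplus>\<^bsub>KQ\<^esub> g = (\<lambda>v. f v + g v)" "c \<odot>\<^bsub>KQ\<^esub> f = (\<lambda>v. c * f v)" "\<zero>\<^bsub>KQ\<^esub> = (\<lambda>_. 0)"
  by (simp_all add: coord_alg_def)

lemma KK: "tensor_product Inv K K"
  by (rule tensor_product.intro) (simp_all add: coord_alg_cring Inv_subset_P)

lemma KKQ: "tensor_product Inv K KQ"
  by (rule tensor_product.intro) (simp_all add: coord_alg_cring KQ_cring Inv_subset_P Inv_subset_Q)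

lemma F_cring: "cring F"
  by (rule prod_alg_cring[OF coord_alg_cring])

lemma KM_simps:
  "carrier KM = M" "\<one>\<^bsub>KM\<^esub> = \<one>\<^bsub>F\<^esub>" "p \<otimes>\<^bsub>KM\<^esub> q = p \<otimes>\<^bsub>F\<^esub> q"
  "p \<oplus>\<^bsub>KM\<^esub> q = p \<oplus>\<^bsub>F\<^esub> q" "c \<odot>\<^bsub>KM\<^esub> p = c \<odot>\<^bsub>F\<^esub> p"
  by simp_all

lemma M_subset: "M \<subseteq> carrier F"
  by (auto simp: quasi_covariants_def)

lemma restrict_M:
  "quasi_covariant (\<lambda>H. 2 * k H + 1) p \<Longrightarrow> restrict p (carrier W) \<in> M"
  unfolding quasi_covariants_iff by (auto elim!: quasi_covariant_cong)

lemma const_family_M: "f \<in> P \<Longrightarrow> const_family f \<in> M"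
  unfolding const_family_def by (intro restrict_M quasi_covariant_constant)

lemma translates_M: "g \<in> Q \<Longrightarrow> translates g \<in> M"
  unfolding translates_def by (intro restrict_M quasi_invariant_translates k)

lemma M_quasi_covariant: "p \<in> M \<Longrightarrow> quasi_covariant (\<lambda>H. 2 * k H + 1) p"
  by (simp add: quasi_covariants_iff)

lemma M_closed:
  assumes p: "p \<in> M"
  shows "q \<in> M \<Longrightarrow> p \<otimes>\<^bsub>F\<^esub> q \<in> M" and "q \<in> M \<Longrightarrow> p \<oplus>\<^bsub>F\<^esub> q \<in> M" and "c \<odot>\<^bsub>F\<^esub> p \<in> M"
  using restrict_M[OF quasi_covariant_mult[OF p[THEN M_quasi_covariant]], of q]
    restrict_M[OF quasi_covariant_add[OF p[THEN M_quasi_covariant]], of q]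
    restrict_M[OF quasi_covariant_mult[OF quasi_covariant_constant[OF polynomial_functions.const[of c]]
        p[THEN M_quasi_covariant]]] M_quasi_covariant[of q]
  by simp_all

lemma const_family_hom: "const_family \<in> alg_hom K F"
  by (rule alg_homI)
    (auto simp: const_family_def PiE_iff intro!: restrict_ext)

lemma translates_hom: "translates \<in> alg_hom K F"
  by (rule alg_homI)
    (auto simp: translates_def PiE_iff P_comp intro!: restrict_ext)

text \<open>Expresses that both components of q have the same image in V//W; it is the balancing
  condition for the tensor product.\<close>

lemma const_family_Inv: "f \<in> Inv \<Longrightarrow> const_family f = translates f"
  by (auto simp: const_family_def translates_def Inv_rho intro!: restrict_ext)

lemma const_times_translates:
  "const_family f \<otimes>\<^bsub>F\<^esub> translates g = (\<lambda>w\<in>carrier W. \<lambda>v. f v * g (\<rho> (inv\<^bsub>W\<^esub> w) v))"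
  by (auto simp: const_family_def translates_def intro!: restrict_ext)

lemma F_scale_one: "x \<in> carrier F \<Longrightarrow> (c \<odot>\<^bsub>F\<^esub> \<one>\<^bsub>F\<^esub>) \<otimes>\<^bsub>F\<^esub> x = c \<odot>\<^bsub>F\<^esub> x"
  by (auto intro!: restrict_ext)

lemma phi_exists:
  "\<exists>\<phi>\<in>alg_hom (tensor_alg Inv K K) F. \<forall>f\<in>P. \<forall>g\<in>P.
    \<phi> (ptK f g) = const_family f \<otimes>\<^bsub>F\<^esub> translates g"
  using tensor_product.tensor_alg_lift[OF KK F_cring F_scale_one _ const_family_hom _ const_family_Inv] translates_hom
  by (auto simp: alg_hom_def polynomial_functions.const)

text \<open>Induced by the inclusion of the quasi-invariants in k[V]. Its injectivity is not a
  matter of flatness here but a consequence of the final result, because \<phi> composed with it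
  turns out to be injective.\<close>

lemma iota_exists:
  "\<exists>\<iota>\<in>alg_hom (tensor_alg Inv K KQ) (tensor_alg Inv K K). \<forall>f\<in>P. \<forall>g\<in>Q.
    \<iota> (ptQ f g) = ptK f g"
proof -
  interpret TK: cring "tensor_ring Inv K K" by (rule tensor_product.tensor_ring_cring[OF KK])
  let ?f = "\<lambda>f. ptK f (\<lambda>_. 1)" and ?g = "\<lambda>g. ptK (\<lambda>_. 1) g"
  have one: "(\<lambda>_. 1) \<in> P" and const: "\<And>c. (\<lambda>_. c) \<in> P" by (auto intro: polynomial_functions.const)
  have K1: "ptK (\<lambda>_. 1) (\<lambda>_. 1) = \<one>\<^bsub>tensor_ring Inv K K\<^esub>" using tensor_product.pt_one[OF KK] by simp
  have f: "?f \<in> alg_hom K (tensor_alg Inv K K)"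
  proof (rule alg_homI)
    show "?f (c \<odot>\<^bsub>K\<^esub> x) = c \<odot>\<^bsub>tensor_alg Inv K K\<^esub> ?f x" if "x \<in> carrier K" for c x
      by (rule tensor_product.pt_scale[OF KK]) (use that const in auto)
  qed (use one tensor_product.pt_mult[OF KK, of _ _ "\<lambda>_. 1" "\<lambda>_. 1"] tensor_product.pt_add_left[OF KK, of _ _ "\<lambda>_. 1"]
      tensor_product.pt_closed[OF KK, of _ "\<lambda>_. 1"] K1 in \<open>auto simp: tensor_alg_simps\<close>)
  have g: "?g \<in> ring_hom KQ (tensor_alg Inv K K)"
  proof (rule ring_hom_memI)
    fix x y assume "x \<in> carrier KQ" "y \<in> carrier KQ"
    then have "x \<in> P" "y \<in> P" using Q_subset_P by auto
    then show "?g (x \<otimes>\<^bsub>KQ\<^esub> y) = ?g x \<otimes>\<^bsub>tensor_alg Inv K K\<^esub> ?g y"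
      "?g (x \<oplus>\<^bsub>KQ\<^esub> y) = ?g x \<oplus>\<^bsub>tensor_alg Inv K K\<^esub> ?g y"
      using tensor_product.pt_mult[OF KK, of "\<lambda>_. 1" "\<lambda>_. 1" x y] tensor_product.pt_add_right[OF KK, of "\<lambda>_. 1" x y] one by (simp_all add: tensor_alg_simps)
  next
    fix x assume "x \<in> carrier KQ"
    then show "?g x \<in> carrier (tensor_alg Inv K K)" using tensor_product.pt_closed[OF KK, of "\<lambda>_. 1" x] one Q_subset_P
      by (auto simp: tensor_alg_simps)
  qed (use K1 in \<open>simp add: tensor_alg_simps\<close>)
  have R: "?f r = ?g r" if "r \<in> Inv" for r
    using tensor_product.pt_balanced[OF KK, of "\<lambda>_. 1" r "\<lambda>_. 1"] that one by simp
  have "\<exists>h\<in>alg_hom (tensor_alg Inv K KQ) (tensor_alg Inv K K).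
    \<forall>a\<in>carrier K. \<forall>b\<in>carrier KQ. h (ptQ a b) = ?f a \<otimes>\<^bsub>tensor_alg Inv K K\<^esub> ?g b"
  proof (rule tensor_product.tensor_alg_lift[OF KKQ tensor_product.tensor_alg_cring[OF KK] _ _ f g R])
    fix c x assume "x \<in> carrier (tensor_alg Inv K K)"
    then show "(c \<odot>\<^bsub>tensor_alg Inv K K\<^esub> \<one>\<^bsub>tensor_alg Inv K K\<^esub>) \<otimes>\<^bsub>tensor_alg Inv K K\<^esub> x
        = c \<odot>\<^bsub>tensor_alg Inv K K\<^esub> x"
      using tensor_product.pt_closed[OF KK const[of c, folded coord_alg_simps(1)] const[of 1, folded coord_alg_simps(1)]]
      by (simp add: tensor_alg_simps)
  qed (use const in auto)
  moreover have "ptK f (\<lambda>_. 1) \<otimes>\<^bsub>tensor_ring Inv K K\<^esub> ptK (\<lambda>_. 1) g = ptK f g"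
    if "f \<in> P" "g \<in> Q" for f g
    using tensor_product.pt_mult[OF KK, of f "\<lambda>_. 1" "\<lambda>_. 1" g] that one Q_subset_P by auto
  ultimately show ?thesis by (auto simp: KQ_simps tensor_alg_simps)
qed

abbreviation "TQ \<equiv> tensor_alg Inv K KQ"

lemma TQ_cring: "cring TQ"
  by (rule tensor_product.tensor_alg_cring[OF KKQ])

lemma ptQ_closed: "f \<in> P \<Longrightarrow> g \<in> Q \<Longrightarrow> ptQ f g \<in> carrier TQ"
  using tensor_product.pt_closed[OF KKQ, of f g] by (simp add: KQ_simps tensor_alg_simps)

lemma TQ_induct [consumes 1, case_names pure add]:
  assumes "z \<in> carrier TQ" "\<And>f g. f \<in> P \<Longrightarrow> g \<in> Q \<Longrightarrow> Y (ptQ f g)"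
    and "\<And>x y. x \<in> carrier TQ \<Longrightarrow> y \<in> carrier TQ \<Longrightarrow> Y x \<Longrightarrow> Y y \<Longrightarrow> Y (x \<oplus>\<^bsub>TQ\<^esub> y)"
  shows "Y z"
  using tensor_product.tensor_induct[OF KKQ, of z Y] assms by (simp add: KQ_simps tensor_alg_simps)

lemma ptQ_bilinear:
  shows "f \<in> P \<Longrightarrow> f' \<in> P \<Longrightarrow> g \<in> Q \<Longrightarrow> ptQ (\<lambda>v. f v + f' v) g = ptQ f g \<oplus>\<^bsub>TQ\<^esub> ptQ f' g"
    and "f \<in> P \<Longrightarrow> g \<in> Q \<Longrightarrow> g' \<in> Q \<Longrightarrow> ptQ f (\<lambda>v. g v + g' v) = ptQ f g \<oplus>\<^bsub>TQ\<^esub> ptQ f g'"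
    and "f \<in> P \<Longrightarrow> r \<in> Inv \<Longrightarrow> g \<in> Q \<Longrightarrow> ptQ (\<lambda>v. f v * r v) g = ptQ f (\<lambda>v. r v * g v)"
    and "g \<in> Q \<Longrightarrow> ptQ (\<lambda>_. 0) g = \<zero>\<^bsub>TQ\<^esub>"
    and "f \<in> P \<Longrightarrow> ptQ f (\<lambda>_. 0) = \<zero>\<^bsub>TQ\<^esub>"
  using tensor_product.pt_add_left[OF KKQ, of f f' g] tensor_product.pt_add_right[OF KKQ, of f g g']
    tensor_product.pt_balanced[OF KKQ, of f r g] tensor_product.pt_zero_left[OF KKQ, of g]
    tensor_product.pt_zero_right[OF KKQ, of f]
  by (simp_all add: KQ_simps tensor_alg_simps)

lemma ptQ_sum:
  assumes f: "\<And>i. i < (n::nat) \<Longrightarrow> f i \<in> P" and g: "g \<in> Q"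
  shows "ptQ (\<lambda>v. \<Sum>i<n. f i v) g = (\<Oplus>\<^bsub>TQ\<^esub>i\<in>{..<n}. ptQ (f i) g)"
proof -
  interpret TQ: cring TQ by (rule TQ_cring)
  show ?thesis
    using f
  proof (induction n)
    case 0
    then show ?case using ptQ_bilinear(4) g by simp
  next
    case (Suc n)
    have "(\<lambda>v. \<Sum>i<n. f i v) \<in> P" by (intro polynomial_functions_sum) (use Suc in auto)
    then have "ptQ (\<lambda>v. (\<Sum>i<n. f i v) + f n v) g = ptQ (\<lambda>v. \<Sum>i<n. f i v) g \<oplus>\<^bsub>TQ\<^esub> ptQ (f n) g"
      by (rule ptQ_bilinear(1)) (use Suc.prems g in auto)
    moreover have "(\<Oplus>\<^bsub>TQ\<^esub>i\<in>{..<Suc n}. ptQ (f i) g) = ptQ (f n) g \<oplus>\<^bsub>TQ\<^esub> (\<Oplus>\<^bsub>TQ\<^esub>i\<in>{..<n}. ptQ (f i) g)"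
      unfolding lessThan_Suc
      by (rule TQ.finsum_insert) (use Suc.prems g ptQ_closed in auto)
    moreover have "(\<Oplus>\<^bsub>TQ\<^esub>i\<in>{..<n}. ptQ (f i) g) \<in> carrier TQ" "ptQ (f n) g \<in> carrier TQ"
      using Suc.prems g ptQ_closed by (auto intro!: TQ.finsum_closed)
    ultimately show ?case using Suc TQ.a_comm by simp
  qed
qed

section \<open>The restricted map and its bijectivity\<close>

text \<open>Values on pure tensors determine an additive map, so the isomorphism is proved from this
  property alone and without reference to the factorisation through k[V] (x) k[V].\<close>

definition restricts_phi :: "((('v \<Rightarrow> 'k) \<times> ('v \<Rightarrow> 'k) \<Rightarrow>\<^sub>0 int) set \<Rightarrow> 'w \<Rightarrow> 'v \<Rightarrow> 'k) \<Rightarrow> bool" where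
  "restricts_phi \<Phi> \<longleftrightarrow> \<Phi> \<in> alg_hom TQ F \<and>
    (\<forall>f\<in>P. \<forall>g\<in>Q. \<Phi> (ptQ f g) = const_family f \<otimes>\<^bsub>F\<^esub> translates g)"

context
  fixes \<Phi>
  assumes \<Phi>: "restricts_phi \<Phi>"
begin

lemma Phi_hom: "\<Phi> \<in> alg_hom TQ F"
  using \<Phi> by (simp add: restricts_phi_def)

lemma Phi_pt: "f \<in> P \<Longrightarrow> g \<in> Q \<Longrightarrow> \<Phi> (ptQ f g) = const_family f \<otimes>\<^bsub>F\<^esub> translates g"
  using \<Phi> by (simp add: restricts_phi_def)

lemma Phi_in_M: "z \<in> carrier TQ \<Longrightarrow> \<Phi> z \<in> M"
proof (induction z rule: TQ_induct)
  case (pure f g)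
  show ?case unfolding Phi_pt[OF pure] by (intro M_closed(1) const_family_M translates_M pure)
next
  case (add x y)
  show ?case unfolding alg_homD(3)[OF Phi_hom add(1,2)] by (intro M_closed(2) add)
qed

text \<open>Agreement is asserted on the group because \<open>spanned\<close> ignores other values;
  extensionality of the elements of \<open>M\<close> closes the gap in
  \<open>Phi_iso\<close>.\<close>

lemma Phi_surj:
  assumes "spanned k p"
  shows "\<exists>z\<in>carrier TQ. \<forall>w\<in>carrier W. \<Phi> z w = p w"
  using assms
proof induction
  case (gen f g p)
  then show ?case
    by (intro bexI[OF _ ptQ_closed[OF gen(1,2)]])
      (auto simp: Phi_pt const_times_translates fun_eq_iff simp del: prod_alg_simps)
next
  case (add p q r)
  interpret TQ: cring TQ by (rule TQ_cring)
  obtain x y where x: "x \<in> carrier TQ" "\<And>w. w \<in> carrier W \<Longrightarrow> \<Phi> x w = p w"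
    and y: "y \<in> carrier TQ" "\<And>w. w \<in> carrier W \<Longrightarrow> \<Phi> y w = q w"
    using add.IH by blast
  show ?case
  proof (intro bexI ballI)
    show "\<Phi> (x \<oplus>\<^bsub>TQ\<^esub> y) w = r w" if "w \<in> carrier W" for w
      unfolding alg_homD(3)[OF Phi_hom x(1) y(1)] using that x y add(3) by (auto simp: fun_eq_iff)
  qed (rule TQ.a_closed[OF x(1) y(1)])
qed

text \<open>
  Every tensor is recovered from its image: \<open>f = \<Sum> a\<^sub>i r\<^sub>i\<close> with \<open>\<delta> r\<^sub>i = \<Sum>\<^sub>w \<epsilon>(w)\<inverse> w\<inverse>(b\<^sub>i f)\<close>
  invariant, so \<open>f \<otimes> g = \<Sum> a\<^sub>i \<otimes> r\<^sub>i g\<close>, and \<open>r\<^sub>i g\<close> depends on \<open>\<phi>(f \<otimes> g)\<close> only.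
\<close>
lemma Phi_kernel:
  assumes z: "z \<in> carrier TQ" and "\<Phi> z = \<zero>\<^bsub>F\<^esub>"
  shows "z = \<zero>\<^bsub>TQ\<^esub>"
proof -
  interpret TQ: cring TQ by (rule TQ_cring)
  obtain n :: nat and a b where ab: "\<forall>i<n. a i \<in> P \<and> b i \<in> P"
    and expand: "\<forall>f\<in>P. \<forall>r. (\<forall>i<n. r i \<in> P \<and> (\<forall>v. \<delta> v * r i v =
      (\<Sum>w\<in>carrier W. 1 / \<epsilon> w * (b i (\<rho> w v) * f (\<rho> w v))))) \<longrightarrow>
      f = (\<lambda>v. \<Sum>i<n. a i v * r i v)"
    using dual_bases by blast
  have a: "\<And>i. i < n \<Longrightarrow> a i \<in> P" and b: "\<And>i. i < n \<Longrightarrow> b i \<in> P" using ab by auto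
  \<comment> \<open>For f (x) g the coefficient \<open>h i\<close> is r_i g. The equation for
    \<delta> h_i is additive in \<open>z\<close> and mentions \<open>z\<close> only through its
    image, so the claim passes to sums and controls the kernel.\<close>
  have "\<exists>h. (\<forall>i<n. h i \<in> Q \<and>
      (\<forall>v. \<delta> v * h i v = (\<Sum>w\<in>carrier W. 1 / \<epsilon> w * (b i (\<rho> w v) * \<Phi> z w (\<rho> w v))))) \<and>
      z = (\<Oplus>\<^bsub>TQ\<^esub>i\<in>{..<n}. ptQ (a i) (h i))"
    using z
  proof (induction z rule: TQ_induct)
    case (pure f g)
    have "\<forall>i. \<exists>r. i < n \<longrightarrow> r \<in> Inv \<and>
        (\<forall>v. \<delta> v * r v = (\<Sum>w\<in>carrier W. 1 / \<epsilon> w * (b i (\<rho> w v) * f (\<rho> w v))))"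
      using skew_average polynomial_functions.mult[OF b pure(1)] by blast
    from choice[OF this] obtain r where r: "\<And>i. i < n \<Longrightarrow> r i \<in> Inv"
      "\<And>i v. i < n \<Longrightarrow> \<delta> v * r i v = (\<Sum>w\<in>carrier W. 1 / \<epsilon> w * (b i (\<rho> w v) * f (\<rho> w v)))"
      by blast
    have rP: "r i \<in> P" "r i \<in> Q" if "i < n" for i using r(1)[OF that] Inv_subset_P Inv_subset_Q by auto
    have f: "f = (\<lambda>v. \<Sum>i<n. a i v * r i v)" using expand pure(1) r(2) rP(1) by blast
    show ?case
    proof (intro exI conjI allI impI)
      fix i v assume i: "i < n"
      show "(\<lambda>v. r i v * g v) \<in> Q" by (rule mult_Q[OF rP(2)[OF i] pure(2)])
      \<comment> \<open>Evaluation at \<open>\<rho> w v\<close> undoes the translation of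
        \<open>g\<close> and leaves g(v), a factor independent of w that leaves the sum.\<close>
      have img: "\<Phi> (ptQ f g) w (\<rho> w v) = f (\<rho> w v) * g v" if "w \<in> carrier W" for w
        unfolding Phi_pt[OF pure] const_times_translates using that rho_inv(1) by simp
      have "\<delta> v * (r i v * g v) = (\<Sum>w\<in>carrier W. 1 / \<epsilon> w * (b i (\<rho> w v) * f (\<rho> w v))) * g v"
        by (simp only: r(2)[OF i, symmetric] mult.assoc)
      also have "\<dots> = (\<Sum>w\<in>carrier W. 1 / \<epsilon> w * (b i (\<rho> w v) * \<Phi> (ptQ f g) w (\<rho> w v)))"
        unfolding sum_distrib_right by (rule sum.cong) (simp_all add: img)
      finally show "\<delta> v * (r i v * g v)
          = (\<Sum>w\<in>carrier W. 1 / \<epsilon> w * (b i (\<rho> w v) * \<Phi> (ptQ f g) w (\<rho> w v)))" .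
    next
      have "ptQ f g = (\<Oplus>\<^bsub>TQ\<^esub>i\<in>{..<n}. ptQ (\<lambda>v. a i v * r i v) g)"
        using ptQ_sum[of n "\<lambda>i v. a i v * r i v" g] a rP(1) pure(2) polynomial_functions.mult
        unfolding f[symmetric] by blast
      also have "\<dots> = (\<Oplus>\<^bsub>TQ\<^esub>i\<in>{..<n}. ptQ (a i) (\<lambda>v. r i v * g v))"
      proof (rule TQ.finsum_cong'[OF HOL.refl])
        show "(\<lambda>i. ptQ (a i) (\<lambda>v. r i v * g v)) \<in> {..<n} \<rightarrow> carrier TQ"
          using ptQ_closed[OF a mult_Q[OF rP(2) pure(2)]] by blast
        show "ptQ (\<lambda>v. a i v * r i v) g = ptQ (a i) (\<lambda>v. r i v * g v)" if "i \<in> {..<n}" for i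
          by (rule ptQ_bilinear(3)) (use a r(1) pure(2) that in auto)
      qed
      finally show "ptQ f g = (\<Oplus>\<^bsub>TQ\<^esub>i\<in>{..<n}. ptQ (a i) (\<lambda>v. r i v * g v))" .
    qed
  next
    case (add x y)
    obtain h where h: "\<And>i. i < n \<Longrightarrow> h i \<in> Q"
      "\<And>i v. i < n \<Longrightarrow> \<delta> v * h i v = (\<Sum>w\<in>carrier W. 1 / \<epsilon> w * (b i (\<rho> w v) * \<Phi> x w (\<rho> w v)))"
      "x = (\<Oplus>\<^bsub>TQ\<^esub>i\<in>{..<n}. ptQ (a i) (h i))" using add(3) by blast
    obtain h' where h': "\<And>i. i < n \<Longrightarrow> h' i \<in> Q"
      "\<And>i v. i < n \<Longrightarrow> \<delta> v * h' i v = (\<Sum>w\<in>carrier W. 1 / \<epsilon> w * (b i (\<rho> w v) * \<Phi> y w (\<rho> w v)))"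
      "y = (\<Oplus>\<^bsub>TQ\<^esub>i\<in>{..<n}. ptQ (a i) (h' i))" using add(4) by blast
    have xy: "\<Phi> (x \<oplus>\<^bsub>TQ\<^esub> y) w v = \<Phi> x w v + \<Phi> y w v" if "w \<in> carrier W" for w v
      unfolding alg_homD(3)[OF Phi_hom add(1,2)] using that by simp
    show ?case
    proof (intro exI conjI allI impI)
      fix i v assume i: "i < n"
      show "(\<lambda>v. h i v + h' i v) \<in> Q" by (rule add_Q[OF h(1)[OF i] h'(1)[OF i]])
      show "\<delta> v * (h i v + h' i v)
          = (\<Sum>w\<in>carrier W. 1 / \<epsilon> w * (b i (\<rho> w v) * \<Phi> (x \<oplus>\<^bsub>TQ\<^esub> y) w (\<rho> w v)))"
        unfolding distrib_left h(2)[OF i] h'(2)[OF i] sum.distrib[symmetric]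
        by (rule sum.cong) (simp_all add: xy distrib_left)
    next
      have "x \<oplus>\<^bsub>TQ\<^esub> y = (\<Oplus>\<^bsub>TQ\<^esub>i\<in>{..<n}. ptQ (a i) (h i) \<oplus>\<^bsub>TQ\<^esub> ptQ (a i) (h' i))"
        unfolding h(3) h'(3)
        by (rule TQ.finsum_addf[symmetric]) (use ptQ_closed[OF a h(1)] ptQ_closed[OF a h'(1)] in auto)
      also have "\<dots> = (\<Oplus>\<^bsub>TQ\<^esub>i\<in>{..<n}. ptQ (a i) (\<lambda>v. h i v + h' i v))"
      proof (rule TQ.finsum_cong'[OF HOL.refl])
        show "(\<lambda>i. ptQ (a i) (\<lambda>v. h i v + h' i v)) \<in> {..<n} \<rightarrow> carrier TQ"
          using ptQ_closed[OF a add_Q[OF h(1) h'(1)]] by blast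
        show "ptQ (a i) (h i) \<oplus>\<^bsub>TQ\<^esub> ptQ (a i) (h' i) = ptQ (a i) (\<lambda>v. h i v + h' i v)" if "i \<in> {..<n}" for i
          by (rule ptQ_bilinear(2)[symmetric]) (use a h(1) h'(1) that in auto)
      qed
      finally show "x \<oplus>\<^bsub>TQ\<^esub> y = (\<Oplus>\<^bsub>TQ\<^esub>i\<in>{..<n}. ptQ (a i) (\<lambda>v. h i v + h' i v))" .
    qed
  qed
  then obtain h where h: "\<And>i. i < n \<Longrightarrow> h i \<in> Q"
    "\<And>i v. i < n \<Longrightarrow> \<delta> v * h i v = (\<Sum>w\<in>carrier W. 1 / \<epsilon> w * (b i (\<rho> w v) * \<Phi> z w (\<rho> w v)))"
    "z = (\<Oplus>\<^bsub>TQ\<^esub>i\<in>{..<n}. ptQ (a i) (h i))" by blast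
  \<comment> \<open>A vanishing image makes each \<delta> h_i zero; cancelling \<delta> annihilates
    every coefficient in the expansion of \<open>z\<close>.\<close>
  have "h i = (\<lambda>_. 0)" if i: "i < n" for i
  proof (rule delta_cancel)
    show "\<delta> v * h i v = \<delta> v * 0" for v
      unfolding h(2)[OF i] \<open>\<Phi> z = \<zero>\<^bsub>F\<^esub>\<close> by (auto intro: sum.neutral)
  qed (use h(1)[OF i] Q_subset_P polynomial_functions.const in auto)
  then have "ptQ (a i) (h i) = \<zero>\<^bsub>TQ\<^esub>" if "i < n" for i
    using ptQ_bilinear(5)[OF a] that by simp
  then have "z = (\<Oplus>\<^bsub>TQ\<^esub>i\<in>{..<n}. \<zero>\<^bsub>TQ\<^esub>)"
    unfolding h(3) by (intro TQ.finsum_cong') auto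
  then show ?thesis by simp
qed

lemma Phi_iso: "\<Phi> \<in> alg_iso TQ KM"
proof -
  interpret TQ: cring TQ by (rule TQ_cring)
  interpret F: cring F by (rule F_cring)
  have hom: "\<Phi> \<in> alg_hom TQ KM"
    by (rule alg_homI) (simp_all only: KM_simps Phi_in_M alg_homD[OF Phi_hom])
  have "inj_on \<Phi> (carrier TQ)"
  proof (rule inj_onI)
    fix x y assume xy: "x \<in> carrier TQ" "y \<in> carrier TQ" "\<Phi> x = \<Phi> y"
    have y': "\<ominus>\<^bsub>TQ\<^esub> y \<in> carrier TQ" using xy by (rule_tac TQ.a_inv_closed)
    interpret \<Phi>: ring_hom_ring TQ F \<Phi>
      by (rule ring_hom_ringI2[OF TQ.ring_axioms F.ring_axioms]) (use Phi_hom in \<open>simp add: alg_hom_def\<close>)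
    have "\<Phi> (x \<ominus>\<^bsub>TQ\<^esub> y) = \<Phi> x \<ominus>\<^bsub>F\<^esub> \<Phi> y"
      unfolding a_minus_def \<Phi>.hom_add[OF xy(1) y'] \<Phi>.hom_a_inv[OF xy(2)] ..
    also have "\<dots> = \<zero>\<^bsub>F\<^esub>" unfolding xy(3) using F.r_right_minus_eq \<Phi>.hom_closed xy(2) by blast
    finally have "x \<ominus>\<^bsub>TQ\<^esub> y = \<zero>\<^bsub>TQ\<^esub>" by (rule Phi_kernel[OF TQ.minus_closed[OF xy(1,2)]])
    then show "x = y" using TQ.r_right_minus_eq xy by blast
  qed
  moreover have "\<Phi> ` carrier TQ = M"
  proof
    show "\<Phi> ` carrier TQ \<subseteq> M" using Phi_in_M by blast
    show "M \<subseteq> \<Phi> ` carrier TQ"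
    proof
      fix p assume p: "p \<in> M"
      obtain z where z: "z \<in> carrier TQ" "\<And>w. w \<in> carrier W \<Longrightarrow> \<Phi> z w = p w"
        using Phi_surj[OF quasi_covariant_spanned[OF k M_quasi_covariant[OF p]]] by blast
      have "\<Phi> z = p"
        by (rule extensionalityI[of _ "carrier W"])
          (use Phi_in_M[OF z(1)] p z(2) in \<open>auto simp: quasi_covariants_iff\<close>)
      then show "p \<in> \<Phi> ` carrier TQ" using z(1) by blast
    qed
  qed
  ultimately show ?thesis using hom by (simp add: alg_iso_def bij_betw_def)
qed

end

lemma Phi_exists:
  "\<exists>\<phi>\<in>alg_hom (tensor_alg Inv K K) F. (\<forall>f\<in>P. \<forall>g\<in>P.
      \<phi> (ptK f g) = const_family f \<otimes>\<^bsub>F\<^esub> translates g) \<and>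
    (\<exists>\<iota>\<in>alg_hom TQ (tensor_alg Inv K K). (\<forall>f\<in>P. \<forall>g\<in>Q. \<iota> (ptQ f g) = ptK f g) \<and>
      restricts_phi (\<phi> \<circ> \<iota>))"
proof -
  obtain \<phi> where \<phi>: "\<phi> \<in> alg_hom (tensor_alg Inv K K) F"
    "\<And>f g. f \<in> P \<Longrightarrow> g \<in> P \<Longrightarrow> \<phi> (ptK f g) = const_family f \<otimes>\<^bsub>F\<^esub> translates g"
    using phi_exists by blast
  obtain \<iota> where \<iota>: "\<iota> \<in> alg_hom TQ (tensor_alg Inv K K)"
    "\<And>f g. f \<in> P \<Longrightarrow> g \<in> Q \<Longrightarrow> \<iota> (ptQ f g) = ptK f g"
    using iota_exists by blast
  have "restricts_phi (\<phi> \<circ> \<iota>)"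
    unfolding restricts_phi_def
    using alg_hom_comp[OF \<phi>(1) \<iota>(1)] \<phi>(2) \<iota>(2) quasi_invariant_P by (simp del: prod_alg_simps)
  then show ?thesis using \<phi> \<iota> by blast
qed

lemma TQ_scale_closed: "z \<in> carrier TQ \<Longrightarrow> c \<odot>\<^bsub>TQ\<^esub> z \<in> carrier TQ"
proof -
  interpret TQ: cring TQ by (rule TQ_cring)
  assume z: "z \<in> carrier TQ"
  have "ptQ (\<lambda>_. c) (\<lambda>_. 1) \<in> carrier TQ"
    by (rule ptQ_closed[OF polynomial_functions.const const_Q])
  from TQ.m_closed[OF this z] show ?thesis by (simp add: tensor_alg_simps KQ_simps)
qed

section \<open>The isomorphism on points\<close>

text \<open>Given directly by the two comorphisms with values in \<open>M\<close>, so naturality and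
  the factorisation of q are formal, and the algebra isomorphism is needed for bijectivity
  alone.\<close>

definition q_k ::
  "('k, 'c) module \<Rightarrow> (('w \<Rightarrow> 'v \<Rightarrow> 'k) \<Rightarrow> 'c) \<Rightarrow> (('v \<Rightarrow> 'k) \<Rightarrow> 'c) \<times> (('v \<Rightarrow> 'k) \<Rightarrow> 'c)" where
  "q_k C \<xi> = (Spec_map K const_family C \<xi>, Spec_map KQ translates C \<xi>)"

abbreviation "FP \<equiv> fibre_product_over_quotient sc W \<rho> KQ"

lemma pts_Spec: "\<xi> \<in> pts (Spec A) C \<longleftrightarrow> \<xi> \<in> alg_hom A C \<and> \<xi> \<in> extensional (carrier A)"
  by (simp add: Spec_def)

lemma pts_FP: "(x, y) \<in> pts FP C \<longleftrightarrow> x \<in> pts (Spec K) C \<and> y \<in> pts (Spec KQ) C \<and> (\<forall>r\<in>Inv. x r = y r)"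
proof -
  have "compose Inv x (\<lambda>p. p) = compose Inv y (\<lambda>p. p) \<longleftrightarrow> (\<forall>r\<in>Inv. x r = y r)"
    by (auto simp: compose_def restrict_def fun_eq_iff)
  then show ?thesis
    by (simp add: fibre_product_over_quotient_def fibre_product_def Spec_map_def)
qed

lemma q_k_pts:
  assumes \<xi>: "\<xi> \<in> pts (Spec KM) C"
  shows "q_k C \<xi> \<in> pts FP C"
proof -
  have h: "\<xi> \<in> alg_hom KM C" using \<xi> by (simp add: pts_Spec)
  note hD = alg_homD[OF h, unfolded KM_simps]
  have x: "compose P \<xi> const_family \<in> alg_hom K C"
  proof (rule alg_homI)
    fix f g assume fg: "f \<in> carrier K" "g \<in> carrier K"
    then show "compose P \<xi> const_family (f \<otimes>\<^bsub>K\<^esub> g)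
        = compose P \<xi> const_family f \<otimes>\<^bsub>C\<^esub> compose P \<xi> const_family g"
      using alg_homD(2)[OF const_family_hom fg] hD(2)[OF const_family_M const_family_M, of f g]
      by (simp add: compose_def polynomial_functions.mult del: prod_alg_simps)
    show "compose P \<xi> const_family (f \<oplus>\<^bsub>K\<^esub> g)
        = compose P \<xi> const_family f \<oplus>\<^bsub>C\<^esub> compose P \<xi> const_family g"
      using fg alg_homD(3)[OF const_family_hom fg] hD(3)[OF const_family_M const_family_M, of f g]
      by (simp add: compose_def polynomial_functions.add del: prod_alg_simps)
  next
    fix c f assume f: "f \<in> carrier K"
    then show "compose P \<xi> const_family (c \<odot>\<^bsub>K\<^esub> f) = c \<odot>\<^bsub>C\<^esub> compose P \<xi> const_family f"
      using alg_homD(5)[OF const_family_hom f, of c] hD(5)[OF const_family_M, of f c]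
      by (simp add: compose_def polynomial_functions_scale del: prod_alg_simps)
  next
    show "compose P \<xi> const_family \<one>\<^bsub>K\<^esub> = \<one>\<^bsub>C\<^esub>"
      using alg_homD(4)[OF const_family_hom] hD(4)
      by (simp add: compose_def polynomial_functions.const del: prod_alg_simps)
  qed (use hD(1)[OF const_family_M] in \<open>auto simp: compose_def\<close>)
  have y: "compose Q \<xi> translates \<in> alg_hom KQ C"
  proof (rule alg_homI)
    fix f g assume "f \<in> carrier KQ" "g \<in> carrier KQ"
    then have fg: "f \<in> Q" "g \<in> Q" "f \<in> carrier K" "g \<in> carrier K" using Q_subset_P by auto
    show "compose Q \<xi> translates (f \<otimes>\<^bsub>KQ\<^esub> g)
        = compose Q \<xi> translates f \<otimes>\<^bsub>C\<^esub> compose Q \<xi> translates g"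
      using fg alg_homD(2)[OF translates_hom fg(3,4)] hD(2)[OF translates_M translates_M, of f g]
      by (simp add: compose_def mult_Q del: prod_alg_simps)
    show "compose Q \<xi> translates (f \<oplus>\<^bsub>KQ\<^esub> g)
        = compose Q \<xi> translates f \<oplus>\<^bsub>C\<^esub> compose Q \<xi> translates g"
      using fg alg_homD(3)[OF translates_hom fg(3,4)] hD(3)[OF translates_M translates_M, of f g]
      by (simp add: compose_def add_Q del: prod_alg_simps)
  next
    fix c f assume "f \<in> carrier KQ"
    then have f: "f \<in> Q" "f \<in> carrier K" using Q_subset_P by auto
    then show "compose Q \<xi> translates (c \<odot>\<^bsub>KQ\<^esub> f) = c \<odot>\<^bsub>C\<^esub> compose Q \<xi> translates f"
      using alg_homD(5)[OF translates_hom f(2), of c] hD(5)[OF translates_M, of f c]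
      by (simp add: compose_def mult_Q[OF const_Q] del: prod_alg_simps)
  next
    show "compose Q \<xi> translates \<one>\<^bsub>KQ\<^esub> = \<one>\<^bsub>C\<^esub>"
      using alg_homD(4)[OF translates_hom] hD(4)
      by (simp add: compose_def const_Q del: prod_alg_simps)
  qed (use hD(1)[OF translates_M] in \<open>auto simp: compose_def\<close>)
  have "compose P \<xi> const_family r = compose Q \<xi> translates r" if "r \<in> Inv" for r
    using const_family_Inv[OF that] that Inv_subset_P Inv_subset_Q by (auto simp: compose_def)
  then show ?thesis
    using x y by (simp add: q_k_def pts_FP pts_Spec Spec_map_def)
qed

text \<open>A point is determined by its values on constant families and on families of translates,
  because by surjectivity of \<open>\<Phi>\<close> their products additively span
  \<open>M\<close>.\<close>

lemma q_k_inj: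
  assumes \<Phi>: "restricts_phi \<Phi>" and \<xi>: "\<xi> \<in> pts (Spec KM) C" and \<xi>': "\<xi>' \<in> pts (Spec KM) C"
    and eq: "q_k C \<xi> = q_k C \<xi>'"
  shows "\<xi> = \<xi>'"
proof -
  interpret TQ: cring TQ by (rule TQ_cring)
  note hD = alg_homD[of \<xi> KM C, unfolded KM_simps] and hD' = alg_homD[of \<xi>' KM C, unfolded KM_simps]
  have h: "\<xi> \<in> alg_hom KM C" "\<xi>' \<in> alg_hom KM C" using \<xi> \<xi>' by (simp_all add: pts_Spec)
  have c: "\<xi> (const_family f) = \<xi>' (const_family f)" if "f \<in> P" for f
    using eq that unfolding q_k_def Spec_map_def compose_def
    by (auto dest!: fun_cong[of _ _ f])
  have t: "\<xi> (translates g) = \<xi>' (translates g)" if "g \<in> Q" for g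
    using eq that unfolding q_k_def Spec_map_def compose_def
    by (auto dest!: fun_cong[of _ _ g])
  have on_image: "\<xi> (\<Phi> z) = \<xi>' (\<Phi> z)" if "z \<in> carrier TQ" for z
    using that
  proof (induction z rule: TQ_induct)
    case (pure f g)
    show ?case
      unfolding Phi_pt[OF \<Phi> pure] hD(2)[OF h(1) const_family_M[OF pure(1)] translates_M[OF pure(2)]]
        hD'(2)[OF h(2) const_family_M[OF pure(1)] translates_M[OF pure(2)]] c[OF pure(1)] t[OF pure(2)] ..
  next
    case (add x y)
    show ?case
      unfolding alg_homD(3)[OF Phi_hom[OF \<Phi>] add(1,2)]
        hD(3)[OF h(1) Phi_in_M[OF \<Phi> add(1)] Phi_in_M[OF \<Phi> add(2)]]
        hD'(3)[OF h(2) Phi_in_M[OF \<Phi> add(1)] Phi_in_M[OF \<Phi> add(2)]] add(3,4) ..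
  qed
  have image: "\<Phi> ` carrier TQ = M"
    using Phi_iso[OF \<Phi>] by (simp add: alg_iso_def bij_betw_def)
  have on_M: "\<xi> p = \<xi>' p" if "p \<in> M" for p
    using that unfolding image[symmetric] by (elim imageE) (simp only: on_image)
  have "\<xi> \<in> extensional M" "\<xi>' \<in> extensional M" using \<xi> \<xi>' by (simp_all add: pts_Spec)
  then show ?thesis by (rule extensionalityI) (rule on_M)
qed

text \<open>Agreement of \<open>x\<close> and \<open>y\<close> on invariants lets them combine to a
  homomorphism \<open>h\<close> on the tensor product; the wanted point is \<open>h\<close>
  transported along the inverse of \<open>\<Phi>\<close>.\<close>

lemma q_k_surj:
  assumes \<Phi>: "restricts_phi \<Phi>" and C: "is_k_algebra C" and xy: "(x, y) \<in> pts FP C"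
  shows "\<exists>\<xi>\<in>pts (Spec KM) C. q_k C \<xi> = (x, y)"
proof -
  interpret TQ: cring TQ by (rule TQ_cring)
  interpret C: cring C by (rule k_algebraD(1)[OF C])
  have x: "x \<in> alg_hom K C" "x \<in> extensional P" and y: "y \<in> alg_hom KQ C" "y \<in> extensional Q"
    and eq: "\<And>r. r \<in> Inv \<Longrightarrow> x r = y r"
    using xy by (simp_all add: pts_FP pts_Spec)
  have y': "y \<in> ring_hom KQ C" using y(1) by (simp add: alg_hom_def)
  have "\<exists>h\<in>alg_hom TQ C. \<forall>f\<in>carrier K. \<forall>g\<in>carrier KQ. h (ptQ f g) = x f \<otimes>\<^bsub>C\<^esub> y g"
    by (rule tensor_product.tensor_alg_lift[OF KKQ k_algebraD(1,3)[OF C] _ x(1) y' eq])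
      (auto simp: polynomial_functions.const)
  then obtain h where h: "h \<in> alg_hom TQ C"
    and h_pt: "\<And>f g. f \<in> P \<Longrightarrow> g \<in> Q \<Longrightarrow> h (ptQ f g) = x f \<otimes>\<^bsub>C\<^esub> y g" by auto
  have bij: "bij_betw \<Phi> (carrier TQ) M" using Phi_iso[OF \<Phi>] by (simp add: alg_iso_def)
  define \<xi> where "\<xi> = restrict (\<lambda>p. h (inv_into (carrier TQ) \<Phi> p)) M"
  have \<xi>: "\<xi> (\<Phi> z) = h z" if "z \<in> carrier TQ" for z
    using that Phi_in_M[OF \<Phi> that] bij by (simp add: \<xi>_def bij_betw_def)
  have rep: "\<exists>z\<in>carrier TQ. p = \<Phi> z" if "p \<in> M" for p using bij that by (auto simp: bij_betw_def)
  note \<Phi>D = alg_homD[OF Phi_hom[OF \<Phi>]] and h' = alg_homD[OF h]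
  have "\<xi> \<in> alg_hom KM C"
  proof (rule alg_homI; unfold KM_simps)
    fix p q assume "p \<in> M" "q \<in> M"
    then obtain a b where ab: "a \<in> carrier TQ" "b \<in> carrier TQ" "p = \<Phi> a" "q = \<Phi> b"
      using rep by metis
    show "\<xi> (p \<otimes>\<^bsub>F\<^esub> q) = \<xi> p \<otimes>\<^bsub>C\<^esub> \<xi> q"
      unfolding ab(3,4) \<Phi>D(2)[OF ab(1,2), symmetric] \<xi>[OF ab(1)] \<xi>[OF ab(2)]
        \<xi>[OF TQ.m_closed[OF ab(1,2)]] by (rule h'(2)[OF ab(1,2)])
    show "\<xi> (p \<oplus>\<^bsub>F\<^esub> q) = \<xi> p \<oplus>\<^bsub>C\<^esub> \<xi> q"
      unfolding ab(3,4) \<Phi>D(3)[OF ab(1,2), symmetric] \<xi>[OF ab(1)] \<xi>[OF ab(2)]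
        \<xi>[OF TQ.a_closed[OF ab(1,2)]] by (rule h'(3)[OF ab(1,2)])
  next
    fix p assume "p \<in> M"
    then obtain a where a: "a \<in> carrier TQ" "p = \<Phi> a" using rep by blast
    show "\<xi> p \<in> carrier C" unfolding a(2) \<xi>[OF a(1)] by (rule h'(1)[OF a(1)])
    show "\<xi> (c \<odot>\<^bsub>F\<^esub> p) = c \<odot>\<^bsub>C\<^esub> \<xi> p" for c
      unfolding a(2) \<Phi>D(5)[OF a(1), symmetric] \<xi>[OF a(1)] \<xi>[OF TQ_scale_closed[OF a(1)]]
      by (rule h'(5)[OF a(1)])
  next
    show "\<xi> \<one>\<^bsub>F\<^esub> = \<one>\<^bsub>C\<^esub>" using \<xi>[OF TQ.one_closed] \<Phi>D(4) h'(4) by (simp del: prod_alg_simps)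
  qed
  then have "\<xi> \<in> pts (Spec KM) C" by (simp add: pts_Spec \<xi>_def)
  moreover have "q_k C \<xi> = (x, y)"
  proof -
    have one: "(\<lambda>_. 1) \<in> P" "(\<lambda>_. 1) \<in> Q" by (auto intro: polynomial_functions.const const_Q)
    interpret F: cring F by (rule F_cring)
    have "const_family (\<lambda>_. 1) = \<one>\<^bsub>F\<^esub>" "translates (\<lambda>_. 1) = \<one>\<^bsub>F\<^esub>"
      using alg_homD(4)[OF const_family_hom] alg_homD(4)[OF translates_hom] by simp_all
    moreover have "x (\<lambda>_. 1) = \<one>\<^bsub>C\<^esub>" "y (\<lambda>_. 1) = \<one>\<^bsub>C\<^esub>"
      using alg_homD(4)[OF x(1)] alg_homD(4)[OF y(1)] by (simp_all add: KQ_simps)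
    moreover have "const_family f \<in> carrier F" if "f \<in> P" for f using const_family_M[OF that] M_subset by blast
    moreover have "translates g \<in> carrier F" if "g \<in> Q" for g using translates_M[OF that] M_subset by blast
    moreover have "x f \<in> carrier C" if "f \<in> P" for f using alg_homD(1)[OF x(1)] that by simp
    moreover have "y g \<in> carrier C" if "g \<in> Q" for g using alg_homD(1)[OF y(1)] that by simp
    \<comment> \<open>The components are recovered at f (x) 1 and 1 (x) g, whose images under
      \<open>\<Phi>\<close> are the constant family of f and the translates of g.\<close>
    ultimately have "\<xi> (const_family f) = x f" "\<xi> (translates g) = y g" if "f \<in> P" "g \<in> Q" for f g
      using \<xi>[OF ptQ_closed[OF that(1) one(2)]] \<xi>[OF ptQ_closed[OF one(1) that(2)]]
        Phi_pt[OF \<Phi> that(1) one(2)] Phi_pt[OF \<Phi> one(1) that(2)] h_pt[OF that(1) one(2)]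
        h_pt[OF one(1) that(2)] F.l_one F.r_one that by (simp_all del: prod_alg_simps)
    then have "\<xi> (const_family f) = x f" "\<xi> (translates g) = y g" if "f \<in> P" "g \<in> Q" for f g using that by auto
    then show ?thesis
      unfolding q_k_def Spec_map_def using x(2) y(2) one
      by (auto simp: compose_def KQ_simps fun_eq_iff restrict_def extensional_def)
  qed
  ultimately show ?thesis by blast
qed

lemma functor_isomorphism_q_k: "functor_isomorphism (Spec KM) FP q_k"
  unfolding functor_isomorphism_def functor_morphism_def
proof (intro conjI allI impI)
  obtain \<Phi> where \<Phi>: "restricts_phi \<Phi>" using Phi_exists by blast
  fix C :: "('k, 'c) module" assume C: "is_k_algebra C"
  show "q_k C \<in> pts (Spec KM) C \<rightarrow> pts FP C" using q_k_pts by blast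
  show "bij_betw (q_k C) (pts (Spec KM) C) (pts FP C)"
    unfolding bij_betw_def
  proof
    show "inj_on (q_k C) (pts (Spec KM) C)" by (rule inj_onI) (rule q_k_inj[OF \<Phi>])
    show "q_k C ` pts (Spec KM) C = pts FP C"
    proof (intro equalityI subsetI)
      fix xy assume "xy \<in> pts FP C"
      then obtain \<xi> where "\<xi> \<in> pts (Spec KM) C" "q_k C \<xi> = xy"
        using q_k_surj[OF \<Phi> C, of "fst xy" "snd xy"] by auto
      then show "xy \<in> q_k C ` pts (Spec KM) C" by blast
    qed (use q_k_pts in blast)
  qed
next
  fix C D :: "('k, 'c) module" and h
  \<comment> \<open>\<open>push\<close> composes on the left and \<open>q_k\<close> on the right;
    the comorphisms take values in \<open>M\<close>, so the restrictions to carriers agree.\<close>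
  show "\<forall>\<xi>\<in>pts (Spec KM) C. q_k D (push (Spec KM) h \<xi>) = push FP h (q_k C \<xi>)"
    using const_family_M translates_M
    by (auto simp: q_k_def fibre_product_over_quotient_def fibre_product_def Spec_def Spec_map_def
        compose_def restrict_def fun_eq_iff)
qed

text \<open>Nothing is lost by first restricting \<eta> to \<open>M\<close>, since the comorphism of
  the first component on k[V] and that of the second on the quasi-invariants take values
  there.\<close>

lemma q_k_factor:
  "q_k C (bold_pi_map sc W \<rho> \<alpha> (\<lambda>H. 2 * k H + 1) C \<eta>) =
    map_prod id (pi_map sc W \<rho> \<alpha> k C) (q_map sc W \<rho> C \<eta>)"
proof -
  have q: "q_map sc W \<rho> C \<eta> = (Spec_map K const_family C \<eta>, Spec_map K translates C \<eta>)"
    by (simp add: q_map_def const_family_def[abs_def] translates_def[abs_def])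
  show ?thesis
    unfolding q q_k_def bold_pi_map_def pi_map_def Spec_map_def
    using const_family_M translates_M Q_subset_P
    by (auto simp: compose_def restrict_def fun_eq_iff)
qed

end

theorem proposition2p12:
  fixes sc :: "'k::field_char_0 \<Rightarrow> 'v::ab_group_add \<Rightarrow> 'v"
    and W :: "'w monoid" and S :: "'w set" and \<rho> :: "'w \<Rightarrow> 'v \<Rightarrow> 'v"
    and \<alpha> :: "'v set \<Rightarrow> 'v \<Rightarrow> 'k" and k :: "'v set \<Rightarrow> nat"
  assumes "coxeter_system W S" and "finite (carrier W)"
    and "reflection_representation sc W S \<rho>"
    and "\<forall>H\<in>reflection_hyperplanes sc W \<rho>. linear_form sc (\<alpha> H) \<and> H = {v. \<alpha> H v = 0}"
    and "k \<in> multiplicities sc W \<rho>"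
  shows
    "(\<exists>qk :: ('k, 'c) module \<Rightarrow> (('w \<Rightarrow> 'v \<Rightarrow> 'k) \<Rightarrow> 'c)
              \<Rightarrow> (('v \<Rightarrow> 'k) \<Rightarrow> 'c) \<times> (('v \<Rightarrow> 'k) \<Rightarrow> 'c).
        functor_isomorphism
          (Spec (quasi_covariant_alg sc W \<rho> \<alpha> (\<lambda>H. 2 * k H + 1)))
          (fibre_product_over_quotient sc W \<rho> (quasi_invariant_alg sc W \<rho> \<alpha> k))
          qk \<and>
        (\<forall>C. is_k_algebra C \<longrightarrow> (\<forall>\<eta>\<in>pts (Spec (coord_alg_W sc W)) C.
           qk C (bold_pi_map sc W \<rho> \<alpha> (\<lambda>H. 2 * k H + 1) C \<eta>) =
           map_prod id (pi_map sc W \<rho> \<alpha> k C) (q_map sc W \<rho> C \<eta>))))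
     \<and>
     (\<exists>\<phi> \<in> alg_hom (tensor_alg (invariant_functions sc W \<rho>) (coord_alg sc) (coord_alg sc))
                   (coord_alg_W sc W).
        (\<forall>f\<in>carrier (coord_alg sc). \<forall>g\<in>carrier (coord_alg sc).
           \<phi> (pure_tensor (invariant_functions sc W \<rho>) (coord_alg sc) (coord_alg sc) f g) =
           (\<lambda>w\<in>carrier W. f \<otimes>\<^bsub>coord_alg sc\<^esub> act W \<rho> w g)) \<and>
        (\<exists>\<iota> \<in> alg_hom (tensor_alg (invariant_functions sc W \<rho>) (coord_alg sc) (quasi_invariant_alg sc W \<rho> \<alpha> k))
                      (tensor_alg (invariant_functions sc W \<rho>) (coord_alg sc) (coord_alg sc)).
           (\<forall>f\<in>carrier (coord_alg sc). \<forall>g\<in>carrier (quasi_invariant_alg sc W \<rho> \<alpha> k).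
              \<iota> (pure_tensor (invariant_functions sc W \<rho>) (coord_alg sc) (quasi_invariant_alg sc W \<rho> \<alpha> k) f g) =
              pure_tensor (invariant_functions sc W \<rho>) (coord_alg sc) (coord_alg sc) f g) \<and>
           \<phi> \<circ> \<iota> \<in> alg_iso
             (tensor_alg (invariant_functions sc W \<rho>) (coord_alg sc) (quasi_invariant_alg sc W \<rho> \<alpha> k))
             (quasi_covariant_alg sc W \<rho> \<alpha> (\<lambda>H. 2 * k H + 1))))"
proof -
  interpret quasi_invariant_data sc W S \<rho> \<alpha> k
    by unfold_locales (fact assms)+
  have family: "const_family f \<otimes>\<^bsub>F\<^esub> translates g = (\<lambda>w\<in>carrier W. f \<otimes>\<^bsub>K\<^esub> act W \<rho> w g)" for f g
    unfolding const_times_translates by (simp add: act_def)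
  show ?thesis
  proof (rule conjI, goal_cases)
    case 1
    show ?case using functor_isomorphism_q_k q_k_factor by blast
  next
    case 2
    obtain \<phi> \<iota> where \<phi>: "\<phi> \<in> alg_hom (tensor_alg Inv K K) F"
      "\<And>f g. f \<in> P \<Longrightarrow> g \<in> P \<Longrightarrow> \<phi> (ptK f g) = const_family f \<otimes>\<^bsub>F\<^esub> translates g"
      and \<iota>: "\<iota> \<in> alg_hom TQ (tensor_alg Inv K K)"
      "\<And>f g. f \<in> P \<Longrightarrow> g \<in> Q \<Longrightarrow> \<iota> (ptQ f g) = ptK f g"
      and \<Phi>: "restricts_phi (\<phi> \<circ> \<iota>)" using Phi_exists by blast
    show ?case
    proof (intro bexI[OF _ \<phi>(1)] bexI[OF _ \<iota>(1)] conjI ballI)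
      show "\<phi> \<circ> \<iota> \<in> alg_iso TQ KM" by (rule Phi_iso[OF \<Phi>])
    next
      fix f g assume "f \<in> carrier K" "g \<in> carrier K"
      then show "\<phi> (ptK f g) = (\<lambda>w\<in>carrier W. f \<otimes>\<^bsub>K\<^esub> act W \<rho> w g)"
        unfolding family[symmetric] by (intro \<phi>(2)) simp_all
    next
      fix f g assume "f \<in> carrier K" "g \<in> carrier KQ"
      then show "\<iota> (ptQ f g) = ptK f g" by (intro \<iota>(2)) simp_all
    qed
  qed
qed

end
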